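(* Suppose $M/K$ is obtained by general normal magnification from $L/K$ through $J/K$. (1) Let the unique descending chain for $L/K$ be $L=N_0\supsetneq N_1\supsetneq\dots\supsetneq N_k$ and the unique descending chain for $J/K$ be $J=N'_0\supsetneq N'_1\supsetneq\dots\supsetneq N'_{k'}$. Then the unique descending chain for $M/K$ is $$M=N_0N'_0\supsetneq N_1N'_1\supsetneq\dots\supsetneq N_{k'}N'_{k'}\supsetneq N_{k'+1}N'_{k'}\supsetneq\dots\supsetneq N_kN'_{k'}$$ if $k\ge k'$, and $$M=N_0N'_0\supsetneq N_1N'_1\supsetneq\dots\supsetneq N_kN'_k\supsetneq N_kN'_{k+1}\supsetneq\dots\supsetneq N_kN'_{k'}$$ if $k<k'$. (2) Let the unique ascending chain for $L/K$ be $K=F_0\subsetneq F_1\subsetneq\dots\subsetneq F_l$ and the unique ascending chain for $J/K$ be $K=F'_0\subsetneq F'_1\subsetneq\dots\subsetneq F'_{l'}$. Then the unique ascending chain for $M/K$ is $$K=F_0F'_0\subsetneq F_1F'_1\subsetneq\dots\subsetneq F_{l'}F'_{l'}\subsetneq F_{l'+1}F'_{l'}\subsetneq\dots\subsetneq F_lF'_{l'}$$ if $l\ge l'$, and $$K=F_0F'_0\subsetneq F_1F'_1\subsetneq\dots\subsetneq F_lF'_l\subsetneq F_lF'_{l+1}\subsetneq\dots\subsetneq F_lF'_{l'}$$ if $l<l'$.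
   Context: $K$ is any field (not necessarily perfect) with a fixed algebraic closure $\bar K$; all extensions are finite and contained in $\bar K$. A finite extension $M/K$ is obtained by general normal magnification from a subextension $L/K$ through a finite extension $J/K$ if $[L:K]>1$, the normal closures $\tilde L,\tilde J$ of $L/K,J/K$ in $\bar K$ are linearly disjoint over $K$, and $LJ=M$. For a finite extension $E/K$ there is a unique intermediate field $N$ such that $E/N$ is Galois of maximum possible degree, namely $N=E^{\mathrm{Aut}(E/K)}$; and a unique largest Galois subextension $F/K$ of $E/K$. The unique descending chain for $E/K$ is the strictly descending chain $E=N_0\supsetneq N_1\supsetneq\dots\supsetneq N_k$ in which $N_i$ is the unique intermediate field of $N_{i-1}/K$ with $N_{i-1}/N_i$ Galois of maximum possible degree, continued until it stabilizes (so $|\mathrm{Aut}(N_k/K)|=1$). The unique ascending chain for $E/K$ is the strictly ascending chain $K=F_0\subsetneq F_1\subsetneq\dots\subsetneq F_l$ in which $F_j$ is the largest Galois subextension of $E/F_{j-1}$, continued until it stabilizes (so the largest Galois subextension of $E/F_l$ is $F_l$). Chains may consist of a single field. *)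

theory Defs
  imports "HOL-Algebra.Algebra" "HOL-Algebra.Algebraic_Closure"
begin

text \<open>Throughout, \<open>\<Omega>\<close> is the ambient algebraically closed field; every field extension \<open>E/K\<close>
  is given by two subfields \<open>K \<subseteq> E\<close> of \<open>\<Omega>\<close>, represented by their carrier sets.\<close>

definition field_ext :: "('a, 'b) ring_scheme \<Rightarrow> 'a set \<Rightarrow> 'a set \<Rightarrow> bool"
  where "field_ext \<Omega> K E \<longleftrightarrow> subfield K \<Omega> \<and> subfield E \<Omega> \<and> K \<subseteq> E"

definition finite_field_ext :: "('a, 'b) ring_scheme \<Rightarrow> 'a set \<Rightarrow> 'a set \<Rightarrow> bool"
  where "finite_field_ext \<Omega> K E \<longleftrightarrow> field_ext \<Omega> K E \<and> ring.finite_dimension \<Omega> K E"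

definition algebraic_field_ext :: "('a, 'b) ring_scheme \<Rightarrow> 'a set \<Rightarrow> 'a set \<Rightarrow> bool"
  where "algebraic_field_ext \<Omega> K E \<longleftrightarrow> field_ext \<Omega> K E \<and> (\<forall>x\<in>E. ring.algebraic \<Omega> K x)"

definition intermediate_field :: "('a, 'b) ring_scheme \<Rightarrow> 'a set \<Rightarrow> 'a set \<Rightarrow> 'a set \<Rightarrow> bool"
  where "intermediate_field \<Omega> K E N \<longleftrightarrow> field_ext \<Omega> K N \<and> field_ext \<Omega> N E"

definition compositum :: "('a, 'b) ring_scheme \<Rightarrow> 'a set \<Rightarrow> 'a set \<Rightarrow> 'a set"
  where "compositum \<Omega> A B = generate_field \<Omega> (A \<union> B)"

text \<open>Note that splitting is required in \<open>E[X]\<close>, hence the restricted carrier.\<close>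

definition normal_ext :: "('a, 'b) ring_scheme \<Rightarrow> 'a set \<Rightarrow> 'a set \<Rightarrow> bool"
  where "normal_ext \<Omega> K E \<longleftrightarrow>
    algebraic_field_ext \<Omega> K E \<and>
    (\<forall>p \<in> carrier (K[X]\<^bsub>\<Omega>\<^esub>).
       pirreducible\<^bsub>\<Omega>\<^esub> K p \<longrightarrow> (\<exists>x\<in>E. ring.eval \<Omega> p x = \<zero>\<^bsub>\<Omega>\<^esub>) \<longrightarrow>
       ring.splitted (\<Omega>\<lparr>carrier := E\<rparr>) p)"

text \<open>Minimal polynomials have only simple roots; as \<open>\<Omega>\<close> is algebraically closed, it suffices
  to count multiplicities in \<open>\<Omega>\<close>.\<close>

definition separable_ext :: "('a, 'b) ring_scheme \<Rightarrow> 'a set \<Rightarrow> 'a set \<Rightarrow> bool"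
  where "separable_ext \<Omega> K E \<longleftrightarrow>
    algebraic_field_ext \<Omega> K E \<and>
    (\<forall>x\<in>E. \<forall>a \<in> carrier \<Omega>. ring.alg_mult \<Omega> (ring.Irr \<Omega> K x) a \<le> 1)"

definition galois_ext :: "('a, 'b) ring_scheme \<Rightarrow> 'a set \<Rightarrow> 'a set \<Rightarrow> bool"
  where "galois_ext \<Omega> K E \<longleftrightarrow> normal_ext \<Omega> K E \<and> separable_ext \<Omega> K E"

definition normal_closure :: "('a, 'b) ring_scheme \<Rightarrow> 'a set \<Rightarrow> 'a set \<Rightarrow> 'a set"
  where "normal_closure \<Omega> K L = \<Inter> {E. L \<subseteq> E \<and> normal_ext \<Omega> K E}"

definition linearly_disjoint :: "('a, 'b) ring_scheme \<Rightarrow> 'a set \<Rightarrow> 'a set \<Rightarrow> 'a set \<Rightarrow> bool"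
  where "linearly_disjoint \<Omega> K E F \<longleftrightarrow>
    (\<forall>us. set us \<subseteq> E \<longrightarrow> ring.independent \<Omega> K us \<longrightarrow> ring.independent \<Omega> F us)"

text \<open>\<open>M/K\<close> is obtained from \<open>L/K\<close> through \<open>J/K\<close>.\<close>

definition general_normal_magnification ::
    "('a, 'b) ring_scheme \<Rightarrow> 'a set \<Rightarrow> 'a set \<Rightarrow> 'a set \<Rightarrow> 'a set \<Rightarrow> bool"
  where "general_normal_magnification \<Omega> K L J M \<longleftrightarrow>
    finite_field_ext \<Omega> K M \<and> intermediate_field \<Omega> K M L \<and> finite_field_ext \<Omega> K J \<and>
    ring.dim \<Omega> K L > 1 \<and>
    linearly_disjoint \<Omega> K (normal_closure \<Omega> K L) (normal_closure \<Omega> K J) \<and>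
    compositum \<Omega> L J = M"

text \<open>\<open>N\<close> is the unique intermediate field of \<open>E/K\<close> such that \<open>E/N\<close> is Galois of maximum
  possible degree.\<close>

definition max_galois_base :: "('a, 'b) ring_scheme \<Rightarrow> 'a set \<Rightarrow> 'a set \<Rightarrow> 'a set \<Rightarrow> bool"
  where "max_galois_base \<Omega> K E N \<longleftrightarrow>
    intermediate_field \<Omega> K E N \<and> galois_ext \<Omega> N E \<and>
    (\<forall>N'. intermediate_field \<Omega> K E N' \<and> galois_ext \<Omega> N' E \<longrightarrow>
       ring.dim \<Omega> N' E \<le> ring.dim \<Omega> N E \<and>
       (ring.dim \<Omega> N' E = ring.dim \<Omega> N E \<longrightarrow> N' = N))"

definition largest_galois_subext :: "('a, 'b) ring_scheme \<Rightarrow> 'a set \<Rightarrow> 'a set \<Rightarrow> 'a set \<Rightarrow> bool"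
  where "largest_galois_subext \<Omega> K E F \<longleftrightarrow>
    intermediate_field \<Omega> K E F \<and> galois_ext \<Omega> K F \<and>
    (\<forall>F'. intermediate_field \<Omega> K E F' \<and> galois_ext \<Omega> K F' \<longrightarrow> F' \<subseteq> F)"

text \<open>A chain with last index \<open>k\<close> is a sequence of which only the entries \<open>0, \<dots>, k\<close> matter.
  The last conjunct in each definition says that the process has stabilized at index \<open>k\<close>.\<close>

definition descending_chain ::
    "('a, 'b) ring_scheme \<Rightarrow> 'a set \<Rightarrow> 'a set \<Rightarrow> nat \<Rightarrow> (nat \<Rightarrow> 'a set) \<Rightarrow> bool"
  where "descending_chain \<Omega> K E k N \<longleftrightarrow>
    N 0 = E \<and>
    (\<forall>i<k. N (Suc i) \<subset> N i \<and> max_galois_base \<Omega> K (N i) (N (Suc i))) \<and>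
    max_galois_base \<Omega> K (N k) (N k)"

definition ascending_chain ::
    "('a, 'b) ring_scheme \<Rightarrow> 'a set \<Rightarrow> 'a set \<Rightarrow> nat \<Rightarrow> (nat \<Rightarrow> 'a set) \<Rightarrow> bool"
  where "ascending_chain \<Omega> K E l F \<longleftrightarrow>
    F 0 = K \<and>
    (\<forall>j<l. F j \<subset> F (Suc j) \<and> largest_galois_subext \<Omega> (F j) E (F (Suc j))) \<and>
    largest_galois_subext \<Omega> (F l) E (F l)"

end

theory Submission
  imports Defs "HOL-Computational_Algebra.Primes"
begin

text \<open>No Galois group is ever formed: everything is phrased through embeddings over a base field
  into the algebraically closed field \<open>\<Omega>\<close>, which act on \<open>E/F\<close> whenever they map \<open>E\<close> into itself.

  Let \<open>P\<close>, \<open>Q\<close> be the normal closures of \<open>L\<close>, \<open>J\<close>. Linear disjointness makes a \<open>K\<close>-basis \<open>us\<close> of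
  \<open>J\<close> independent over \<open>P\<close>, so an element of \<open>LJ\<close> has unique coordinates with respect to \<open>us\<close>; in
  particular \<open>EJ \<inter> P = E\<close> and \<open>FJ \<inter> LF' = FF'\<close> for subfields \<open>E\<close>, \<open>F\<close> of \<open>L\<close> and \<open>F'\<close> of \<open>J\<close>.

  Descending chains: the base of maximal degree is the least base over which the field is Galois. If
  \<open>LJ/N\<close> is Galois, its embeddings preserve \<open>LJ \<inter> P = L\<close>, so by Artin's theorem \<open>L/(N \<inter> L)\<close> is Galois.

  Ascending chains: let \<open>x = \<Sum> l\<^sub>i u\<^sub>i\<close> lie in a Galois subextension of \<open>LJ/AA'\<close>. Applying embeddings over
  \<open>AJ\<close> shows that all \<open>A\<close>-conjugates of the \<open>l\<^sub>i\<close> lie in \<open>L\<close>. Some power \<open>l\<^sub>i\<^sup>q\<close> by an exponent for which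
  taking powers is injective is separable over \<open>A\<close>, hence lies in the largest Galois subextension \<open>F\<close>
  of \<open>L/A\<close>. So every embedding over \<open>FJ\<close> fixes all \<open>l\<^sub>i\<close> and \<open>x\<close>, and \<open>x \<in> FJ\<close> since \<open>x\<close> is separable.\<close>

section \<open>Conjugates and separable elements\<close>

text \<open>Coordinates are compared over \<open>P\<close> rather than over \<open>L\<close> because
  an embedding over \<open>AJ\<close> may move the \<open>l\<^sub>i\<close> out of \<open>L\<close>,
  but only to \<open>K\<close>-conjugates, which stay in \<open>P\<close>. If it sends
  \<open>x\<close> back into \<open>LJ\<close>, the image has coordinates in \<open>L\<close>; by
  uniqueness over \<open>P\<close> these are the images of the \<open>l\<^sub>i\<close>. That such
  embeddings reach every \<open>A\<close>-conjugate of \<open>l\<^sub>i\<close> is again due to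
  disjointness: adjoining \<open>J\<close> to \<open>A\<close> loses no conjugate of an element of
  \<open>P\<close>.

  Over an imperfect field, having all conjugates in \<open>L\<close> does not make
  \<open>l\<^sub>i\<close> separable, so \<open>l\<^sub>i\<close> may lie outside \<open>F\<close>.
  The exponent \<open>q\<close> repairs this: it is 1 or a power of the characteristic, so an
  embedding that fixes \<open>l\<^sub>i\<^sup>q\<close> fixes \<open>l\<^sub>i\<close>. For the same
  reason separability is handled element by element, also inside fields that are not separable over
  the base.

  The degree condition on descending chains becomes one on inclusions because the intersection of
  two bases over which \<open>E\<close> is Galois is a third such base. A chain that has stabilized
  can be continued by its last field, so chains of different lengths are combined index by
  index.\<close>

lemma (in domain) subalgebraI_subfield:
  assumes "subfield F R" "subfield E R" "F \<subseteq> E"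
  shows "subalgebra F E R"
proof -
  have "subgroup E (add_monoid R)"
    using assms(2) subfieldE(1) subring.axioms(1) by blast
  thus ?thesis
    using subringE(6)[OF subfieldE(1)[OF assms(2)]] assms(3)
    unfolding subalgebra_def subalgebra_axioms_def by blast
qed

lemma (in ring) Span_mono_field:
  assumes "subfield F R" "subfield B R" "F \<subseteq> B" "set us \<subseteq> carrier R"
  shows "Span F us \<subseteq> Span B us"
  using Span_eq_combine_set[OF assms(1,4)] Span_eq_combine_set[OF assms(2,4)] assms(3) by blast

locale closed_field = algebraically_closed \<Omega> for \<Omega> (structure)
begin

lemma finite_field_ext_subfields:
  assumes "finite_field_ext \<Omega> F E"
  shows "subfield F \<Omega>" "subfield E \<Omega>" "F \<subseteq> E" "E \<subseteq> carrier \<Omega>" "F \<subseteq> carrier \<Omega>"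
    "finite_dimension F E"
  using assms subfieldE(3) unfolding finite_field_ext_def field_ext_def by blast+

lemma finite_field_ext_algebraic:
  assumes "finite_field_ext \<Omega> F E" "x \<in> E"
  shows "(algebraic over F) x"
  using finite_dimension_imp_algebraic finite_field_ext_subfields[OF assms(1)] assms(2) subfieldE(1)
  by blast

text \<open>For the upper step, a list spanning \<open>E\<close> over \<open>F\<close> still spans
  it over \<open>B\<close>; it need not stay independent, but a finite spanning list is
  enough.\<close>

lemma finite_field_ext_between:
  assumes "finite_field_ext \<Omega> F E" "subfield B \<Omega>" "F \<subseteq> B" "B \<subseteq> E"
  shows "finite_field_ext \<Omega> F B" "finite_field_ext \<Omega> B E"
proof -
  note E = finite_field_ext_subfields[OF assms(1)]
  show "finite_field_ext \<Omega> F B"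
    using subalbegra_incl_imp_finite_dimension[OF E(1,6) subalgebraI_subfield[OF E(1) assms(2,3)] assms(4)]
      E assms unfolding finite_field_ext_def field_ext_def by blast
  obtain n where "dimension n F E" using E(6) by blast
  then obtain us where us: "set us \<subseteq> carrier \<Omega>" "Span F us = E"
    using exists_base[OF E(1)] by blast
  have usE: "set us \<subseteq> E" using Span_base_incl[OF E(1) us(1)] us(2) by blast
  have "Span B us \<subseteq> E"
    using subalgebra_Span_incl[OF assms(2) subalgebraI_subfield[OF assms(2) E(2) assms(4)] usE] .
  moreover have "E \<subseteq> Span B us" using Span_mono_field[OF E(1) assms(2,3) us(1)] us(2) by blast
  ultimately have "Span B us = E" by blast
  hence "finite_dimension B E" using Span_finite_dimension[OF assms(2) us(1)] by simp
  thus "finite_field_ext \<Omega> B E"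
    using assms E unfolding finite_field_ext_def field_ext_def by blast
qed

lemma finite_field_ext_refl:
  assumes "subfield F \<Omega>" shows "finite_field_ext \<Omega> F F"
  using assms dimension_one[OF assms] finite_dimensionI unfolding finite_field_ext_def field_ext_def by blast

lemma finite_field_ext_trans:
  assumes "finite_field_ext \<Omega> F B" "finite_field_ext \<Omega> B E"
  shows "finite_field_ext \<Omega> F E"
  using assms telescopic_base_dim(1)[of F B E] unfolding finite_field_ext_def field_ext_def by blast

lemma finite_field_ext_basis:
  assumes "finite_field_ext \<Omega> F E"
  obtains us where "set us \<subseteq> E" "independent F us" "Span F us = E" "length us = dim F E"
proof -
  note E = finite_field_ext_subfields[OF assms]
  have "dimension (dim F E) F E" using finite_dimensionE[OF E(1,6)] unfolding over_def .
  then obtain us where us: "set us \<subseteq> carrier \<Omega>" "independent F us" "length us = dim F E" "Span F us = E"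
    using exists_base[OF E(1)] by blast
  thus ?thesis using that[of us] Span_base_incl[OF E(1) us(1)] by auto
qed

lemma finite_field_ext_dim_less:
  assumes "finite_field_ext \<Omega> F E" "finite_field_ext \<Omega> F B" "B \<subset> E"
  shows "dim F B < dim F E"
proof -
  note E = finite_field_ext_subfields[OF assms(1)]
  obtain us where us: "set us \<subseteq> B" "independent F us" "Span F us = B" "length us = dim F B"
    using finite_field_ext_basis[OF assms(2)] .
  have d: "dimension (dim F E) F E" using finite_dimensionE[OF E(1,6)] unfolding over_def .
  have "set us \<subseteq> E" using us(1) assms(3) by blast
  hence "length us \<le> dim F E" "length us \<noteq> dim F E"
    using independent_length_le_dimension[OF E(1) d us(2)] independent_length_eq_dimension[OF E(1) d us(2)]
      us(3) assms(3) by blast+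
  thus ?thesis using us(4) by simp
qed

text \<open>Conjugates are roots of the minimal polynomial in all of \<open>\<Omega>\<close>. Their
  description as images under embeddings is recovered by \<open>embedding_conjugates\<close> and
  \<open>embedding_to_conjugate\<close>.\<close>

definition conjugates :: "'a set \<Rightarrow> 'a \<Rightarrow> 'a set"
  where "conjugates F x = {y \<in> carrier \<Omega>. eval (Irr F x) y = \<zero>}"

text \<open>The condition of \<open>separable_ext\<close> for a single element, so that it can be
  used for elements of inseparable extensions.\<close>

definition separable_over :: "'a set \<Rightarrow> 'a \<Rightarrow> bool"
  where "separable_over F x \<longleftrightarrow> (\<forall>a \<in> carrier \<Omega>. alg_mult (Irr F x) a \<le> 1)"

lemma Irr_poly_ring:
  assumes "subfield F \<Omega>" "x \<in> carrier \<Omega>" "(algebraic over F) x"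
  shows "Irr F x \<in> carrier (poly_ring \<Omega>)" "Irr F x \<noteq> []"
  using IrrE[OF assms] carrier_polynomial_shell[OF subfieldE(1)[OF assms(1)]]
    pirreducibleE(1)[OF subfieldE(1)[OF assms(1)]] by blast+

lemma conjugates_carrier: "conjugates F x \<subseteq> carrier \<Omega>"
  unfolding conjugates_def by blast

lemma conjugates_self:
  assumes "subfield F \<Omega>" "x \<in> carrier \<Omega>" "(algebraic over F) x"
  shows "x \<in> conjugates F x"
  using IrrE(4)[OF assms] assms(2) unfolding conjugates_def by blast

lemma conjugates_eq_roots:
  assumes "subfield F \<Omega>" "x \<in> carrier \<Omega>" "(algebraic over F) x"
  shows "conjugates F x = set_mset (roots (Irr F x))"
  using roots_mem_iff_is_root[OF Irr_poly_ring(1)[OF assms]] Irr_poly_ring(2)[OF assms]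
  unfolding conjugates_def is_root_def by blast

lemma conjugates_finite:
  assumes "subfield F \<Omega>" "x \<in> carrier \<Omega>" "(algebraic over F) x"
  shows "finite (conjugates F x)"
  using conjugates_eq_roots[OF assms] by simp

lemma conjugate_root:
  assumes "subfield F \<Omega>" "x \<in> carrier \<Omega>" "(algebraic over F) x"
    and "p \<in> carrier (F[X])" "eval p x = \<zero>" "y \<in> conjugates F x"
  shows "eval p y = \<zero>"
  using pdivides_imp_root_sharing[OF Irr_poly_ring(1)[OF assms(1-3)] Irr_minimal[OF assms(1-5)]]
    assms(6) unfolding conjugates_def by blast

text \<open>\<open>Irr F x\<close> is monic, irreducible over \<open>F\<close> and vanishes at
  \<open>y\<close>, which characterizes the minimal polynomial of \<open>y\<close>.\<close>

lemma Irr_conjugate: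
  assumes "subfield F \<Omega>" "x \<in> carrier \<Omega>" "(algebraic over F) x" "y \<in> conjugates F x"
  shows "(algebraic over F) y" "Irr F y = Irr F x"
proof -
  have y: "y \<in> carrier \<Omega>" "eval (Irr F x) y = \<zero>" using assms(4) unfolding conjugates_def by auto
  show alg: "(algebraic over F) y"
    using algebraicI[OF IrrE(1)[OF assms(1-3)] Irr_poly_ring(2)[OF assms(1-3)] y(2)] .
  show "Irr F y = Irr F x"
    using minimal_polynomial_is_unique[OF assms(1) y(1) alg] IrrE[OF assms(1) y(1) alg]
      IrrE(1-3)[OF assms(1-3)] y(2) by blast
qed

lemma conjugates_conjugate:
  assumes "subfield F \<Omega>" "x \<in> carrier \<Omega>" "(algebraic over F) x" "y \<in> conjugates F x"
  shows "conjugates F y = conjugates F x" "separable_over F y = separable_over F x"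
  using Irr_conjugate[OF assms] unfolding conjugates_def separable_over_def by auto

lemma poly_ring_mono: "F \<subseteq> B \<Longrightarrow> carrier (F[X]) \<subseteq> carrier (B[X])"
  unfolding univ_poly_def polynomial_def by auto

text \<open>Over the larger field the minimal polynomial divides the old one. Keeping multiplicities
  in the conclusion yields both the inclusion of conjugates and the inheritance of
  separability.\<close>

lemma Irr_roots_mono:
  assumes "subfield F \<Omega>" "subfield B \<Omega>" "F \<subseteq> B" "x \<in> carrier \<Omega>" "(algebraic over F) x"
  shows "roots (Irr B x) \<subseteq># roots (Irr F x)"
proof -
  have alg: "(algebraic over B) x" using algebraic_mono[of F B x] assms(3,5) unfolding over_def by blast
  have "Irr F x \<in> carrier (B[X])" using IrrE(1)[OF assms(1,4,5)] poly_ring_mono[OF assms(3)] by blast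
  hence "Irr B x pdivides Irr F x"
    using Irr_minimal[OF assms(2,4) alg] IrrE(4)[OF assms(1,4,5)] by blast
  thus ?thesis
    using pdivides_imp_roots_incl Irr_poly_ring[OF assms(1,4,5)] Irr_poly_ring(1)[OF assms(2,4) alg] by blast
qed

lemma conjugates_mono:
  assumes "subfield F \<Omega>" "subfield B \<Omega>" "F \<subseteq> B" "x \<in> carrier \<Omega>" "(algebraic over F) x"
  shows "conjugates B x \<subseteq> conjugates F x"
proof -
  have alg: "(algebraic over B) x" using algebraic_mono[of F B x] assms(3,5) unfolding over_def by blast
  show ?thesis
    using set_mset_mono[OF Irr_roots_mono[OF assms]] conjugates_eq_roots[OF assms(1,4,5)]
      conjugates_eq_roots[OF assms(2,4) alg] by simp
qed

lemma separable_over_iff_count: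
  assumes "subfield F \<Omega>" "x \<in> carrier \<Omega>" "(algebraic over F) x"
  shows "separable_over F x \<longleftrightarrow> (\<forall>a. count (roots (Irr F x)) a \<le> 1)"
proof -
  \<comment> \<open>Outside the carrier \<open>alg_mult\<close> takes the default value 0, so the
    bound may be stated for every \<open>a\<close>, as multiset arguments require.\<close>
  have "a \<notin> carrier \<Omega> \<Longrightarrow> alg_mult (Irr F x) a = 0" for a unfolding alg_mult_def by auto
  thus ?thesis
    unfolding separable_over_def alg_mult_eq_count_roots[OF Irr_poly_ring(1)[OF assms], symmetric]
    by (metis zero_le)
qed

lemma separable_over_mono:
  assumes "subfield F \<Omega>" "subfield B \<Omega>" "F \<subseteq> B" "x \<in> carrier \<Omega>" "(algebraic over F) x"
    and "separable_over F x"
  shows "separable_over B x"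
proof -
  have alg: "(algebraic over B) x" using algebraic_mono[of F B x] assms(3,5) unfolding over_def by blast
  show ?thesis
    using mset_subset_eq_count[OF Irr_roots_mono[OF assms(1-5)]] assms(6)
    unfolding separable_over_iff_count[OF assms(1,4,5)] separable_over_iff_count[OF assms(2,4) alg]
    by (meson le_trans)
qed

lemma card_roots_le_degree:
  assumes "p \<in> carrier (poly_ring \<Omega>)" "p \<noteq> []" "S \<subseteq> carrier \<Omega>" "\<And>s. s \<in> S \<Longrightarrow> eval p s = \<zero>"
  shows "card S \<le> degree p"
proof -
  have "S \<subseteq> set_mset (roots p)"
    using assms roots_mem_iff_is_root[OF assms(1)] unfolding is_root_def by blast
  hence "card S \<le> card (set_mset (roots p))" by (simp add: card_mono)
  also have "\<dots> \<le> size (roots p)"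
    by (metis mset_set_set_mset_msubset size_mset_mono size_mset_set)
  finally show ?thesis using size_roots_le_degree[OF assms(1)] by simp
qed

text \<open>Over \<open>\<Omega>\<close> the polynomial splits, so its roots with multiplicity are
  as many as its degree; separability makes the multiset of roots a set.\<close>

lemma card_conjugates_separable:
  assumes "subfield F \<Omega>" "x \<in> carrier \<Omega>" "(algebraic over F) x" "separable_over F x"
  shows "card (conjugates F x) = degree (Irr F x)"
proof -
  let ?r = "roots (Irr F x)"
  have "?r = mset_set (set_mset ?r)"
  proof (rule multiset_eqI)
    fix a
    have "count ?r a \<le> 1" using assms(4) separable_over_iff_count[OF assms(1-3)] by blast
    thus "count ?r a = count (mset_set (set_mset ?r)) a"
    proof (cases "a \<in># ?r")
      case True
      hence "count ?r a = 1"
        using \<open>count ?r a \<le> 1\<close> count_greater_zero_iff[of ?r a] by linarith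
      thus ?thesis using True by simp
    next
      case False
      thus ?thesis by (simp add: not_in_iff)
    qed
  qed
  hence "card (set_mset ?r) = size ?r" by (metis size_mset_set)
  thus ?thesis using conjugates_eq_roots[OF assms(1-3)] roots_over_carrier[OF Irr_poly_ring(1)[OF assms(1-3)]]
    unfolding splitted_def by simp
qed

lemma algebraic_field_extI:
  assumes "finite_field_ext \<Omega> F E" shows "algebraic_field_ext \<Omega> F E"
  using assms finite_field_ext_algebraic[OF assms]
  unfolding algebraic_field_ext_def finite_field_ext_def over_def by blast

section \<open>Embeddings\<close>

lemma exists_root:
  assumes "p \<in> carrier (poly_ring \<Omega>)" "degree p \<ge> 1"
  obtains y where "y \<in> carrier \<Omega>" "eval p y = \<zero>"
proof -
  have "size (roots p) \<ge> 1" using roots_over_carrier[OF assms(1)] assms(2) unfolding splitted_def by simp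
  then obtain y where "y \<in># roots p" by (metis multiset_nonemptyE not_one_le_zero size_empty)
  thus ?thesis using that roots_mem_iff_is_root[OF assms(1)] unfolding is_root_def by blast
qed

text \<open>An irreducible polynomial vanishing at \<open>x\<close> is associated to
  \<open>Irr F x\<close>. This reduces the arbitrary irreducible polynomials in
  \<open>normal_ext\<close> to minimal polynomials.\<close>

lemma pirreducible_root_conjugates:
  assumes "subfield F \<Omega>" "p \<in> carrier (F[X])" "pirreducible F p"
    and "x \<in> carrier \<Omega>" "eval p x = \<zero>" "y \<in> carrier \<Omega>" "eval p y = \<zero>"
  shows "y \<in> conjugates F x"
proof -
  have "p \<noteq> []" using pirreducibleE(1)[OF subfieldE(1)[OF assms(1)] assms(2,3)] .
  hence alg: "(algebraic over F) x" using algebraicI[OF assms(2)] assms(5) by blast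
  note I = IrrE[OF assms(1,4) alg]
  have "Irr F x divides\<^bsub>F[X]\<^esub> p"
    using Irr_minimal[OF assms(1,4) alg assms(2,5)] pdivides_iff_shell[OF assms(1) I(1) assms(2)] by blast
  hence "Irr F x \<sim>\<^bsub>F[X]\<^esub> p"
    using divides_pirreducible_condition[OF assms(3) I(1)]
      pirreducibleE(2)[OF subfieldE(1)[OF assms(1)] I(1,2)] by blast
  hence "p pdivides Irr F x"
    using pdivides_iff_shell[OF assms(1) assms(2) I(1)] unfolding associated_def by blast
  hence "eval (Irr F x) y = \<zero>"
    using pdivides_imp_root_sharing[OF carrier_polynomial_shell[OF subfieldE(1)[OF assms(1)] assms(2)]]
      assms(6,7) by blast
  thus ?thesis using assms(6) unfolding conjugates_def by blast
qed

lemma degree_one_root_mem: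
  assumes "subfield E \<Omega>" "q \<in> carrier (E[X])" "degree q = 1" "y \<in> carrier \<Omega>" "eval q y = \<zero>"
  shows "y \<in> E"
proof -
  have "q \<noteq> []" using assms(3) by auto
  hence "y = \<ominus> (inv (lead_coeff q) \<otimes> const_term q)"
    using degree_one_root_condition[OF carrier_polynomial_shell[OF subfieldE(1)[OF assms(1)] assms(2)] assms(3), of y]
      assms(4,5) unfolding is_root_def by blast
  moreover have "inv (lead_coeff q) \<otimes> const_term q \<in> E" using degree_one_root(2)[OF assms(1-3)] .
  ultimately show ?thesis using subringE(5)[OF subfieldE(1)[OF assms(1)]] by simp
qed

text \<open>\<open>Irr E y\<close> is an irreducible factor of a polynomial that splits over
  \<open>E\<close>, so it is linear and its root \<open>y\<close> lies in \<open>E\<close>.\<close>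

lemma splitted_subfield_root_mem:
  assumes "subfield E \<Omega>" "p \<in> carrier (E[X])" "p \<noteq> []" "ring.splitted (\<Omega>\<lparr>carrier := E\<rparr>) p"
    and "y \<in> carrier \<Omega>" "eval p y = \<zero>"
  shows "y \<in> E"
proof -
  interpret E: field "\<Omega>\<lparr>carrier := E\<rparr>" using subfield_iff(2)[OF assms(1)] .
  have c: "poly_ring (\<Omega>\<lparr>carrier := E\<rparr>) = E[X]"
    using univ_poly_consistent[OF subfieldE(1)[OF assms(1)]] by simp
  have alg: "(algebraic over E) y" using algebraicI[OF assms(2,3,6)] .
  note I = IrrE[OF assms(1,5) alg]
  have "Irr E y divides\<^bsub>E[X]\<^esub> p"
    using Irr_minimal[OF assms(1,5) alg assms(2,6)] pdivides_iff_shell[OF assms(1) I(1) assms(2)] by blast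
  hence "Irr E y pdivides\<^bsub>\<Omega>\<lparr>carrier := E\<rparr>\<^esub> p" unfolding pdivides_def c .
  moreover have "pirreducible\<^bsub>\<Omega>\<lparr>carrier := E\<rparr>\<^esub> E (Irr E y)"
    using I(2) c by simp
  ultimately have "degree (Irr E y) = 1"
    using E.splitted_imp_trivial_factors[of p "Irr E y"] assms(2-4) I(1) c by simp
  thus ?thesis using degree_one_root_mem[OF assms(1) I(1) _ assms(5) I(4)] by blast
qed

text \<open>Trades splitting in \<open>E[X]\<close> for stability under conjugates in
  \<open>\<Omega>\<close>, the only form of normality used afterwards.\<close>

lemma normal_ext_iff:
  "normal_ext \<Omega> F E \<longleftrightarrow> algebraic_field_ext \<Omega> F E \<and> (\<forall>x\<in>E. conjugates F x \<subseteq> E)"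
proof (cases "algebraic_field_ext \<Omega> F E")
  case False
  thus ?thesis unfolding normal_ext_def by blast
next
  case True
  hence F: "subfield F \<Omega>" and E: "subfield E \<Omega>" and FE: "F \<subseteq> E" and EO: "E \<subseteq> carrier \<Omega>"
    and alg: "\<And>x. x \<in> E \<Longrightarrow> (algebraic over F) x"
    using subfieldE(3) unfolding algebraic_field_ext_def field_ext_def over_def by blast+
  interpret E: field "\<Omega>\<lparr>carrier := E\<rparr>" using subfield_iff(2)[OF E] .
  have c: "poly_ring (\<Omega>\<lparr>carrier := E\<rparr>) = E[X]"
    using univ_poly_consistent[OF subfieldE(1)[OF E]] by simp
  have ev: "E.eval = eval" using eval_consistent[OF subfieldE(1)[OF E]] .
  show ?thesis
  proof
    assume N: "normal_ext \<Omega> F E"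
    have "y \<in> E" if x: "x \<in> E" and y: "y \<in> conjugates F x" for x y
    proof -
      have xO: "x \<in> carrier \<Omega>" using x EO by blast
      note I = IrrE[OF F xO alg[OF x]]
      have "E.splitted (Irr F x)" using N I x unfolding normal_ext_def by blast
      moreover have "Irr F x \<in> carrier (E[X])" using I(1) poly_ring_mono[OF FE] by blast
      ultimately show ?thesis
        using splitted_subfield_root_mem[OF E _ Irr_poly_ring(2)[OF F xO alg[OF x]]] y
        unfolding conjugates_def by blast
    qed
    thus "algebraic_field_ext \<Omega> F E \<and> (\<forall>x\<in>E. conjugates F x \<subseteq> E)" using True by blast
  next
    assume A: "algebraic_field_ext \<Omega> F E \<and> (\<forall>x\<in>E. conjugates F x \<subseteq> E)"
    have "E.splitted p" if p: "p \<in> carrier (F[X])" "pirreducible F p" and x: "x \<in> E" "eval p x = \<zero>" for p x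
    proof (rule E.trivial_factors_imp_splitted)
      have pE: "p \<in> carrier (E[X])" using p(1) poly_ring_mono[OF FE] by blast
      thus "p \<in> carrier (poly_ring (\<Omega>\<lparr>carrier := E\<rparr>))" using c by simp
      fix q assume q: "q \<in> carrier (poly_ring (\<Omega>\<lparr>carrier := E\<rparr>))"
        "pirreducible\<^bsub>\<Omega>\<lparr>carrier := E\<rparr>\<^esub> (carrier (\<Omega>\<lparr>carrier := E\<rparr>)) q" "q pdivides\<^bsub>\<Omega>\<lparr>carrier := E\<rparr>\<^esub> p"
      have q1: "q \<in> carrier (E[X])" "pirreducible E q" "q divides\<^bsub>E[X]\<^esub> p"
        using q c unfolding pdivides_def by simp_all
      have "degree q \<ge> 1" using pirreducible_degree[OF E q1(1,2)] .
      moreover have qO: "q \<in> carrier (poly_ring \<Omega>)"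
        using carrier_polynomial_shell[OF subfieldE(1)[OF E] q1(1)] .
      \<comment> \<open>An irreducible factor \<open>q\<close> over \<open>E\<close> has a root at
        least in \<open>\<Omega>\<close>. As a root of \<open>p\<close> it is a conjugate of
        \<open>x\<close>, hence lies in \<open>E\<close>, which forces \<open>q\<close> to be
        linear.\<close>
      ultimately obtain y where y: "y \<in> carrier \<Omega>" "eval q y = \<zero>" using exists_root by blast
      have "q pdivides p" using q1 pE pdivides_iff_shell[OF E] by blast
      hence "eval p y = \<zero>" using pdivides_imp_root_sharing[OF qO] y by blast
      hence "y \<in> conjugates F x" using pirreducible_root_conjugates[OF F p _ x(2) y(1)] x(1) EO by blast
      hence yE: "y \<in> E" using A x(1) by blast
      have qn: "q \<noteq> []" using pirreducibleE(1)[OF subfieldE(1)[OF E] q1(1,2)] .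
      have "E.is_root q y" unfolding E.is_root_def ev using yE y qn by simp
      hence "E.roots q \<noteq> {#}" using E.roots_mem_iff_is_root[OF q(1)] by fastforce
      thus "degree q \<le> 1" using E.pirreducible_roots[OF q(1,2)] by fastforce
    qed
    thus "normal_ext \<Omega> F E" using True unfolding normal_ext_def by blast
  qed
qed

lemma galois_ext_iff:
  "galois_ext \<Omega> F E \<longleftrightarrow> algebraic_field_ext \<Omega> F E \<and>
     (\<forall>x\<in>E. conjugates F x \<subseteq> E \<and> separable_over F x)"
  unfolding galois_ext_def normal_ext_iff separable_ext_def separable_over_def by blast

text \<open>The target is \<open>\<Omega>\<close>, so an image may leave \<open>E\<close>. Values
  outside \<open>E\<close> and \<open>F\<close> are unconstrained; hence restricting to a smaller
  field that contains the base keeps the same function.\<close>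

definition embeddings :: "'a set \<Rightarrow> 'a set \<Rightarrow> ('a \<Rightarrow> 'a) set"
  where "embeddings F E = {h \<in> ring_hom (\<Omega>\<lparr>carrier := E\<rparr>) \<Omega>. \<forall>x\<in>F. h x = x}"

lemma restricted_hom_ring:
  assumes "subring E \<Omega>" "h \<in> ring_hom (\<Omega>\<lparr>carrier := E\<rparr>) \<Omega>"
  shows "ring_hom_ring (\<Omega>\<lparr>carrier := E\<rparr>) \<Omega> h"
  using ring_hom_ringI2[OF subring_is_ring[OF assms(1)] ring_axioms assms(2)] .

lemma restricted_hom:
  assumes "h \<in> ring_hom (\<Omega>\<lparr>carrier := E\<rparr>) \<Omega>"
  shows "x \<in> E \<Longrightarrow> h x \<in> carrier \<Omega>"
    and "\<lbrakk>x \<in> E; y \<in> E\<rbrakk> \<Longrightarrow> h (x \<oplus> y) = h x \<oplus> h y"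
    and "\<lbrakk>x \<in> E; y \<in> E\<rbrakk> \<Longrightarrow> h (x \<otimes> y) = h x \<otimes> h y"
    and "h \<one> = \<one>"
  using ring_hom_memE[OF assms] by simp_all

lemma restricted_hom_subset:
  assumes "h \<in> ring_hom (\<Omega>\<lparr>carrier := E\<rparr>) \<Omega>" "B \<subseteq> E"
  shows "h \<in> ring_hom (\<Omega>\<lparr>carrier := B\<rparr>) \<Omega>"
  using restricted_hom[OF assms(1)] assms(2) by (intro ring_hom_memI) (auto simp: subset_iff)

lemma restricted_hom_zero:
  assumes "subring E \<Omega>" "h \<in> ring_hom (\<Omega>\<lparr>carrier := E\<rparr>) \<Omega>"
  shows "h \<zero> = \<zero>"
proof -
  interpret ring_hom_ring "\<Omega>\<lparr>carrier := E\<rparr>" \<Omega> h using restricted_hom_ring[OF assms] .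
  show ?thesis using hom_zero by simp
qed

lemma restricted_hom_inj:
  assumes "subfield E \<Omega>" "h \<in> ring_hom (\<Omega>\<lparr>carrier := E\<rparr>) \<Omega>"
  shows "inj_on h E"
proof -
  interpret E: field "\<Omega>\<lparr>carrier := E\<rparr>" using subfield_iff(2)[OF assms(1)] .
  interpret ring_hom_ring "\<Omega>\<lparr>carrier := E\<rparr>" \<Omega> h using restricted_hom_ring[OF subfieldE(1)[OF assms(1)] assms(2)] .
  show ?thesis using img_is_subfield(1)[OF E.carrier_is_subfield] by simp
qed

lemma restricted_hom_pow:
  assumes "subring E \<Omega>" "h \<in> ring_hom (\<Omega>\<lparr>carrier := E\<rparr>) \<Omega>" "x \<in> E"
  shows "h (x [^] (n::nat)) = h x [^] n"
proof (induction n)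
  case 0 thus ?case using restricted_hom(4)[OF assms(2)] by simp
next
  case (Suc n)
  have "x [^] n \<in> E" using assms(1,3) by (induction n) (auto intro: subringE)
  thus ?case using Suc restricted_hom(3)[OF assms(2)] assms(3) by simp
qed

lemma restricted_hom_eval:
  assumes "subring E \<Omega>" "h \<in> ring_hom (\<Omega>\<lparr>carrier := E\<rparr>) \<Omega>" "set p \<subseteq> E" "x \<in> E"
  shows "h (eval p x) = eval (map h p) (h x)"
proof -
  interpret H: ring_hom_ring "\<Omega>\<lparr>carrier := E\<rparr>" \<Omega> h using restricted_hom_ring[OF assms(1,2)] .
  show ?thesis using H.eval_hom'[of x p] assms(3,4) eval_consistent[OF assms(1)] by simp
qed

lemma polynomial_set: "p \<in> carrier (F[X]) \<Longrightarrow> set p \<subseteq> F"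
  unfolding univ_poly_def polynomial_def by auto

lemma embedding_eval:
  assumes "subring E \<Omega>" "h \<in> embeddings F E" "F \<subseteq> E" "set p \<subseteq> F" "x \<in> E"
  shows "h (eval p x) = eval p (h x)"
proof -
  have "map h p = p" using assms(2,4) unfolding embeddings_def by (intro map_idI) auto
  thus ?thesis using restricted_hom_eval[OF assms(1) _ _ assms(5), of h p] assms(2-4)
    unfolding embeddings_def by auto
qed

lemma embedding_conjugates:
  assumes "finite_field_ext \<Omega> F E" "h \<in> embeddings F E" "x \<in> E"
  shows "h x \<in> conjugates F x"
proof -
  note E = finite_field_ext_subfields[OF assms(1)]
  have hom: "h \<in> ring_hom (\<Omega>\<lparr>carrier := E\<rparr>) \<Omega>" using assms(2) unfolding embeddings_def by blast
  have xO: "x \<in> carrier \<Omega>" using assms(3) E by blast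
  note I = IrrE[OF E(1) xO finite_field_ext_algebraic[OF assms(1,3)]]
  have "eval (Irr F x) (h x) = h \<zero>"
    using embedding_eval[OF subfieldE(1)[OF E(2)] assms(2) E(3) polynomial_set[OF I(1)] assms(3)] I(4) by simp
  thus ?thesis
    using restricted_hom_zero[OF subfieldE(1)[OF E(2)] hom] restricted_hom(1)[OF hom assms(3)]
    unfolding conjugates_def by simp
qed

text \<open>Evaluation at \<open>b\<close> twisted by \<open>h\<close>: coefficients are moved by
  \<open>h\<close> before substituting. If it kills \<open>Irr B a\<close>, it descends to
  \<open>B(a)\<close>.\<close>

lemma eval_map_hom:
  assumes "subring B \<Omega>" "h \<in> ring_hom (\<Omega>\<lparr>carrier := B\<rparr>) \<Omega>" "b \<in> carrier \<Omega>"
  shows "ring_hom_ring (B[X]) \<Omega> (\<lambda>p. eval (map h p) b)"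
proof (rule ring_hom_ringI2[OF univ_poly_is_ring[OF assms(1)] ring_axioms])
  interpret H: ring_hom_ring "\<Omega>\<lparr>carrier := B\<rparr>" \<Omega> h using restricted_hom_ring[OF assms(1,2)] .
  note hB = restricted_hom(1)[OF assms(2)]
  have hset: "set p \<subseteq> B \<Longrightarrow> set (map h p) \<subseteq> carrier \<Omega>" for p using hB by auto
  show "(\<lambda>p. eval (map h p) b) \<in> ring_hom (B[X]) \<Omega>"
  proof (rule ring_hom_memI)
    fix p assume "p \<in> carrier (B[X])"
    thus "eval (map h p) b \<in> carrier \<Omega>" using eval_in_carrier[OF hset assms(3)] polynomial_set by blast
  next
    fix p q assume pq: "p \<in> carrier (B[X])" "q \<in> carrier (B[X])"
    have s: "set p \<subseteq> B" "set q \<subseteq> B" using pq polynomial_set by blast+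
    have BO: "B \<subseteq> carrier \<Omega>" using subringE(1)[OF assms(1)] .
    have "p \<otimes>\<^bsub>B[X]\<^esub> q \<in> carrier (B[X])"
      using pq univ_poly_is_ring[OF assms(1)] by (simp add: ring.ring_simprules(5))
    hence sm: "set (poly_mult p q) \<subseteq> B" using polynomial_set unfolding univ_poly_mult by blast
    \<comment> \<open>Homomorphism rules for coefficient lists hold up to leading zeros; normalizing
      removes these and leaves values unchanged.\<close>
    have "eval (map h (poly_mult p q)) b = eval (normalize (map h (poly_mult p q))) b"
      using eval_normalize[OF hset[OF sm] assms(3)] by simp
    also have "\<dots> = eval (map h p) b \<otimes> eval (map h q) b"
      using H.poly_mult_hom'[of p q] s poly_mult_consistent[OF assms(1)]
        eval_poly_mult[OF hset[OF s(1)] hset[OF s(2)] assms(3)] by simp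
    finally show "eval (map h (p \<otimes>\<^bsub>B[X]\<^esub> q)) b = eval (map h p) b \<otimes> eval (map h q) b"
      unfolding univ_poly_mult .
    have "p \<oplus>\<^bsub>B[X]\<^esub> q \<in> carrier (B[X])"
      using pq univ_poly_is_ring[OF assms(1)] by (simp add: ring.ring_simprules(1))
    hence sa: "set (poly_add p q) \<subseteq> B" using polynomial_set unfolding univ_poly_add by blast
    have "eval (map h (poly_add p q)) b = eval (normalize (map h (poly_add p q))) b"
      using eval_normalize[OF hset[OF sa] assms(3)] by simp
    also have "\<dots> = eval (map h p) b \<oplus> eval (map h q) b"
      using H.poly_add_hom'[of p q] s poly_add_consistent[OF assms(1)]
        eval_poly_add[OF hset[OF s(1)] hset[OF s(2)] assms(3)] by simp
    finally show "eval (map h (p \<oplus>\<^bsub>B[X]\<^esub> q)) b = eval (map h p) b \<oplus> eval (map h q) b"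
      unfolding univ_poly_add .
  next
    show "eval (map h \<one>\<^bsub>B[X]\<^esub>) b = \<one>"
      unfolding univ_poly_one using restricted_hom(4)[OF assms(2)] assms(3) by simp
  qed
qed

text \<open>Elements of \<open>B(a)\<close> are values \<open>p(a)\<close>, and
  \<open>p(a) = q(a)\<close> exactly when \<open>Irr B a\<close> divides \<open>p - q\<close>. So
  sending \<open>p(a)\<close> to the twisted value of \<open>p\<close> at \<open>b\<close> is well
  defined.\<close>

lemma hom_extends_simple:
  assumes "subfield B \<Omega>" "h \<in> ring_hom (\<Omega>\<lparr>carrier := B\<rparr>) \<Omega>"
    and "a \<in> carrier \<Omega>" "(algebraic over B) a" "b \<in> carrier \<Omega>" "eval (map h (Irr B a)) b = \<zero>"
  obtains g where "g \<in> ring_hom (\<Omega>\<lparr>carrier := simple_extension B a\<rparr>) \<Omega>"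
    "\<And>x. x \<in> B \<Longrightarrow> g x = h x" "g a = b"
proof -
  let ?S = "simple_extension B a"
  have sB: "subring B \<Omega>" using subfieldE(1)[OF assms(1)] .
  interpret P: domain "B[X]" using univ_poly_is_domain[OF sB] .
  interpret H: ring_hom_ring "B[X]" \<Omega> "\<lambda>p. eval (map h p) b" using eval_map_hom[OF sB assms(2,5)] .
  interpret V: ring_hom_ring "B[X]" \<Omega> "\<lambda>p. eval p a" using eval_ring_hom[OF sB assms(3)] .
  have img: "?S = (\<lambda>p. eval p a) ` carrier (B[X])"
    using simple_extension_as_eval_img[OF subfieldE(3)[OF assms(1)] assms(3)] .
  note I = IrrE[OF assms(1,3,4)]
  have wd: "eval (map h p) b = eval (map h q) b"
    if pq: "p \<in> carrier (B[X])" "q \<in> carrier (B[X])" "eval p a = eval q a" for p q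
  proof -
    let ?d = "p \<ominus>\<^bsub>B[X]\<^esub> q"
    have d: "?d \<in> carrier (B[X])" using pq by simp
    have "eval ?d a = \<zero>" using pq by (simp add: a_minus_def r_neg)
    hence "Irr B a divides\<^bsub>B[X]\<^esub> ?d"
      using Irr_minimal[OF assms(1,3,4) d] pdivides_iff_shell[OF assms(1) I(1) d] by blast
    then obtain r where r: "r \<in> carrier (B[X])" "?d = Irr B a \<otimes>\<^bsub>B[X]\<^esub> r" unfolding factor_def by blast
    have "eval (map h ?d) b = \<zero>" unfolding r(2) using H.hom_mult[OF I(1) r(1)] assms(6) r(1) by simp
    hence "eval (map h p) b \<ominus> eval (map h q) b = \<zero>" using pq by (simp add: a_minus_def)
    thus ?thesis using pq by simp
  qed
  \<comment> \<open>An arbitrary polynomial representing \<open>z\<close> is chosen; by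
    \<open>wd\<close> the value does not depend on the choice.\<close>
  define g where "g z = eval (map h (SOME p. p \<in> carrier (B[X]) \<and> eval p a = z)) b" for z
  have g: "g (eval p a) = eval (map h p) b" if p: "p \<in> carrier (B[X])" for p
  proof -
    let ?q = "SOME q. q \<in> carrier (B[X]) \<and> eval q a = eval p a"
    have "?q \<in> carrier (B[X]) \<and> eval ?q a = eval p a" by (rule someI[of _ p]) (use p in simp)
    thus ?thesis unfolding g_def using wd[of ?q p] p by blast
  qed
  have gh: "g \<in> ring_hom (\<Omega>\<lparr>carrier := ?S\<rparr>) \<Omega>"
  proof (rule ring_hom_memI)
    fix x assume "x \<in> carrier (\<Omega>\<lparr>carrier := ?S\<rparr>)"
    then obtain p where "p \<in> carrier (B[X])" "x = eval p a" using img by auto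
    thus "g x \<in> carrier \<Omega>" using g by simp
  next
    fix x y assume "x \<in> carrier (\<Omega>\<lparr>carrier := ?S\<rparr>)" "y \<in> carrier (\<Omega>\<lparr>carrier := ?S\<rparr>)"
    then obtain p q where pq: "p \<in> carrier (B[X])" "x = eval p a" "q \<in> carrier (B[X])" "y = eval q a"
      using img by auto
    have "g (eval (p \<otimes>\<^bsub>B[X]\<^esub> q) a) = g x \<otimes> g y"
      using g[OF P.m_closed[OF pq(1,3)]] g pq by simp
    thus "g (x \<otimes>\<^bsub>\<Omega>\<lparr>carrier := ?S\<rparr>\<^esub> y) = g x \<otimes> g y" using pq by simp
    have "g (eval (p \<oplus>\<^bsub>B[X]\<^esub> q) a) = g x \<oplus> g y"
      using g[OF P.a_closed[OF pq(1,3)]] g pq by simp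
    thus "g (x \<oplus>\<^bsub>\<Omega>\<lparr>carrier := ?S\<rparr>\<^esub> y) = g x \<oplus> g y" using pq by simp
  next
    have "g (eval \<one>\<^bsub>B[X]\<^esub> a) = \<one>" using g[OF P.one_closed] by simp
    thus "g \<one>\<^bsub>\<Omega>\<lparr>carrier := ?S\<rparr>\<^esub> = \<one>" by simp
  qed
  have gB: "g x = h x" if x: "x \<in> B" for x
  \<comment> \<open>The constant polynomial is \<open>[x]\<close> only for nonzero \<open>x\<close>;
    the zero polynomial is the empty list.\<close>
  proof (cases "x = \<zero>")
    case True
    have "g (eval \<zero>\<^bsub>B[X]\<^esub> a) = \<zero>" using g[OF P.zero_closed] by simp
    thus ?thesis using True restricted_hom_zero[OF sB assms(2)] by simp
  next
    case False
    have xO: "x \<in> carrier \<Omega>" using x subringE(1)[OF sB] by blast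
    have "[x] \<in> carrier (B[X])" using x False unfolding univ_poly_def polynomial_def by simp
    thus ?thesis using g[of "[x]"] xO assms(3,5) restricted_hom(1)[OF assms(2) x] by simp
  qed
  have "[\<one>, \<zero>] \<in> carrier (B[X])"
    using subringE(2,3)[OF sB] unfolding univ_poly_def polynomial_def by simp
  hence "g a = b" using g[of "[\<one>, \<zero>]"] assms(3,5) restricted_hom(4)[OF assms(2)] restricted_hom_zero[OF sB assms(2)]
    by simp
  thus ?thesis using that gh gB by blast
qed

text \<open>A homomorphism on a field is injective, so the leading coefficient survives and the
  image polynomial keeps its positive degree.\<close>

lemma map_poly_root:
  assumes "subfield B \<Omega>" "h \<in> ring_hom (\<Omega>\<lparr>carrier := B\<rparr>) \<Omega>" "p \<in> carrier (B[X])" "degree p \<ge> 1"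
  obtains b where "b \<in> carrier \<Omega>" "eval (map h p) b = \<zero>"
proof -
  have ne: "p \<noteq> []" using assms(4) by auto
  hence l: "lead_coeff p \<in> B" "lead_coeff p \<noteq> \<zero>"
    using assms(3) unfolding univ_poly_def polynomial_def by (auto dest: hd_in_set)
  have "h (lead_coeff p) \<noteq> \<zero>"
    using inj_onD[OF restricted_hom_inj[OF assms(1,2)], of "lead_coeff p" \<zero>] l
      restricted_hom_zero[OF subfieldE(1)[OF assms(1)] assms(2)] subringE(2)[OF subfieldE(1)[OF assms(1)]] by auto
  hence "map h p \<in> carrier (poly_ring \<Omega>)"
    using polynomial_set[OF assms(3)] restricted_hom(1)[OF assms(2)] ne
    unfolding univ_poly_def polynomial_def by (auto simp: hd_map)
  thus ?thesis using exists_root[of "map h p"] assms(4) that by auto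
qed

text \<open>Generators are adjoined one at a time. Each time the image of the minimal polynomial has
  a root in \<open>\<Omega>\<close>, where the new generator can be sent.\<close>

lemma hom_extends_finite_extension:
  assumes "subfield B \<Omega>" "h \<in> ring_hom (\<Omega>\<lparr>carrier := B\<rparr>) \<Omega>"
    and "set xs \<subseteq> carrier \<Omega>" "\<And>x. x \<in> set xs \<Longrightarrow> (algebraic over B) x"
  shows "\<exists>g \<in> ring_hom (\<Omega>\<lparr>carrier := finite_extension B xs\<rparr>) \<Omega>. \<forall>x\<in>B. g x = h x"
  using assms(3,4)
proof (induction xs)
  case Nil
  thus ?case using assms(2) by auto
next
  case (Cons x xs)
  let ?C = "finite_extension B xs"
  obtain g where g: "g \<in> ring_hom (\<Omega>\<lparr>carrier := ?C\<rparr>) \<Omega>" "\<forall>x\<in>B. g x = h x"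
    using Cons by auto
  have C: "subfield ?C \<Omega>" using finite_extension_is_subfield[OF assms(1)] Cons.prems by auto
  have BC: "B \<subseteq> ?C" using finite_extension_incl[OF subfieldE(3)[OF assms(1)]] Cons.prems by auto
  have x: "x \<in> carrier \<Omega>" "(algebraic over ?C) x"
    using Cons.prems algebraic_mono[OF BC] unfolding over_def by auto
  note I = IrrE[OF C x]
  obtain b where b: "b \<in> carrier \<Omega>" "eval (map g (Irr ?C x)) b = \<zero>"
    using map_poly_root[OF C g(1) I(1) pirreducible_degree[OF C I(1,2)]] .
  obtain g' where g': "g' \<in> ring_hom (\<Omega>\<lparr>carrier := simple_extension ?C x\<rparr>) \<Omega>" "\<And>y. y \<in> ?C \<Longrightarrow> g' y = g y"
    using hom_extends_simple[OF C g(1) x b] by metis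
  have "simple_extension ?C x = finite_extension B (x # xs)" by simp
  thus ?case using g' g(2) BC by (metis subsetD)
qed

lemma hom_extends:
  assumes "finite_field_ext \<Omega> B E" "h \<in> ring_hom (\<Omega>\<lparr>carrier := B\<rparr>) \<Omega>"
  obtains g where "g \<in> ring_hom (\<Omega>\<lparr>carrier := E\<rparr>) \<Omega>" "\<And>x. x \<in> B \<Longrightarrow> g x = h x"
proof -
  note E = finite_field_ext_subfields[OF assms(1)]
  obtain us where us: "set us \<subseteq> E" "Span B us = E"
    using finite_field_ext_basis[OF assms(1)] by metis
  have usO: "set us \<subseteq> carrier \<Omega>" using us(1) E by blast
  have alg: "\<And>x. x \<in> set us \<Longrightarrow> (algebraic over B) x"
    using finite_field_ext_algebraic[OF assms(1)] us(1) by blast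
  have C: "subfield (finite_extension B us) \<Omega>" using finite_extension_is_subfield[OF E(1) usO alg] .
  have BC: "B \<subseteq> finite_extension B us" using finite_extension_incl[OF E(5) usO] .
  have "E \<subseteq> finite_extension B us"
    using subalgebra_Span_incl[OF E(1) subalgebraI_subfield[OF E(1) C BC]
        finite_extension_mem[OF subfieldE(1)[OF E(1)] usO]] us(2) by blast
  moreover obtain g where "g \<in> ring_hom (\<Omega>\<lparr>carrier := finite_extension B us\<rparr>) \<Omega>" "\<forall>x\<in>B. g x = h x"
    using hom_extends_finite_extension[OF E(1) assms(2) usO alg] by blast
  ultimately show ?thesis using that restricted_hom_subset by blast
qed

text \<open>The identity of \<open>F\<close> extends to \<open>F(a)\<close> by sending
  \<open>a\<close> to \<open>b\<close>, and from there to \<open>E\<close>. This replaces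
  transitivity of a Galois group on roots; \<open>b\<close> may lie outside
  \<open>E\<close>.\<close>

lemma embedding_to_conjugate:
  assumes "finite_field_ext \<Omega> F E" "a \<in> E" "b \<in> conjugates F a"
  obtains g where "g \<in> embeddings F E" "g a = b"
proof -
  note E = finite_field_ext_subfields[OF assms(1)]
  have aO: "a \<in> carrier \<Omega>" using assms(2) E(4) by blast
  have alg: "(algebraic over F) a" using finite_field_ext_algebraic[OF assms(1,2)] .
  have id: "(\<lambda>x. x) \<in> ring_hom (\<Omega>\<lparr>carrier := F\<rparr>) \<Omega>"
    using E(5) by (intro ring_hom_memI) auto
  obtain g where g: "g \<in> ring_hom (\<Omega>\<lparr>carrier := simple_extension F a\<rparr>) \<Omega>"
    "\<And>x. x \<in> F \<Longrightarrow> g x = x" "g a = b"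
    using hom_extends_simple[OF E(1) id aO alg, of b] assms(3) unfolding conjugates_def by auto
  have S: "subfield (simple_extension F a) \<Omega>" using simple_extension_is_subfield[OF E(1) aO] alg by blast
  have FS: "F \<subseteq> simple_extension F a" using simple_extension_incl[OF E(5) aO] .
  have SE: "simple_extension F a \<subseteq> E" using simple_extension_subring_incl[OF subfieldE(1)[OF E(2)] E(3) assms(2)] .
  have aS: "a \<in> simple_extension F a" using simple_extension_mem[OF subfieldE(1)[OF E(1)] aO] .
  obtain g' where g': "g' \<in> ring_hom (\<Omega>\<lparr>carrier := E\<rparr>) \<Omega>" "\<And>x. x \<in> simple_extension F a \<Longrightarrow> g' x = g x"
    using hom_extends[OF finite_field_ext_between(2)[OF assms(1) S FS SE] g(1)] by metis
  have "g' \<in> embeddings F E" "g' a = b" using g' g FS aS unfolding embeddings_def by auto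
  thus ?thesis using that by blast
qed

section \<open>Galois extensions\<close>

declare poly_add.simps [simp del] poly_mult.simps [simp del]

text \<open>Write \<open>z = r(a)\<close> with \<open>r\<close> of degree below that of
  \<open>Irr B a\<close>. If \<open>z\<close> were outside \<open>B\<close>, then
  \<open>r - z\<close> would be nonzero, yet it would vanish at all conjugates of \<open>a\<close>,
  and separability makes these too many.\<close>

lemma embedding_fixes_simple_generator:
  assumes "finite_field_ext \<Omega> B E" "a \<in> E" "separable_over B a"
    and "z \<in> simple_extension B a" "\<And>h. h \<in> embeddings B E \<Longrightarrow> h z = z"
  shows "z \<in> B"
proof (rule ccontr)
  assume zB: "z \<notin> B"
  note E = finite_field_ext_subfields[OF assms(1)]
  have aO: "a \<in> carrier \<Omega>" using assms(2) E(4) by blast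
  have alg: "(algebraic over B) a" using finite_field_ext_algebraic[OF assms(1,2)] .
  note I = IrrE[OF E(1) aO alg]
  obtain p where p: "p \<in> carrier (B[X])" "z = eval p a"
    using assms(4) simple_extension_as_eval_img[OF E(5) aO] by blast
  let ?q = "pmod p (Irr B a)"
  have ne: "Irr B a \<noteq> []" using Irr_poly_ring(2)[OF E(1) aO alg] .
  have q: "?q \<in> carrier (B[X])" using long_division_closed(2)[OF E(1) p(1) I(1)] .
  have pd: "pdiv p (Irr B a) \<in> carrier (B[X])" using long_division_closed(1)[OF E(1) p(1) I(1)] .
  interpret V: ring_hom_ring "B[X]" \<Omega> "\<lambda>p. eval p a" using eval_ring_hom[OF subfieldE(1)[OF E(1)] aO] .
  have "eval p a = eval ((Irr B a \<otimes>\<^bsub>B[X]\<^esub> (pdiv p (Irr B a))) \<oplus>\<^bsub>B[X]\<^esub> ?q) a"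
    using arg_cong[OF pdiv_pmod[OF E(1) p(1) I(1)], of "\<lambda>p. eval p a"] .
  also have "\<dots> = eval (Irr B a) a \<otimes> eval (pdiv p (Irr B a)) a \<oplus> eval ?q a"
    using V.hom_add[OF V.R.m_closed[OF I(1) pd] q] V.hom_mult[OF I(1) pd] by simp
  also have "\<dots> = eval ?q a"
    using I(4) V.hom_closed[OF pd] V.hom_closed[OF q] by simp
  finally have zq: "z = eval ?q a" using p(2) by simp
  have qB: "set ?q \<subseteq> B" using polynomial_set[OF q] .
  have zO: "z \<in> carrier \<Omega>" unfolding zq using V.hom_closed[OF q] .
  have l2: "length ?q \<ge> 2"
  proof (rule ccontr)
    assume "\<not> length ?q \<ge> 2"
    then consider "?q = []" | c where "?q = [c]"
      by (cases ?q; cases "tl ?q") auto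
    thus False
    proof cases
      case 1
      thus False using zq zB subringE(2)[OF subfieldE(1)[OF E(1)]] by simp
    next
      case (2 c)
      hence "c \<in> B" using qB by simp
      moreover have "eval ?q a = c" using 2 \<open>c \<in> B\<close> E(5) aO by auto
      ultimately show False using zq zB by simp
    qed
  qed
  have dq: "degree ?q < degree (Irr B a)"
    using pmod_degree[OF E(1) p(1) I(1) ne] l2 by auto
  have z0: "z \<noteq> \<zero>" using zB subringE(2)[OF subfieldE(1)[OF E(1)]] by blast
  have qO: "?q \<in> carrier (poly_ring \<Omega>)" using carrier_polynomial_shell[OF subfieldE(1)[OF E(1)] q] .
  have mz: "[\<ominus> z] \<in> carrier (poly_ring \<Omega>)"
    using zO z0 unfolding univ_poly_def polynomial_def by (auto simp: add.inv_eq_1_iff)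
  \<comment> \<open>This is \<open>r - z\<close>, with coefficients in \<open>\<Omega>\<close> only.
    Since the remainder has length at least 2, subtracting a constant does not affect its leading
    coefficient.\<close>
  let ?h = "poly_add ?q [\<ominus> z]"
  have hO: "?h \<in> carrier (poly_ring \<Omega>)"
    using poly_add_closed[OF carrier_is_subring] qO mz unfolding univ_poly_carrier[symmetric] by blast
  have lh: "length ?h = length ?q"
    using poly_add_length_eq[OF carrier_is_subring, of ?q "[\<ominus> z]"] qO mz l2
    unfolding univ_poly_carrier[symmetric] by simp
  have "card (conjugates B a) \<le> degree ?h"
  proof (rule card_roots_le_degree[OF hO _ conjugates_carrier])
    show "?h \<noteq> []" using lh l2 by auto
    fix s assume s: "s \<in> conjugates B a"
    obtain h where h: "h \<in> embeddings B E" "h a = s" using embedding_to_conjugate[OF assms(1,2) s] .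
    have "eval ?q s = z"
      using embedding_eval[OF subfieldE(1)[OF E(2)] h(1) E(3) qB assms(2)] assms(5)[OF h(1)] zq h(2) by simp
    moreover have "eval ?h s = eval ?q s \<oplus> eval [\<ominus> z] s"
      using eval_poly_add[of ?q "[\<ominus> z]" s] polynomial_set[OF qO] polynomial_set[OF mz] s conjugates_carrier by blast
    ultimately show "eval ?h s = \<zero>" using zO s conjugates_carrier[of B a] by (auto simp: r_neg)
  qed
  thus False unfolding lh card_conjugates_separable[OF E(1) aO alg assms(3)] using dq by linarith
qed

text \<open>Among the fields between \<open>F\<close> and \<open>E\<close> that miss
  \<open>z\<close>, let \<open>B\<close> have the largest degree over \<open>F\<close>. Some
  generator \<open>a\<close> is not in \<open>B\<close>, so \<open>z\<close> lies in
  \<open>B(a)\<close> by maximality, and the simple case over \<open>B\<close> gives a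
  contradiction. The set of generators may be infinite.\<close>

lemma separable_generated_fixed:
  assumes "finite_field_ext \<Omega> F E" "A \<subseteq> carrier \<Omega>" "E = generate_field \<Omega> (F \<union> A)"
    and "\<And>a. a \<in> A \<Longrightarrow> separable_over F a" "z \<in> E" "\<And>h. h \<in> embeddings F E \<Longrightarrow> h z = z"
  shows "z \<in> F"
proof (rule ccontr)
  assume zF: "z \<notin> F"
  note E = finite_field_ext_subfields[OF assms(1)]
  have AE: "A \<subseteq> E" unfolding assms(3) by (auto intro: generate_field.incl)
  define P where "P B \<longleftrightarrow> subfield B \<Omega> \<and> F \<subseteq> B \<and> B \<subseteq> E \<and> z \<notin> B" for B
  have fin: "finite_field_ext \<Omega> F B" if "P B" for B
    using finite_field_ext_between(1)[OF assms(1)] that unfolding P_def by blast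
  have le: "dim F B \<le> dim F E" if "P B" for B
    using finite_field_ext_dim_less[OF assms(1) fin[OF that]] that assms(5) unfolding P_def by fastforce
  have "P F" unfolding P_def using E zF by blast
  hence "\<exists>B. P B \<and> (\<forall>C. P C \<longrightarrow> dim F C \<le> dim F B)"
    using ex_has_greatest_nat[of P F "dim F" "Suc (dim F E)"] le by (simp add: less_Suc_eq_le)
  then obtain B where B: "P B" "\<And>C. P C \<Longrightarrow> dim F C \<le> dim F B" by auto
  have sB: "subfield B \<Omega>" "F \<subseteq> B" "B \<subseteq> E" "z \<notin> B" using B(1) unfolding P_def by auto
  have "\<not> A \<subseteq> B"
  proof
    assume "A \<subseteq> B"
    hence "E \<subseteq> B" unfolding assms(3) using generate_field_min_subfield1[of "F \<union> A" B] sB assms(2) E(5) by blast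
    thus False using assms(5) sB(4) by blast
  qed
  then obtain a where a: "a \<in> A" "a \<notin> B" by blast
  have aO: "a \<in> carrier \<Omega>" and aE: "a \<in> E" using a(1) AE assms(2) by auto
  have fBE: "finite_field_ext \<Omega> B E" using finite_field_ext_between(2)[OF assms(1) sB(1-3)] .
  have alg: "(algebraic over B) a" using finite_field_ext_algebraic[OF fBE aE] .
  let ?S = "simple_extension B a"
  have S: "subfield ?S \<Omega>" using simple_extension_is_subfield[OF sB(1) aO] alg by blast
  have BS: "B \<subseteq> ?S" using simple_extension_incl[OF subfieldE(3)[OF sB(1)] aO] .
  have aS: "a \<in> ?S" using simple_extension_mem[OF subfieldE(1)[OF sB(1)] aO] .
  have SE: "?S \<subseteq> E" using simple_extension_subring_incl[OF subfieldE(1)[OF E(2)] sB(3) aE] .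
  have "z \<in> ?S"
  proof (rule ccontr)
    assume "z \<notin> ?S"
    hence PS: "P ?S" unfolding P_def using S BS SE sB(2) by blast
    have "dim F B < dim F ?S" using finite_field_ext_dim_less[OF fin[OF PS] fin[OF B(1)]] BS aS a(2) by blast
    thus False using B(2)[OF PS] by simp
  qed
  moreover have "separable_over B a"
    using separable_over_mono[OF E(1) sB(1,2) aO finite_field_ext_algebraic[OF assms(1) aE] assms(4)[OF a(1)]] .
  moreover have "embeddings B E \<subseteq> embeddings F E" using sB(2) unfolding embeddings_def by blast
  ultimately have "z \<in> B" using embedding_fixes_simple_generator[OF fBE aE] assms(6) by blast
  thus False using sB(4) by blast
qed

text \<open>Separability is asked of \<open>x\<close> alone: the simple case is applied with
  \<open>x\<close> itself as generator, while the embeddings are those of the possibly inseparable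
  \<open>E\<close>.\<close>

lemma separable_fixed:
  assumes "finite_field_ext \<Omega> F E" "x \<in> E" "separable_over F x" "\<And>h. h \<in> embeddings F E \<Longrightarrow> h x = x"
  shows "x \<in> F"
proof -
  have "x \<in> carrier \<Omega>" using assms(2) finite_field_ext_subfields[OF assms(1)] by blast
  hence "x \<in> simple_extension F x"
    using simple_extension_mem[OF subfieldE(1)] finite_field_ext_subfields[OF assms(1)] by blast
  thus ?thesis using embedding_fixes_simple_generator[OF assms(1-3)] assms(4) by blast
qed

text \<open>The product of the linear factors \<open>X - s\<close>, formed in \<open>E[X]\<close>.
  Its multiset of roots in \<open>\<Omega>\<close> records that every root is simple.\<close>

lemma monic_poly_with_roots:
  assumes "subfield E \<Omega>" "finite S" "S \<subseteq> E"
  shows "\<exists>f \<in> carrier (E[X]). f \<noteq> [] \<and> lead_coeff f = \<one> \<and> degree f = card S \<and> roots f = mset_set S"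
  using assms(2,3)
proof (induction S rule: finite_induct)
  case empty
  have "[\<one>] \<in> carrier (E[X])"
    using subringE(3)[OF subfieldE(1)[OF assms(1)]] unfolding univ_poly_def polynomial_def by simp
  moreover have "roots [\<one>] = {#}"
    by (rule degree_zero_imp_empty_roots) (auto simp: univ_poly_def polynomial_def)
  ultimately show ?case by (intro bexI[of _ "[\<one>]"]) auto
next
  case (insert s S)
  obtain f where f: "f \<in> carrier (E[X])" "f \<noteq> []" "lead_coeff f = \<one>" "degree f = card S" "roots f = mset_set S"
    using insert by auto
  have sE: "s \<in> E" and sO: "s \<in> carrier \<Omega>" using insert.prems subfieldE(3)[OF assms(1)] by auto
  have sub: "subring E \<Omega>" using subfieldE(1)[OF assms(1)] .
  have l: "[\<one>, \<ominus> s] \<in> carrier (E[X])"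
    using subringE(3,5)[OF sub] sE unfolding univ_poly_def polynomial_def by simp
  let ?g = "[\<one>, \<ominus> s] \<otimes>\<^bsub>E[X]\<^esub> f"
  interpret P: domain "E[X]" using univ_poly_is_domain[OF sub] .
  have g: "?g \<in> carrier (E[X])" using l f(1) by simp
  have lc: "lead_coeff ?g = \<one>"
    using poly_mult_lead_coeff[OF sub, of "[\<one>, \<ominus> s]" f] l f(1-3)
    unfolding univ_poly_mult univ_poly_carrier by simp
  have "length f = Suc (card S)" using f(2,4) by (cases f) auto
  hence deg: "degree ?g = Suc (card S)"
    using poly_mult_degree_eq[OF sub, of "[\<one>, \<ominus> s]" f] l f(1,2,4)
    unfolding univ_poly_mult univ_poly_carrier by simp
  hence "?g \<noteq> []" by auto
  moreover have "roots ?g = add_mset s (mset_set S)"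
    using poly_mult_degree_one_monic_imp_same_roots[OF sO carrier_polynomial_shell[OF sub f(1)] f(2)] f(5)
    unfolding univ_poly_mult by simp
  ultimately show ?case using g lc deg insert.hyps by (intro bexI[of _ ?g]) auto
qed

text \<open>The leading terms cancel in the difference, so its degree is below \<open>card S\<close>
  while it vanishes on all of \<open>S\<close>.\<close>

lemma monic_poly_unique:
  assumes "f \<in> carrier (poly_ring \<Omega>)" "g \<in> carrier (poly_ring \<Omega>)"
    and "f \<noteq> []" "g \<noteq> []" "lead_coeff f = \<one>" "lead_coeff g = \<one>" "degree f = card S" "degree g = card S"
    and "S \<subseteq> carrier \<Omega>" "\<And>s. s \<in> S \<Longrightarrow> eval f s = \<zero>" "\<And>s. s \<in> S \<Longrightarrow> eval g s = \<zero>"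
  shows "f = g"
proof (rule ccontr)
  assume ne: "f \<noteq> g"
  interpret P: domain "poly_ring \<Omega>" using univ_poly_is_domain[OF carrier_is_subring] .
  let ?d = "f \<ominus>\<^bsub>poly_ring \<Omega>\<^esub> g"
  have d: "?d \<in> carrier (poly_ring \<Omega>)" using assms(1,2) by simp
  have dne: "?d \<noteq> []" using ne assms(1,2) P.r_right_minus_eq unfolding univ_poly_zero by blast
  have mg: "\<ominus>\<^bsub>poly_ring \<Omega>\<^esub> g = map (\<lambda>a. \<ominus> a) g" using univ_poly_a_inv_def'[OF carrier_is_subring assms(2)] .
  have dd: "?d = poly_add f (map (\<lambda>a. \<ominus> a) g)" unfolding a_minus_def mg univ_poly_add ..
  have gO: "set g \<subseteq> carrier \<Omega>" "set (map (\<lambda>a. \<ominus> a) g) \<subseteq> carrier \<Omega>" "set f \<subseteq> carrier \<Omega>"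
    using polynomial_set assms(1,2) by auto
  have "coeff ?d (card S) = coeff f (card S) \<oplus> coeff (map (\<lambda>a. \<ominus> a) g) (card S)"
    unfolding dd using poly_add_coeff[OF gO(3,2)] by simp
  moreover have "coeff (map (\<lambda>a. \<ominus> a) g) (card S) = \<ominus> \<one>"
    using lead_coeff_simp[of "map (\<lambda>a. \<ominus> a) g"] assms(4,6,8) by (simp add: hd_map)
  ultimately have "coeff ?d (card S) = \<zero>" using lead_coeff_simp[OF assms(3)] assms(5,7) by (simp add: r_neg)
  moreover have "coeff ?d (degree ?d) \<noteq> \<zero>"
    using lead_coeff_simp[OF dne] d dne unfolding univ_poly_def polynomial_def by auto
  ultimately have "degree ?d \<noteq> card S" by metis
  moreover have "length ?d \<le> Suc (card S)"
    using poly_add_length_le[of f "map (\<lambda>a. \<ominus> a) g"] assms(3,4,7,8) unfolding dd by (cases f; cases g) auto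
  ultimately have "degree ?d < card S" by linarith
  moreover have "card S \<le> degree ?d"
  proof (rule card_roots_le_degree[OF d dne assms(9)])
    fix s assume s: "s \<in> S"
    interpret V: ring_hom_ring "poly_ring \<Omega>" \<Omega> "\<lambda>p. eval p s"
      using eval_ring_hom[OF carrier_is_subring] s assms(9) by blast
    show "eval ?d s = \<zero>" using assms(1,2,10,11) s by (simp add: a_minus_def)
  qed
  ultimately show False by simp
qed

text \<open>Artin's theorem: the monic polynomial whose simple roots are the conjugates of \<open>x\<close> inside \<open>E\<close>
  is invariant under \<open>H\<close>, hence has its coefficients in \<open>F\<close>.\<close>

lemma galois_ext_fixed_field:
  assumes "finite_field_ext \<Omega> F E" "H \<subseteq> embeddings F E" "\<And>h. h \<in> H \<Longrightarrow> h ` E \<subseteq> E"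
    and "\<And>x. \<lbrakk>x \<in> E; \<And>h. h \<in> H \<Longrightarrow> h x = x\<rbrakk> \<Longrightarrow> x \<in> F"
  shows "galois_ext \<Omega> F E"
proof -
  note E = finite_field_ext_subfields[OF assms(1)]
  have "conjugates F x \<subseteq> E \<and> separable_over F x" if x: "x \<in> E" for x
  proof -
    have xO: "x \<in> carrier \<Omega>" using x E(4) by blast
    have alg: "(algebraic over F) x" using finite_field_ext_algebraic[OF assms(1) x] .
    let ?S = "conjugates F x \<inter> E"
    have fS: "finite ?S" using conjugates_finite[OF E(1) xO alg] by blast
    obtain f where f: "f \<in> carrier (E[X])" "f \<noteq> []" "lead_coeff f = \<one>" "degree f = card ?S" "roots f = mset_set ?S"
      using monic_poly_with_roots[OF E(2) fS] by blast
    have fO: "f \<in> carrier (poly_ring \<Omega>)" using carrier_polynomial_shell[OF subfieldE(1)[OF E(2)] f(1)] .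
    have f0: "eval f s = \<zero>" if "s \<in> ?S" for s
      using roots_mem_iff_is_root[OF fO, of s] f(5) fS that unfolding is_root_def by simp
    have fE: "set f \<subseteq> E" using polynomial_set[OF f(1)] .
    have "map h f = f" if h: "h \<in> H" for h
    proof -
      have hh: "h \<in> embeddings F E" using h assms(2) by blast
      hence hom: "h \<in> ring_hom (\<Omega>\<lparr>carrier := E\<rparr>) \<Omega>" unfolding embeddings_def by blast
      \<comment> \<open>An injective map of a finite set into itself is a permutation, so no group
        structure on \<open>H\<close> is involved.\<close>
      have "h ` ?S \<subseteq> ?S"
      proof
        fix y assume "y \<in> h ` ?S"
        then obtain s where s: "s \<in> conjugates F x" "s \<in> E" "y = h s" by blast
        have "h s \<in> conjugates F s" using embedding_conjugates[OF assms(1) hh s(2)] .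
        thus "y \<in> ?S" using conjugates_conjugate(1)[OF E(1) xO alg s(1)] assms(3)[OF h] s by blast
      qed
      moreover have "inj_on h ?S" using restricted_hom_inj[OF E(2) hom] inj_on_subset by blast
      ultimately have hS: "h ` ?S = ?S" using endo_inj_surj[OF fS] by blast
      have lc: "lead_coeff (map h f) = \<one>" using f(2,3) restricted_hom(4)[OF hom] by (simp add: hd_map)
      have "map h f \<in> carrier (poly_ring \<Omega>)"
        using fE restricted_hom(1)[OF hom] lc unfolding univ_poly_def polynomial_def by auto
      moreover have "eval (map h f) s = \<zero>" if s: "s \<in> ?S" for s
      proof -
        obtain t where t: "t \<in> ?S" "s = h t" using s hS by blast
        show ?thesis
          using restricted_hom_eval[OF subfieldE(1)[OF E(2)] hom fE, of t] t f0[OF t(1)]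
            restricted_hom_zero[OF subfieldE(1)[OF E(2)] hom] by simp
      qed
      ultimately show ?thesis
        using monic_poly_unique[OF _ fO _ f(2) lc f(3) _ f(4)] f(2,4) f0 E(4) by auto
    qed
    hence "\<And>c h. c \<in> set f \<Longrightarrow> h \<in> H \<Longrightarrow> h c = c" by (metis map_eq_conv map_idI list.map_ident)
    hence "set f \<subseteq> F" using assms(4) fE by blast
    hence fF: "f \<in> carrier (F[X])" using f(2,3) unfolding univ_poly_def polynomial_def by simp
    have "x \<in> ?S" using conjugates_self[OF E(1) xO alg] x by blast
    \<comment> \<open>As \<open>f\<close> has coefficients in \<open>F\<close>, the minimal
      polynomial divides it. This one inclusion of multisets puts the conjugates into
      \<open>E\<close> and makes them simple roots.\<close>
    hence "roots (Irr F x) \<subseteq># mset_set ?S"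
      using pdivides_imp_roots_incl[OF Irr_poly_ring(1)[OF E(1) xO alg] fO f(2) Irr_minimal[OF E(1) xO alg fF f0]]
        f(5) by simp
    moreover from set_mset_mono[OF this] have "conjugates F x \<subseteq> E" using conjugates_eq_roots[OF E(1) xO alg] fS by auto
    ultimately show ?thesis
      unfolding separable_over_iff_count[OF E(1) xO alg]
      by (metis count_mset_set(1) count_mset_set(3) fS le_trans mset_subset_eq_count order_refl zero_le_one)
  qed
  thus ?thesis unfolding galois_ext_iff using algebraic_field_extI[OF assms(1)] by blast
qed

text \<open>Allows stability of \<open>E\<close> under \<open>h\<close> to be checked on
  generators.\<close>

lemma embedding_preimage_subfield:
  assumes "subfield E \<Omega>" "h \<in> ring_hom (\<Omega>\<lparr>carrier := E\<rparr>) \<Omega>"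
  shows "subfield {x \<in> E. h x \<in> E} \<Omega>"
proof (rule subfieldI')
  note s = subringE[OF subfieldE(1)[OF assms(1)]]
  note r = restricted_hom[OF assms(2)]
  interpret E: field "\<Omega>\<lparr>carrier := E\<rparr>" using subfield_iff(2)[OF assms(1)] .
  have hz: "h \<zero> = \<zero>" using restricted_hom_zero[OF subfieldE(1)[OF assms(1)] assms(2)] .
  have hm: "h (\<ominus> x) = \<ominus> h x" if x: "x \<in> E" for x
  proof -
    have "h (\<ominus> x) \<oplus> h x = \<zero>" using r(2)[OF s(5)[OF x] x] x s(1) hz by (auto simp: l_neg)
    thus ?thesis using r(1)[OF x] r(1)[OF s(5)[OF x]] minus_equality by metis
  qed
  show "subring {x \<in> E. h x \<in> E} \<Omega>"
    by (rule subringI) (use s r hm in auto)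
  fix k assume k: "k \<in> {x \<in> E. h x \<in> E} - {\<zero>}"
  have kE: "k \<in> E - {\<zero>}" "h k \<in> E" using k by auto
  note i = subfield_m_inv[OF assms(1) kE(1)]
  have "h k \<otimes> h (inv k) = \<one>" using r(3)[of k "inv k"] i kE r(4) by auto
  moreover have "h k \<noteq> \<zero>"
    using kE inj_onD[OF restricted_hom_inj[OF assms], of k \<zero>] hz s(2) by auto
  ultimately have "h (inv k) = inv (h k)"
    using comm_inv_char[of "h k" "h (inv k)"] r(1) i(1) kE by auto
  hence "h (inv k) \<in> E" using subfield_m_inv(1)[OF assms(1), of "h k"] kE(2) \<open>h k \<noteq> \<zero>\<close> by auto
  thus "inv k \<in> {x \<in> E. h x \<in> E}" using i(1) by blast
qed

text \<open>All embeddings over \<open>F\<close> are used in Artin's criterion: separable generators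
  leave nothing outside \<open>F\<close> fixed, and generators with conjugates in \<open>E\<close>
  keep \<open>E\<close> stable.\<close>

lemma galois_ext_generated:
  assumes "finite_field_ext \<Omega> F E" "A \<subseteq> E" "E = generate_field \<Omega> (F \<union> A)"
    and "\<And>a. a \<in> A \<Longrightarrow> separable_over F a" "\<And>a. a \<in> A \<Longrightarrow> conjugates F a \<subseteq> E"
  shows "galois_ext \<Omega> F E"
proof (rule galois_ext_fixed_field[OF assms(1) order_refl])
  note E = finite_field_ext_subfields[OF assms(1)]
  have AO: "A \<subseteq> carrier \<Omega>" using assms(2) E(4) by blast
  show "x \<in> F" if "x \<in> E" "\<And>h. h \<in> embeddings F E \<Longrightarrow> h x = x" for x
    by (rule separable_generated_fixed[OF assms(1) AO assms(3)]) (use assms(4) that in auto)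
  fix h assume h: "h \<in> embeddings F E"
  hence hom: "h \<in> ring_hom (\<Omega>\<lparr>carrier := E\<rparr>) \<Omega>" unfolding embeddings_def by blast
  have "F \<union> A \<subseteq> {x \<in> E. h x \<in> E}"
    using embedding_conjugates[OF assms(1) h] assms(2,5) E(3) h unfolding embeddings_def by fastforce
  hence "E \<subseteq> {x \<in> E. h x \<in> E}"
    using generate_field_min_subfield1[OF _ embedding_preimage_subfield[OF E(2) hom], of "F \<union> A"] AO E(5)
    unfolding assms(3)[symmetric] by blast
  thus "h ` E \<subseteq> E" by blast
qed

lemma galois_embedding_image:
  assumes "finite_field_ext \<Omega> F E" "galois_ext \<Omega> F E" "h \<in> embeddings F E"
  shows "h ` E \<subseteq> E"
  using embedding_conjugates[OF assms(1,3)] assms(2) unfolding galois_ext_iff by blast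

lemma galois_fixed:
  assumes "finite_field_ext \<Omega> F E" "galois_ext \<Omega> F E" "x \<in> E" "\<And>h. h \<in> embeddings F E \<Longrightarrow> h x = x"
  shows "x \<in> F"
  using separable_fixed[OF assms(1,3)] assms(2-4) unfolding galois_ext_iff by blast

lemma subfield_inter:
  assumes "subfield A \<Omega>" "subfield B \<Omega>" shows "subfield (A \<inter> B) \<Omega>"
  using subfieldI'[OF subring_inter[OF subfieldE(1)[OF assms(1)] subfieldE(1)[OF assms(2)]]]
    subfield_m_inv(1)[OF assms(1)] subfield_m_inv(1)[OF assms(2)] by blast

text \<open>Artin's criterion is applied to the embeddings over \<open>N\<close> together with those
  over \<open>N'\<close>: what both families fix lies in both fields.\<close>

lemma galois_ext_inter:
  assumes "finite_field_ext \<Omega> K E" "intermediate_field \<Omega> K E N" "intermediate_field \<Omega> K E N'"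
    and "galois_ext \<Omega> N E" "galois_ext \<Omega> N' E"
  shows "galois_ext \<Omega> (N \<inter> N') E"
proof -
  have N: "subfield N \<Omega>" "K \<subseteq> N" "N \<subseteq> E" and N': "subfield N' \<Omega>" "K \<subseteq> N'" "N' \<subseteq> E"
    using assms(2,3) unfolding intermediate_field_def field_ext_def by auto
  note f = finite_field_ext_between(2)[OF assms(1) N] finite_field_ext_between(2)[OF assms(1) N']
  have fin: "finite_field_ext \<Omega> (N \<inter> N') E"
    using finite_field_ext_between(2)[OF assms(1) subfield_inter[OF N(1) N'(1)]] N N' by blast
  show ?thesis
  proof (rule galois_ext_fixed_field[OF fin, of "embeddings N E \<union> embeddings N' E"])
    show "embeddings N E \<union> embeddings N' E \<subseteq> embeddings (N \<inter> N') E" unfolding embeddings_def by blast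
    show "h ` E \<subseteq> E" if "h \<in> embeddings N E \<union> embeddings N' E" for h
      using that galois_embedding_image[OF f(1) assms(4)] galois_embedding_image[OF f(2) assms(5)] by blast
    show "x \<in> N \<inter> N'" if "x \<in> E" "\<And>h. h \<in> embeddings N E \<union> embeddings N' E \<Longrightarrow> h x = x" for x
      using that galois_fixed[OF f(1) assms(4)] galois_fixed[OF f(2) assms(5)] by blast
  qed
qed

lemma finite_field_ext_dim_mult:
  assumes "finite_field_ext \<Omega> F B" "finite_field_ext \<Omega> B E"
  shows "dim F E = dim F B * dim B E"
  using telescopic_base_dim(2)[of F B E] assms unfolding finite_field_ext_def field_ext_def over_def by blast

lemma finite_field_ext_dim_self:
  assumes "subfield F \<Omega>" shows "dim F F = 1"
  using dimI[OF assms dimension_one[OF assms]] unfolding over_def .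

lemma finite_field_ext_dim_pos:
  assumes "finite_field_ext \<Omega> F E" shows "dim F E > 0"
  using finite_field_ext_dim_less[OF assms finite_field_ext_refl] finite_field_ext_dim_self
    finite_field_ext_subfields[OF assms] by fastforce

lemma dim_antimono_base:
  assumes "finite_field_ext \<Omega> F E" "subfield B \<Omega>" "F \<subset> B" "B \<subseteq> E"
  shows "dim B E < dim F E"
proof -
  have FB: "F \<subseteq> B" using assms(3) by blast
  note f = finite_field_ext_between[OF assms(1,2) FB assms(4)]
  have sF: "subfield F \<Omega>" using finite_field_ext_subfields[OF assms(1)] by blast
  have "dim F B > 1"
    using finite_field_ext_dim_less[OF f(1) finite_field_ext_refl[OF sF] assms(3)]
      finite_field_ext_dim_self[OF sF] by simp
  thus ?thesis using finite_field_ext_dim_mult[OF f] finite_field_ext_dim_pos[OF f(2)] by simp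
qed

lemma intermediate_finite:
  assumes "finite_field_ext \<Omega> K E" "intermediate_field \<Omega> K E N"
  shows "finite_field_ext \<Omega> K N" "finite_field_ext \<Omega> N E"
  using finite_field_ext_between[OF assms(1)] assms(2) unfolding intermediate_field_def field_ext_def by blast+

text \<open>If some other base did not contain \<open>N\<close>, intersecting with it would give a
  Galois base of larger degree. Conversely, every base strictly above the least one has smaller
  degree by the tower law.\<close>

lemma max_galois_base_iff:
  assumes "finite_field_ext \<Omega> K E"
  shows "max_galois_base \<Omega> K E N \<longleftrightarrow> intermediate_field \<Omega> K E N \<and> galois_ext \<Omega> N E \<and>
    (\<forall>N'. intermediate_field \<Omega> K E N' \<and> galois_ext \<Omega> N' E \<longrightarrow> N \<subseteq> N')"
proof
  assume m: "max_galois_base \<Omega> K E N"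
  hence N: "intermediate_field \<Omega> K E N" "galois_ext \<Omega> N E" unfolding max_galois_base_def by auto
  have "N \<subseteq> N'" if N': "intermediate_field \<Omega> K E N'" "galois_ext \<Omega> N' E" for N'
  proof (rule ccontr)
    assume "\<not> N \<subseteq> N'"
    hence lt: "N \<inter> N' \<subset> N" by blast
    have i: "intermediate_field \<Omega> K E (N \<inter> N')"
      using subfield_inter N(1) N'(1) unfolding intermediate_field_def field_ext_def by blast
    have "dim (N \<inter> N') E \<le> dim N E"
      using m i galois_ext_inter[OF assms N(1) N'(1) N(2) N'(2)] unfolding max_galois_base_def by blast
    thus False
      using dim_antimono_base[OF intermediate_finite(2)[OF assms i] _ lt] N(1)
      unfolding intermediate_field_def field_ext_def by fastforce
  qed
  thus "intermediate_field \<Omega> K E N \<and> galois_ext \<Omega> N E \<and>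
    (\<forall>N'. intermediate_field \<Omega> K E N' \<and> galois_ext \<Omega> N' E \<longrightarrow> N \<subseteq> N')" using N by blast
next
  assume m: "intermediate_field \<Omega> K E N \<and> galois_ext \<Omega> N E \<and>
    (\<forall>N'. intermediate_field \<Omega> K E N' \<and> galois_ext \<Omega> N' E \<longrightarrow> N \<subseteq> N')"
  have "dim N' E < dim N E" if "intermediate_field \<Omega> K E N'" "galois_ext \<Omega> N' E" "N' \<noteq> N" for N'
    using dim_antimono_base[OF intermediate_finite(2)[OF assms], of N N'] that m
    unfolding intermediate_field_def field_ext_def by blast
  thus "max_galois_base \<Omega> K E N" unfolding max_galois_base_def using m by (metis le_less less_irrefl)
qed

end

section \<open>Separable powers\<close>

lemma (in cring) binomial_theorem:
  assumes x: "x \<in> carrier R" and y: "y \<in> carrier R"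
  shows "(x \<oplus> y) [^] (n::nat) = (\<Oplus>k\<in>{..n}. [(n choose k)] \<cdot> (x [^] k \<otimes> y [^] (n - k)))"
proof (induction n)
  case 0
  show ?case using x y by simp
next
  case (Suc n)
  let ?t = "\<lambda>n k. [(n choose k)] \<cdot> (x [^] k \<otimes> y [^] (n - k))"
  let ?u = "\<lambda>k. [(n choose k)] \<cdot> (x [^] Suc k \<otimes> y [^] (n - k))"
  let ?v = "\<lambda>k. [(n choose k)] \<cdot> (x [^] k \<otimes> y [^] (Suc n - k))"
  have t: "?t n \<in> {..n} \<rightarrow> carrier R" using x y by simp
  have "(x \<oplus> y) [^] n \<otimes> x = (\<Oplus>k\<in>{..n}. ?t n k \<otimes> x)"
    unfolding Suc by (rule finsum_ldistr[OF _ x t]) simp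
  also have "\<dots> = (\<Oplus>k\<in>{..n}. ?u k)"
    by (rule finsum_cong') (use x y in \<open>auto simp: add_pow_ldistr add_pow_rdistr m_ac\<close>)
  finally have X: "(x \<oplus> y) [^] n \<otimes> x = (\<Oplus>k\<in>{..n}. ?u k)" .
  have "(x \<oplus> y) [^] n \<otimes> y = (\<Oplus>k\<in>{..n}. ?t n k \<otimes> y)"
    unfolding Suc by (rule finsum_ldistr[OF _ y t]) simp
  also have "\<dots> = (\<Oplus>k\<in>{..n}. ?v k)"
    by (rule finsum_cong') (use x y in \<open>auto simp: add_pow_ldistr add_pow_rdistr m_ac Suc_diff_le\<close>)
  \<comment> \<open>The added term has coefficient \<open>n choose Suc n\<close>, which is 0. With
    it the sum can be shifted by one and Pascal's rule applies term by term.\<close>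
  also have "\<dots> = (\<Oplus>k\<in>{..Suc n}. ?v k)"
    using x y by (simp add: binomial_eq_0)
  also have "\<dots> = (\<Oplus>k\<in>{..n}. ?v (Suc k)) \<oplus> ?v 0"
    by (rule finsum_Suc2) (use x y in simp)
  finally have Y: "(x \<oplus> y) [^] n \<otimes> y = (\<Oplus>k\<in>{..n}. ?v (Suc k)) \<oplus> ?v 0" .
  have "(x \<oplus> y) [^] Suc n = (x \<oplus> y) [^] n \<otimes> x \<oplus> (x \<oplus> y) [^] n \<otimes> y"
    using x y by (simp add: r_distr)
  also have "\<dots> = ((\<Oplus>k\<in>{..n}. ?u k) \<oplus> (\<Oplus>k\<in>{..n}. ?v (Suc k))) \<oplus> ?v 0"
    unfolding X Y by (rule a_assoc[symmetric]) (use x y in \<open>auto intro!: finsum_closed\<close>)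
  also have "(\<Oplus>k\<in>{..n}. ?u k) \<oplus> (\<Oplus>k\<in>{..n}. ?v (Suc k)) = (\<Oplus>k\<in>{..n}. ?u k \<oplus> ?v (Suc k))"
    by (rule finsum_addf[symmetric]) (use x y in auto)
  also have "\<dots> = (\<Oplus>k\<in>{..n}. ?t (Suc n) (Suc k))"
    by (rule finsum_cong') (use x y in \<open>auto simp: add.nat_pow_mult\<close>)
  also have "\<dots> \<oplus> ?v 0 = (\<Oplus>k\<in>{..Suc n}. ?t (Suc n) k)"
    using finsum_Suc2[of "?t (Suc n)" n] x y by simp
  finally show ?case .
qed

lemma (in ring) add_pow_eq_mult:
  assumes "x \<in> carrier R"
  shows "[(n::nat)] \<cdot> x = ([n] \<cdot> \<one>) \<otimes> x"
  using add_pow_ldistr[of \<one> x n] assms by simp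

lemma (in ring) add_pow_dvd_zero:
  assumes "[(p::nat)] \<cdot> \<one> = \<zero>" "p dvd n" "x \<in> carrier R"
  shows "[n] \<cdot> x = \<zero>"
proof -
  obtain m where "n = p * m" using assms(2) by blast
  hence "[n] \<cdot> \<one> = [m] \<cdot> ([p] \<cdot> \<one>)" using add.nat_pow_pow[of \<one> m p] by (simp add: mult.commute)
  thus ?thesis using add_pow_eq_mult[OF assms(3)] assms(1,3) by simp
qed

lemma (in cring) freshman_dream:
  assumes "Factorial_Ring.prime (p::nat)" "[p] \<cdot> \<one> = \<zero>" and x: "x \<in> carrier R" and y: "y \<in> carrier R"
  shows "(x \<oplus> y) [^] p = x [^] p \<oplus> y [^] p"
proof -
  let ?t = "\<lambda>k. [(p choose k)] \<cdot> (x [^] k \<otimes> y [^] (p - k))"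
  have p0: "p > 0" using prime_gt_0_nat[OF assms(1)] .
  \<comment> \<open>A prime \<open>p\<close> divides the inner binomial coefficients, which
    therefore vanish in the ring.\<close>
  have z: "?t k = \<zero>" if "k \<in> {..p} - {0, p}" for k
    using add_pow_dvd_zero[OF assms(2) dvd_choose_prime[of k p]] that assms(1) x y by simp
  have "(x \<oplus> y) [^] p = (\<Oplus>k\<in>{..p}. ?t k)" using binomial_theorem[OF x y] .
  also have "\<dots> = (\<Oplus>k\<in>{0, p}. ?t k)"
    by (rule add.finprod_mono_neutral_cong_right) (use z x y p0 in auto)
  also have "\<dots> = y [^] p \<oplus> x [^] p" using p0 x y by (simp add: a_comm)
  finally show ?thesis using x y by (simp add: a_comm)
qed

text \<open>The least positive multiple of one that vanishes is prime because a domain has no zero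
  divisors. The hypothesis has the form in which a vanishing derivative supplies it.\<close>

lemma (in domain) prime_characteristic:
  assumes "[(n::nat)] \<cdot> \<one> = \<zero>" "n > 0"
  obtains p where "Factorial_Ring.prime (p::nat)" "[p] \<cdot> \<one> = \<zero>" "\<And>m. [(m::nat)] \<cdot> \<one> = \<zero> \<Longrightarrow> p dvd m"
proof -
  define p where "p = (LEAST n::nat. n > 0 \<and> [n] \<cdot> \<one> = \<zero>)"
  have p: "p > 0" "[p] \<cdot> \<one> = \<zero>"
    using LeastI[of "\<lambda>n::nat. n > 0 \<and> [n] \<cdot> \<one> = \<zero>" n] assms unfolding p_def by auto
  have least: "p \<le> m" if "m > 0" "[m] \<cdot> \<one> = \<zero>" for m
    unfolding p_def using that by (intro Least_le) auto
  have dvd: "p dvd m" if m: "[m] \<cdot> \<one> = \<zero>" for m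
  proof -
    have "[m] \<cdot> \<one> = [(p * (m div p))] \<cdot> \<one> \<oplus> [(m mod p)] \<cdot> \<one>"
      using add.nat_pow_mult[of \<one> "p * (m div p)" "m mod p"] by simp
    hence "[(m mod p)] \<cdot> \<one> = \<zero>" using add_pow_dvd_zero[OF p(2), of "p * (m div p)" \<one>] m by simp
    hence "m mod p = 0" using least[of "m mod p"] p(1) mod_less_divisor[of p m] by fastforce
    thus ?thesis by blast
  qed
  have "p \<noteq> 1" using p(2) by auto
  moreover have "a = 1 \<or> a = p" if ab: "a dvd p" for a
  proof -
    obtain b where b: "p = a * b" using ab by blast
    have "([a] \<cdot> \<one>) \<otimes> ([b] \<cdot> \<one>) = [p] \<cdot> \<one>"
      using add_pow_ldistr[of \<one> "[b] \<cdot> \<one>" a] add.nat_pow_pow[of \<one> a b] b by (simp add: mult.commute)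
    hence "[a] \<cdot> \<one> = \<zero> \<or> [b] \<cdot> \<one> = \<zero>" using integral p(2) by simp
    hence "p dvd a \<or> p dvd b" using dvd by blast
    thus ?thesis
    proof
      assume "p dvd a" thus ?thesis using ab dvd_antisym by blast
    next
      assume "p dvd b"
      hence "b = p" using b dvd_antisym by (metis dvd_triv_right)
      thus ?thesis using b p(1) by simp
    qed
  qed
  ultimately have "Factorial_Ring.prime (p::nat)" using p(1) by (simp add: prime_nat_iff)
  thus ?thesis using that p(2) dvd by blast
qed

lemma (in domain) frobenius_inj:
  assumes "Factorial_Ring.prime (p::nat)" "[p] \<cdot> \<one> = \<zero>" "x \<in> carrier R" "y \<in> carrier R" "x [^] p = y [^] p"
  shows "x = y"
proof -
  \<comment> \<open>Writing \<open>y\<close> as a sum avoids having to determine the sign of the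
    \<open>p\<close>-th power of a negative.\<close>
  have "x [^] p \<oplus> (y \<ominus> x) [^] p = (x \<oplus> (y \<ominus> x)) [^] p"
    using freshman_dream[OF assms(1,2,3), of "y \<ominus> x"] assms by simp
  also have "x \<oplus> (y \<ominus> x) = y" using assms(3,4) by algebra
  finally have "(y \<ominus> x) [^] p = \<zero>" using assms(3-5)
    by (metis a_closed add.l_cancel add.nat_pow_0 minus_closed nat_pow_closed r_zero zero_closed)
  moreover have "z = \<zero>" if "z \<in> carrier R" "z [^] n = \<zero>" for z and n :: nat
    using that(2) integral that(1) by (induction n) auto
  ultimately have "y \<ominus> x = \<zero>" using assms(3,4) by blast
  thus ?thesis using assms(3,4) by simp
qed

text \<open>Lists begin with the leading coefficient, so the exponent belonging to an entry is the
  length of the tail after it. Vanishing leading entries are kept; this makes the length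
  predictable, but rules for the derivative are stated for values instead of lists.\<close>

fun (in ring) pderiv :: "'a list \<Rightarrow> 'a list"
  where
    "pderiv [] = []"
  | "pderiv [c] = []"
  | "pderiv (c # d # p) = [Suc (length p)] \<cdot> c # pderiv (d # p)"

section \<open>Derivatives of coefficient lists and multiple roots\<close>

context ring
begin

lemma length_pderiv: "length (pderiv p) = length p - 1"
  by (induction p rule: pderiv.induct) auto

lemma pderiv_subring:
  assumes "subring A R" "set p \<subseteq> A" shows "set (pderiv p) \<subseteq> A"
proof -
  have "[(n::nat)] \<cdot> c \<in> A" if "c \<in> A" for n c
    using that subringE(2,7)[OF assms(1)] by (induction n) (auto simp: add_pow_def)
  thus ?thesis using assms(2) subringE(7)[OF assms(1)] by (induction p rule: pderiv.induct) auto
qed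

lemma pderiv_carrier: "set p \<subseteq> carrier R \<Longrightarrow> set (pderiv p) \<subseteq> carrier R"
  using pderiv_subring[OF carrier_is_subring] .

text \<open>Unites the clauses of the definition: for empty \<open>p\<close> the multiple 0 kills
  the term, so the truncated exponent is harmless.\<close>

lemma pderiv_Cons:
  assumes "c \<in> carrier R" "set p \<subseteq> carrier R" "x \<in> carrier R"
  shows "eval (pderiv (c # p)) x = [length p] \<cdot> (c \<otimes> x [^] (length p - 1)) \<oplus> eval (pderiv p) x"
proof (cases p)
  case Nil
  thus ?thesis using assms by simp
next
  case (Cons d q)
  thus ?thesis using assms length_pderiv[of p] add_pow_ldistr[of c _ "length p"] by simp
qed

lemma map2_add_in_carrier:
  assumes "set p \<subseteq> carrier R" "set q \<subseteq> carrier R"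
  shows "set (map2 (\<oplus>) p q) \<subseteq> carrier R"
  using assms by (auto dest: set_zip_leftD set_zip_rightD)

lemma pderiv_map2_add:
  assumes "length p = length q" "set p \<subseteq> carrier R" "set q \<subseteq> carrier R" "x \<in> carrier R"
  shows "eval (pderiv (map2 (\<oplus>) p q)) x = eval (pderiv p) x \<oplus> eval (pderiv q) x"
  using assms(1-3)
proof (induction p q rule: list_induct2)
  case Nil
  show ?case by simp
next
  case (Cons c p d q)
  have s: "set (map2 (\<oplus>) p q) \<subseteq> carrier R" using map2_add_in_carrier Cons.prems by simp
  have cl: "eval (pderiv p) x \<in> carrier R" "eval (pderiv q) x \<in> carrier R"
    using eval_in_carrier pderiv_carrier assms(4) Cons.prems by simp_all
  let ?n = "length p" let ?y = "x [^] (?n - 1)"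
  have "eval (pderiv (map2 (\<oplus>) (c # p) (d # q))) x =
    [?n] \<cdot> ((c \<oplus> d) \<otimes> ?y) \<oplus> (eval (pderiv p) x \<oplus> eval (pderiv q) x)"
    using pderiv_Cons[of "c \<oplus> d" "map2 (\<oplus>) p q" x] s Cons assms(4) by simp
  also have "[?n] \<cdot> ((c \<oplus> d) \<otimes> ?y) = [?n] \<cdot> (c \<otimes> ?y) \<oplus> [?n] \<cdot> (d \<otimes> ?y)"
    using Cons.prems assms(4) by (simp add: l_distr add.nat_pow_distrib)
  finally show ?case
    using pderiv_Cons[of c p x] pderiv_Cons[of d q x] Cons.prems Cons.hyps assms(4) cl by (simp add: a_ac)
qed

lemma pderiv_replicate:
  assumes "set p \<subseteq> carrier R" "x \<in> carrier R"
  shows "eval (pderiv (replicate n \<zero> @ p)) x = eval (pderiv p) x"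
proof (induction n)
  case (Suc n)
  have "set (replicate n \<zero> @ p) \<subseteq> carrier R" using assms(1) by auto
  thus ?case
    using pderiv_Cons[of \<zero> "replicate n \<zero> @ p" x] Suc assms eval_in_carrier[OF pderiv_carrier[OF assms(1)] assms(2)] by simp
qed simp

lemma pderiv_normalize:
  assumes "set p \<subseteq> carrier R" "x \<in> carrier R"
  shows "eval (pderiv (normalize p)) x = eval (pderiv p) x"
  using pderiv_replicate[OF normalize_in_carrier[OF assms(1)] assms(2)] normalize_trick[of p] by metis

text \<open>\<open>poly_add\<close> pads the shorter list with zeros, adds entrywise and normalizes;
  each of these operations is compatible with values of the derivative.\<close>

lemma pderiv_poly_add:
  assumes "set p \<subseteq> carrier R" "set q \<subseteq> carrier R" "x \<in> carrier R"
  shows "eval (pderiv (poly_add p q)) x = eval (pderiv p) x \<oplus> eval (pderiv q) x"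
proof -
  have *: "eval (pderiv (poly_add p q)) x = eval (pderiv p) x \<oplus> eval (pderiv q) x"
    if pq: "length q \<le> length p" "set p \<subseteq> carrier R" "set q \<subseteq> carrier R" for p q
  proof -
    let ?q = "replicate (length p - length q) \<zero> @ q"
    have q: "set ?q \<subseteq> carrier R" "length p = length ?q" using pq by auto
    have "set (map2 (\<oplus>) p ?q) \<subseteq> carrier R" using map2_add_in_carrier[OF pq(2) q(1)] .
    moreover have "poly_add p q = normalize (map2 (\<oplus>) p ?q)" using pq(1) by (simp add: poly_add.simps)
    ultimately show ?thesis
      using pderiv_normalize pderiv_map2_add[OF q(2) pq(2) q(1) assms(3)] pderiv_replicate[OF pq(3) assms(3)] assms(3)
      by simp
  qed
  show ?thesis
  proof (cases "length q \<le> length p")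
    case True thus ?thesis using * assms by blast
  next
    case False
    have "poly_add p q = poly_add q p" using poly_add_comm[OF assms(1,2)] .
    thus ?thesis using *[of p q] *[of q p] False assms
      eval_in_carrier[OF pderiv_carrier[OF assms(1)] assms(3)] eval_in_carrier[OF pderiv_carrier[OF assms(2)] assms(3)]
      by (simp add: a_comm)
  qed
qed

end

context domain
begin

lemma pderiv_map_mult:
  assumes "a \<in> carrier R" "set p \<subseteq> carrier R" "x \<in> carrier R"
  shows "eval (pderiv (map ((\<otimes>) a) p)) x = a \<otimes> eval (pderiv p) x"
  using assms(2)
proof (induction p)
  case Nil thus ?case using assms by simp
next
  case (Cons c p)
  let ?y = "x [^] (length p - 1)"
  have s: "set (map ((\<otimes>) a) p) \<subseteq> carrier R" using Cons.prems assms(1) by auto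
  have cl: "eval (pderiv p) x \<in> carrier R" using eval_in_carrier pderiv_carrier assms(3) Cons.prems by simp
  show ?case
    using pderiv_Cons[of c p x] pderiv_Cons[of "a \<otimes> c" "map ((\<otimes>) a) p" x] Cons assms s cl
    by (simp add: r_distr add_pow_rdistr m_assoc)
qed

text \<open>Appending a zero multiplies by \<open>X\<close>, so this is the product rule for the
  factor \<open>X\<close>.\<close>

lemma pderiv_append_zero:
  assumes "set p \<subseteq> carrier R" "x \<in> carrier R"
  shows "eval (pderiv (p @ [\<zero>])) x = eval (pderiv p) x \<otimes> x \<oplus> eval p x"
  using assms(1)
proof (induction p)
  case Nil thus ?case using assms by simp
next
  case (Cons c p)
  let ?n = "length p"
  have c: "c \<in> carrier R" "set p \<subseteq> carrier R" using Cons.prems by auto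
  have cl: "eval (pderiv p) x \<in> carrier R" "eval p x \<in> carrier R"
    using eval_in_carrier pderiv_carrier assms(2) c by simp_all
  have m: "c \<otimes> x [^] ?n \<in> carrier R" using c assms(2) by simp
  have "[?n] \<cdot> (c \<otimes> x [^] (?n - 1)) \<otimes> x = [?n] \<cdot> (c \<otimes> x [^] (?n - 1) \<otimes> x)"
    using add_pow_ldistr c assms(2) by simp
  also have "\<dots> = [?n] \<cdot> (c \<otimes> x [^] ?n)"
    using c assms(2) by (cases p) (simp_all add: m_assoc)
  finally have "[?n] \<cdot> (c \<otimes> x [^] (?n - 1)) \<otimes> x = [?n] \<cdot> (c \<otimes> x [^] ?n)" .
  hence "eval (pderiv (c # p)) x \<otimes> x = [?n] \<cdot> (c \<otimes> x [^] ?n) \<oplus> eval (pderiv p) x \<otimes> x"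
    using pderiv_Cons[OF c assms(2)] c cl assms(2) by (simp add: l_distr)
  moreover have "eval (pderiv ((c # p) @ [\<zero>])) x = [Suc ?n] \<cdot> (c \<otimes> x [^] ?n) \<oplus> (eval (pderiv p) x \<otimes> x \<oplus> eval p x)"
    using pderiv_Cons[of c "p @ [\<zero>]" x] Cons.IH c assms(2) by simp
  moreover have "[Suc ?n] \<cdot> (c \<otimes> x [^] ?n) = [?n] \<cdot> (c \<otimes> x [^] ?n) \<oplus> c \<otimes> x [^] ?n"
    by (simp add: add_pow_def)
  ultimately show ?case using m cl c assms(2) by (simp add: a_ac)
qed

text \<open>The product rule for \<open>(X - a) q\<close>, evaluated at \<open>a\<close>, where the
  term with the derivative of \<open>q\<close> drops out.\<close>

lemma pderiv_linear_mult:
  assumes "a \<in> carrier R" "set q \<subseteq> carrier R"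
  shows "eval (pderiv (poly_mult [\<one>, \<ominus> a] q)) a = eval q a"
proof -
  have s1: "set (map ((\<otimes>) \<one>) q @ [\<zero>]) \<subseteq> carrier R" using assms by auto
  have s2: "set (map ((\<otimes>) (\<ominus> a)) q) \<subseteq> carrier R" using assms by auto
  have e: "poly_mult [\<one>, \<ominus> a] q = poly_add (map ((\<otimes>) \<one>) q @ [\<zero>]) (poly_add (map ((\<otimes>) (\<ominus> a)) q) [])"
    by (simp add: poly_mult.simps)
  have q1: "map ((\<otimes>) \<one>) q = q" using assms(2) by (intro map_idI) auto
  have cl: "eval (pderiv q) a \<in> carrier R" "eval q a \<in> carrier R"
    using eval_in_carrier pderiv_carrier assms by simp_all
  have "eval (pderiv (poly_mult [\<one>, \<ominus> a] q)) a = eval (pderiv (q @ [\<zero>])) a \<oplus> eval (pderiv (map ((\<otimes>) (\<ominus> a)) q)) a"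
    unfolding e using pderiv_poly_add[OF s1 _ assms(1), of "poly_add (map ((\<otimes>) (\<ominus> a)) q) []"]
      pderiv_poly_add[OF s2 _ assms(1), of "[]"] poly_add_in_carrier[OF s2, of "[]"] q1
      eval_in_carrier[OF pderiv_carrier[OF s2] assms(1)] by simp
  also have "\<dots> = (eval (pderiv q) a \<otimes> a \<oplus> eval q a) \<oplus> \<ominus> a \<otimes> eval (pderiv q) a"
    using pderiv_append_zero[OF assms(2,1)] pderiv_map_mult[of "\<ominus> a" q a] assms by simp
  also have "\<dots> = eval q a" using cl assms(1) by algebra
  finally show ?thesis .
qed

lemma multiple_root_pderiv:
  assumes "f \<in> carrier (poly_ring R)" "a \<in> carrier R" "alg_mult f a \<ge> 2"
  shows "eval (pderiv f) a = \<zero>"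
proof -
  interpret P: domain "poly_ring R" using univ_poly_is_domain[OF carrier_is_subring] .
  have l: "[\<one>, \<ominus> a] \<in> carrier (poly_ring R)" using assms(2) unfolding univ_poly_def polynomial_def by simp
  have "([\<one>, \<ominus> a] [^]\<^bsub>poly_ring R\<^esub> (2::nat)) pdivides f" using le_alg_mult_imp_pdivides[OF assms(2,1,3)] .
  then obtain g where g: "g \<in> carrier (poly_ring R)" "f = [\<one>, \<ominus> a] [^]\<^bsub>poly_ring R\<^esub> (2::nat) \<otimes>\<^bsub>poly_ring R\<^esub> g"
    unfolding pdivides_def factor_def by blast
  let ?q = "[\<one>, \<ominus> a] \<otimes>\<^bsub>poly_ring R\<^esub> g"
  have q: "?q \<in> carrier (poly_ring R)" using l g(1) by simp
  have s: "set ?q \<subseteq> carrier R" "set [\<one>, \<ominus> a] \<subseteq> carrier R" "set g \<subseteq> carrier R"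
    using q g(1) assms(2) unfolding univ_poly_def polynomial_def by auto
  \<comment> \<open>Splitting off one of the two linear factors leaves a cofactor that still
    vanishes at \<open>a\<close>, and its value there is the derivative of \<open>f\<close>.\<close>
  have f: "f = [\<one>, \<ominus> a] \<otimes>\<^bsub>poly_ring R\<^esub> ?q"
    unfolding g(2) using l g(1) by (simp add: numeral_2_eq_2 P.m_assoc)
  have "eval ?q a = eval [\<one>, \<ominus> a] a \<otimes> eval g a"
    using eval_poly_mult[OF s(2,3) assms(2)] unfolding univ_poly_mult .
  also have "eval [\<one>, \<ominus> a] a = \<zero>" using assms(2) by (simp add: r_neg)
  finally have "eval ?q a = \<zero>" using eval_in_carrier[OF s(3) assms(2)] by simp
  thus ?thesis using pderiv_linear_mult[OF assms(2) s(1)] f unfolding univ_poly_mult by simp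
qed

text \<open>The length bound is rounded up because the induction runs over all suffixes of \<open>f\<close>, whose
  degrees need not be divisible by \<open>p\<close>.\<close>

lemma pderiv_zero_imp_poly_in_power:
  assumes "Factorial_Ring.prime (p::nat)" "\<And>m. [(m::nat)] \<cdot> \<one> = \<zero> \<Longrightarrow> p dvd m" "subring A R" "set f \<subseteq> A" "set (pderiv f) \<subseteq> {\<zero>}"
  shows "\<exists>g. set g \<subseteq> A \<and> length g \<le> (length f + p - 1) div p \<and>
    (f \<noteq> [] \<and> p dvd length f - 1 \<longrightarrow> g \<noteq> [] \<and> hd g = hd f) \<and>
    (\<forall>x \<in> carrier R. eval g (x [^] p) = eval f x)"
  using assms(4,5)
proof (induction f)
  case Nil
  have "(length [] + p - 1) div p = 0" using prime_gt_0_nat[OF assms(1)] by simp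
  thus ?case by (intro exI[of _ "[]"]) auto
next
  case (Cons c f)
  have p0: "p > 0" using prime_gt_0_nat[OF assms(1)] .
  have cA: "c \<in> A" "set f \<subseteq> A" using Cons.prems by auto
  have AR: "A \<subseteq> carrier R" using subringE(1)[OF assms(3)] .
  have df: "set (pderiv f) \<subseteq> {\<zero>}" "[length f] \<cdot> c = \<zero>"
    using Cons.prems(2) by (cases f; auto)+
  obtain g where g: "set g \<subseteq> A" "length g \<le> (length f + p - 1) div p"
    "\<And>x. x \<in> carrier R \<Longrightarrow> eval g (x [^] p) = eval f x"
    using Cons.IH[OF cA(2) df(1)] by auto
  show ?case
  proof (cases "p dvd length f")
    \<comment> \<open>The multiple of \<open>c\<close> vanishes, and \<open>length f\<close> times
      one is nonzero since \<open>p\<close> does not divide \<open>length f\<close>; so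
      \<open>c\<close> itself is zero and the old \<open>g\<close> still works.\<close>
    case False
    have "[length f] \<cdot> \<one> \<otimes> c = \<zero>" using df(2) add_pow_eq_mult[of c "length f"] cA(1) AR by auto
    hence "c = \<zero>" using integral[of "[length f] \<cdot> \<one>" c] assms(2) False cA(1) AR by auto
    hence "eval (c # f) x = eval f x" if "x \<in> carrier R" for x
      using that eval_in_carrier[of f x] cA(2) AR by auto
    moreover have "(length f + p - 1) div p \<le> (length (c # f) + p - 1) div p" by (intro div_le_mono) simp
    ultimately show ?thesis using g False by (intro exI[of _ g]) auto
  next
    case True
    then obtain m where m: "length f = p * m" by blast
    have "(p * m + p - 1) div p = m" by (rule div_nat_eqI) (use p0 in \<open>auto simp: algebra_simps\<close>)
    hence gm: "length g \<le> m" using g(2) m by simp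
    have len: "(length (c # f) + p - 1) div p = Suc m" using p0 m by simp
    \<comment> \<open>Here \<open>c\<close> belongs to the exponent \<open>p * m\<close>, so it must
      get exponent \<open>m\<close> in \<open>g\<close>; the zeros fill the gap when
      \<open>g\<close> is shorter than \<open>m\<close>.\<close>
    let ?g = "c # replicate (m - length g) \<zero> @ g"
    have gs: "set (replicate (m - length g) \<zero> @ g) \<subseteq> carrier R" "set g \<subseteq> carrier R" using g(1) AR by auto
    have "eval ?g (x [^] p) = eval (c # f) x" if x: "x \<in> carrier R" for x
      using eval_replicate[OF gs(2), of "x [^] p" "m - length g"] g(3)[OF x] gm x m
      by (simp add: nat_pow_pow)
    moreover have "set ?g \<subseteq> A" using g(1) cA(1) subringE(2)[OF assms(3)] by auto
    ultimately show ?thesis using len gm by (intro exI[of _ ?g]) auto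
  qed
qed

end

context closed_field
begin

text \<open>If the minimal polynomial has a multiple root, its derivative is zero, so it is a
  polynomial in \<open>X^p\<close>. Then \<open>x^p\<close> has smaller degree over \<open>A\<close>
  and induction applies. The final \<open>q\<close> is 1 or a product of copies of \<open>p\<close>,
  for which injectivity follows from that of Frobenius.\<close>

lemma power_separable:
  assumes "subfield A \<Omega>" "x \<in> carrier \<Omega>" "(algebraic over A) x"
  shows "\<exists>q::nat. separable_over A (x [^] q) \<and> inj_on (\<lambda>y. y [^] q) (carrier \<Omega>)"
  using assms(2,3)
proof (induction "degree (Irr A x)" arbitrary: x rule: less_induct)
  case less
  show ?case
  proof (cases "separable_over A x")
    case True
    thus ?thesis using less.prems(1) by (intro exI[of _ 1]) (auto intro: inj_onI)
  next
    case False
    let ?f = "Irr A x"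
    note I = IrrE[OF assms(1) less.prems]
    have fO: "?f \<in> carrier (poly_ring \<Omega>)" "?f \<noteq> []" using Irr_poly_ring[OF assms(1) less.prems] .
    have sA: "subring A \<Omega>" using subfieldE(1)[OF assms(1)] .
    obtain a where a: "a \<in> carrier \<Omega>" "alg_mult ?f a \<ge> 2" using False unfolding separable_over_def by fastforce
    have "is_root ?f a" using alg_mult_gt_zero_iff_is_root[OF fO(1), of a] a(2) by simp
    hence ac: "a \<in> conjugates A x" unfolding is_root_def conjugates_def by blast
    note aI = Irr_conjugate[OF assms(1) less.prems ac]
    have fA: "set ?f \<subseteq> A" using polynomial_set[OF I(1)] .
    have dA: "set (pderiv ?f) \<subseteq> A" using pderiv_subring[OF sA fA] .
    have dO: "set (pderiv ?f) \<subseteq> carrier \<Omega>" using dA subfieldE(3)[OF assms(1)] by blast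
    have d1: "degree ?f \<ge> 1" using pirreducible_degree[OF assms(1) I(1,2)] .
    \<comment> \<open>A nonzero derivative would have smaller degree and vanish at \<open>a\<close>,
      whose minimal polynomial is again \<open>?f\<close>.\<close>
    have "normalize (pderiv ?f) = []"
    proof (rule ccontr)
      assume ne: "normalize (pderiv ?f) \<noteq> []"
      have n: "normalize (pderiv ?f) \<in> carrier (A[X])"
        using normalize_gives_polynomial[OF dA] unfolding univ_poly_carrier .
      have "eval (normalize (pderiv ?f)) a = \<zero>"
        using eval_normalize[OF dO a(1)] multiple_root_pderiv[OF fO(1) a] by simp
      hence "?f pdivides normalize (pderiv ?f)" using Irr_minimal[OF assms(1) a(1) aI(1) n] aI(2) by simp
      hence "degree ?f \<le> degree (normalize (pderiv ?f))"
        using pdivides_imp_degree_le[OF sA I(1) n ne] by blast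
      thus False using normalize_length_le[of "pderiv ?f"] length_pderiv[of ?f] d1 by simp
    qed
    hence "pderiv ?f = replicate (length (pderiv ?f)) \<zero>" using normalize_trick[of "pderiv ?f"] by simp
    hence z: "set (pderiv ?f) \<subseteq> {\<zero>}" by (metis in_set_replicate insertCI subsetI)
    \<comment> \<open>As \<open>?f\<close> is monic, the head of its derivative is the degree times
      one; its vanishing reveals the positive characteristic.\<close>
    obtain d r where dr: "?f = \<one> # d # r" using d1 I(3) by (cases ?f; cases "tl ?f") auto
    have "[degree ?f] \<cdot> \<one> = \<zero>" using z unfolding dr by simp
    then obtain p where p: "Factorial_Ring.prime (p::nat)" "[p] \<cdot> \<one> = \<zero>" "\<And>m. [(m::nat)] \<cdot> \<one> = \<zero> \<Longrightarrow> p dvd m"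
      by (rule prime_characteristic) (use d1 in auto)
    have pd: "p dvd degree ?f" using p(3) \<open>[degree ?f] \<cdot> \<one> = \<zero>\<close> by blast
    obtain g where g: "set g \<subseteq> A" "length g \<le> (length ?f + p - 1) div p" "g \<noteq> []" "hd g = \<one>"
      "eval g (x [^] p) = \<zero>"
      using pderiv_zero_imp_poly_in_power[OF p(1,3) sA fA z] pd fO(2) I(3,4) less.prems(1) by auto
    have gA: "g \<in> carrier (A[X])" using g(1,3,4) unfolding univ_poly_def polynomial_def by simp
    have xp: "x [^] p \<in> carrier \<Omega>" using less.prems(1) by simp
    have alg: "(algebraic over A) (x [^] p)" using algebraicI[OF gA g(3,5)] .
    have "degree (Irr A (x [^] p)) \<le> degree g"
      using pdivides_imp_degree_le[OF sA IrrE(1)[OF assms(1) xp alg] gA g(3)] Irr_minimal[OF assms(1) xp alg gA g(5)] by blast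
    also have "\<dots> < degree ?f"
    proof -
      obtain m where m: "degree ?f = p * m" using pd by blast
      have "length ?f = p * m + 1" using m fO(2) by (cases ?f) auto
      hence "(length ?f + p - 1) div p = m + 1" using prime_gt_0_nat[OF p(1)] by simp
      hence gm: "degree g \<le> m" using g(2) by simp
      have "0 < m" using m d1 by (cases m) auto
      hence "m < p * m"
        by (rule n_less_m_mult_n) (use prime_gt_1_nat[OF p(1)] in auto)
      thus ?thesis unfolding m using gm by (rule le_less_trans[rotated])
    qed
    finally obtain q :: nat where q: "separable_over A ((x [^] p) [^] q)" "inj_on (\<lambda>y. y [^] q) (carrier \<Omega>)"
      using less.hyps[OF _ xp alg] by blast
    have "inj_on (\<lambda>y. y [^] (p * q)) (carrier \<Omega>)"
    proof (rule inj_onI)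
      fix y z assume yz: "y \<in> carrier \<Omega>" "z \<in> carrier \<Omega>" "y [^] (p * q) = z [^] (p * q)"
      hence "(y [^] p) [^] q = (z [^] p) [^] q" by (simp add: nat_pow_pow)
      hence "y [^] p = z [^] p" using inj_onD[OF q(2)] yz by simp
      thus "y = z" using frobenius_inj[OF p(1,2)] yz by blast
    qed
    thus ?thesis using q(1) less.prems(1) by (intro exI[of _ "p * q"]) (simp add: nat_pow_pow)
  qed
qed

end

section \<open>Linearly disjoint fields\<close>

declare (in ring) Span.simps [simp del]

lemma (in ring) combine_in_subring:
  assumes "subring V R" "set ks \<subseteq> V" "set us \<subseteq> V"
  shows "combine ks us \<in> V"
  using assms(2,3)
proof (induction ks us rule: combine.induct)
  case (1 k Ks u Us)
  thus ?case using subringE(6,7)[OF assms(1)] by simp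
qed (use subringE(2)[OF assms(1)] in auto)

text \<open>Expanding each entry of \<open>es\<close> in terms of \<open>bs\<close> and exchanging the order of summation.\<close>

lemma (in cring) combine_Span_exchange:
  assumes "subfield A R" "set bs \<subseteq> carrier R" "set es \<subseteq> Span A bs"
  shows "\<exists>cols. length cols = length bs \<and> (\<forall>c \<in> set cols. set c \<subseteq> A \<and> length c = length es) \<and>
    (\<forall>ws. set ws \<subseteq> carrier R \<and> length ws = length es \<longrightarrow>
       combine es ws = combine (map (\<lambda>c. combine c ws) cols) bs) \<and>
    ((\<forall>c \<in> set cols. set c \<subseteq> {\<zero>}) \<longrightarrow> set es \<subseteq> {\<zero>})"
  using assms(3)
proof (induction es)
  case Nil
  have "combine [] ws = combine (map (\<lambda>c. combine c ws) (replicate (length bs) [])) bs" for ws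
    using combine_replicate[OF assms(2)] by (simp add: map_replicate)
  thus ?case by (intro exI[of _ "replicate (length bs) []"]) auto
next
  case (Cons e es)
  have "set es \<subseteq> Span A bs" using Cons.prems by simp
  from Cons.IH[OF this] obtain cols
    where c: "length cols = length bs" "\<forall>c \<in> set cols. set c \<subseteq> A \<and> length c = length es"
    and cw: "\<forall>ws. set ws \<subseteq> carrier R \<and> length ws = length es \<longrightarrow>
       combine es ws = combine (map (\<lambda>c. combine c ws) cols) bs"
    and c0: "(\<forall>c \<in> set cols. set c \<subseteq> {\<zero>}) \<longrightarrow> set es \<subseteq> {\<zero>}"
    by (elim exE conjE) (rule that; assumption)
  have "e \<in> Span A bs" using Cons.prems by simp
  then obtain ks where k: "set ks \<subseteq> A" "length ks = length bs" "e = combine ks bs"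
    using Span_mem_iff_length_version[OF assms(1,2)] by blast
  have AR: "A \<subseteq> carrier R" using subfieldE(3)[OF assms(1)] .
  have kR: "set ks \<subseteq> carrier R" using k(1) AR by blast
  \<comment> \<open>\<open>cols\<close> holds the columns of the coordinate matrix, so a new entry
    \<open>e\<close> adds a row: each of its coordinates goes on top of the matching column.\<close>
  let ?cols = "map2 (#) ks cols"
  have mem: "\<exists>k c. d = k # c \<and> k \<in> set ks \<and> c \<in> set cols" if "d \<in> set ?cols" for d
    using that by (auto dest: set_zip_leftD set_zip_rightD)
  have 1: "length ?cols = length bs" using c(1) k(2) by simp
  have 2: "set d \<subseteq> A \<and> length d = length (e # es)" if "d \<in> set ?cols" for d
    using mem[OF that] c(2) k(1) by (auto simp: subset_iff)
  have 3: "combine (e # es) ws = combine (map (\<lambda>c. combine c ws) ?cols) bs"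
    if ws: "set ws \<subseteq> carrier R" "length ws = length (e # es)" for ws
  proof -
    obtain v vs where v: "ws = v # vs" using ws(2) by (cases ws) auto
    have vR: "v \<in> carrier R" "set vs \<subseteq> carrier R" "length vs = length es" using ws unfolding v by simp_all
    let ?X = "map ((\<otimes>) v) ks" let ?Y = "map (\<lambda>c. combine c vs) cols"
    have X: "length ?X = length bs" "set ?X \<subseteq> carrier R" using k(2) kR vR(1) by auto
    have Y: "length ?Y = length bs" "set ?Y \<subseteq> carrier R"
      using c AR vR(2) by (auto intro!: combine_in_carrier)
    have "combine (e # es) ws = v \<otimes> combine ks bs \<oplus> combine es vs"
      unfolding v k(3) using combine_in_carrier[OF kR assms(2)] vR(1) by (simp add: m_comm)
    also have "\<dots> = combine ?X bs \<oplus> combine ?Y bs"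
      using combine_r_distr[OF kR assms(2) vR(1)] cw vR(2,3) by simp
    also have "\<dots> = combine (map2 (\<oplus>) ?X ?Y) bs"
      using combine_add[OF X(1) Y(1) X(2) Y(2) assms(2)] .
    also have "map2 (\<oplus>) ?X ?Y = map (\<lambda>c. combine c ws) ?cols"
      using c(1) k(2) kR vR(1) unfolding v
      by (intro nth_equalityI) (auto simp: m_comm subset_iff)
    finally show ?thesis .
  qed
  have 4: "set (e # es) \<subseteq> {\<zero>}" if z: "\<forall>d \<in> set ?cols. set d \<subseteq> {\<zero>}"
  proof -
    have "ks ! i = \<zero> \<and> set (cols ! i) \<subseteq> {\<zero>}" if i: "i < length bs" for i
    proof -
      have "?cols ! i = ks ! i # cols ! i" "i < length ?cols" using i c(1) k(2) by simp_all
      hence "ks ! i # cols ! i \<in> set ?cols" using nth_mem[of i ?cols] by simp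
      hence "set (ks ! i # cols ! i) \<subseteq> {\<zero>}" using z by blast
      thus ?thesis by simp
    qed
    hence zi: "ks ! i = \<zero>" "set (cols ! i) \<subseteq> {\<zero>}" if "i < length bs" for i using that by blast+
    have "ks = replicate (length bs) \<zero>" using zi(1) k(2) by (intro nth_equalityI) auto
    moreover have "\<forall>c \<in> set cols. set c \<subseteq> {\<zero>}" using zi(2) c(1) by (metis in_set_conv_nth)
    ultimately show ?thesis using c0 k(3) combine_replicate[OF assms(2)] by simp
  qed
  show ?case
    by (intro exI[of _ ?cols] conjI ballI allI impI; (elim conjE)?)
      (rule 1 2[THEN conjunct1] 2[THEN conjunct2] 3 4; assumption)+
qed

context closed_field
begin

lemma linearly_disjointD:
  assumes "linearly_disjoint \<Omega> K E F" "set us \<subseteq> E" "independent K us"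
  shows "independent F us"
  using assms unfolding linearly_disjoint_def by blast

text \<open>The definition is asymmetric. In a relation among \<open>us\<close> with coefficients in
  \<open>E\<close>, expand the coefficients in a \<open>K\<close>-basis \<open>bs\<close> of their
  span. By hypothesis \<open>bs\<close> is independent over \<open>F\<close>, so the collected
  coefficients in \<open>F\<close> vanish; these are \<open>K\<close>-relations among
  \<open>us\<close> and hence trivial.\<close>

lemma linearly_disjoint_commute:
  assumes "subfield K \<Omega>" "subfield E \<Omega>" "subfield F \<Omega>" "K \<subseteq> E" "K \<subseteq> F"
    and "linearly_disjoint \<Omega> K E F"
  shows "linearly_disjoint \<Omega> K F E"
  unfolding linearly_disjoint_def
proof (intro allI impI)
  fix us assume us: "set us \<subseteq> F" "independent K us"
  have usO: "set us \<subseteq> carrier \<Omega>" using us(1) subfieldE(3)[OF assms(3)] by blast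
  have EO: "E \<subseteq> carrier \<Omega>" using subfieldE(3)[OF assms(2)] .
  show "independent E us"
  proof (rule trivial_combine_imp_independent[OF assms(2) usO])
    fix Ks assume Ks: "set Ks \<subseteq> E" "combine Ks us = \<zero>"
    have KO: "set Ks \<subseteq> carrier \<Omega>" using Ks(1) EO by blast
    \<comment> \<open>\<open>combine\<close> stops at the end of the shorter list; \<open>es\<close>
      is \<open>Ks\<close> cut or padded with zeros to the length of \<open>us\<close>.\<close>
    obtain es where es: "set (take (length us) Ks) \<subseteq> set es" "set es \<subseteq> set (take (length us) Ks) \<union> {\<zero>}"
      "length es = length us" "combine es us = \<zero>"
      using combine_normalize[OF KO usO Ks(2)] by blast
    have "set es \<subseteq> set Ks \<union> {\<zero>}" using es(2) set_take_subset[of "length us" Ks] by blast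
    hence eE: "set es \<subseteq> E" using Ks(1) subringE(2)[OF subfieldE(1)[OF assms(2)]] by blast
    hence eO: "set es \<subseteq> carrier \<Omega>" using EO by blast
    obtain bs where bs: "set bs \<subseteq> carrier \<Omega>" "independent K bs" "Span K bs = Span K es"
      using filter_base[OF assms(1) eO] by blast
    have "Span K es \<subseteq> E"
      using subalgebra_Span_incl[OF assms(1) subalgebraI_subfield[OF assms(1,2,4)] eE] .
    hence bE: "set bs \<subseteq> E" using Span_base_incl[OF assms(1) bs(1)] bs(3) by blast
    have bF: "independent F bs" using linearly_disjointD[OF assms(6) bE bs(2)] .
    have "set es \<subseteq> Span K bs" using Span_base_incl[OF assms(1) eO] bs(3) by simp
    from combine_Span_exchange[OF assms(1) bs(1) this]
    obtain cols where c: "length cols = length bs" "\<forall>c \<in> set cols. set c \<subseteq> K \<and> length c = length es"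
      "\<forall>ws. set ws \<subseteq> carrier \<Omega> \<and> length ws = length es \<longrightarrow>
        combine es ws = combine (map (\<lambda>c. combine c ws) cols) bs"
      "(\<forall>c \<in> set cols. set c \<subseteq> {\<zero>}) \<longrightarrow> set es \<subseteq> {\<zero>}"
      by (elim exE conjE) (rule that; assumption)
    have ce: "combine es us = combine (map (\<lambda>c. combine c us) cols) bs" using c(3) usO es(3) by simp
    have cF: "set (map (\<lambda>c. combine c us) cols) \<subseteq> F"
      using combine_in_subring[OF subfieldE(1)[OF assms(3)] _ us(1)] c(2) assms(5) by auto
    have "set (map (\<lambda>c. combine c us) cols) \<subseteq> {\<zero>}"
      using independent_imp_trivial_combine[OF assms(3) bF cF] c(1) ce es(4) by simp
    hence "set c \<subseteq> {\<zero>}" if "c \<in> set cols" for c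
      using independent_imp_trivial_combine[OF assms(1) us(2), of c] c(2) es(3) that by auto
    thus "set (take (length us) Ks) \<subseteq> {\<zero>}" using c(4) es(1) by blast
  qed
qed

lemma compositum_subfield:
  assumes "A \<subseteq> carrier \<Omega>" "B \<subseteq> carrier \<Omega>"
  shows "subfield (compositum \<Omega> A B) \<Omega>"
  unfolding compositum_def using generate_field_is_subfield assms by blast

lemma compositum_upper: "A \<subseteq> compositum \<Omega> A B" "B \<subseteq> compositum \<Omega> A B"
  unfolding compositum_def by (auto intro: generate_field.incl)

lemma compositum_least:
  assumes "subfield C \<Omega>" "A \<subseteq> C" "B \<subseteq> C"
  shows "compositum \<Omega> A B \<subseteq> C"
  unfolding compositum_def using generate_field_min_subfield1[of "A \<union> B" C] assms subfieldE(3)[OF assms(1)] by blast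

lemma compositum_mono:
  assumes "A \<subseteq> A'" "B \<subseteq> B'" "A' \<subseteq> carrier \<Omega>" "B' \<subseteq> carrier \<Omega>"
  shows "compositum \<Omega> A B \<subseteq> compositum \<Omega> A' B'"
  unfolding compositum_def by (rule mono_generate_field) (use assms in auto)

lemma compositum_commute: "compositum \<Omega> A B = compositum \<Omega> B A"
  unfolding compositum_def by (simp add: Un_commute)

text \<open>Every \<open>y\<close> is algebraic over \<open>E\<close>, so its inverse lies in
  \<open>E(y)\<close>, a field inside \<open>V\<close>.\<close>

lemma finite_subring_is_subfield:
  assumes "subfield E \<Omega>" "subring V \<Omega>" "E \<subseteq> V" "finite_dimension E V"
  shows "subfield V \<Omega>"
proof (rule subfieldI'[OF assms(2)])
  fix y assume y: "y \<in> V - {\<zero>}"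
  have yO: "y \<in> carrier \<Omega>" using y subringE(1)[OF assms(2)] by blast
  have "(algebraic over E) y" using finite_dimension_imp_algebraic[OF assms(1,2,4)] y by blast
  hence S: "subfield (simple_extension E y) \<Omega>" using simple_extension_is_subfield[OF assms(1) yO] by blast
  have "y \<in> simple_extension E y - {\<zero>}" using simple_extension_mem[OF subfieldE(1)[OF assms(1)] yO] y by blast
  moreover have "simple_extension E y \<subseteq> V" using simple_extension_subring_incl[OF assms(2,3)] y by blast
  ultimately show "inv y \<in> V" using subfield_m_inv(1)[OF S] by blast
qed

text \<open>The span is closed under products since multiplying a member of \<open>us\<close> by an
  element of \<open>J\<close> stays in \<open>J\<close>; having finite dimension over
  \<open>E\<close>, it is a field.\<close>

lemma compositum_eq_Span:
  assumes "subfield K \<Omega>" "subfield E \<Omega>" "subfield J \<Omega>" "K \<subseteq> E" "K \<subseteq> J" "set us \<subseteq> J" "Span K us = J"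
  shows "compositum \<Omega> E J = Span E us"
proof
  have JO: "J \<subseteq> carrier \<Omega>" using subfieldE(3)[OF assms(3)] .
  have EO: "E \<subseteq> carrier \<Omega>" using subfieldE(3)[OF assms(2)] .
  have usO: "set us \<subseteq> carrier \<Omega>" using JO assms(6) by blast
  let ?C = "compositum \<Omega> E J"
  have C: "subfield ?C \<Omega>" using compositum_subfield[OF EO JO] .
  show "Span E us \<subseteq> ?C"
    using subalgebra_Span_incl[OF assms(2) subalgebraI_subfield[OF assms(2) C]] compositum_upper(1)[of E J]
      order_trans[OF assms(6) compositum_upper(2)] by blast
  let ?V = "Span E us"
  have JV: "J \<subseteq> ?V" using Span_mono_field[OF assms(1,2,4) usO] assms(7) by blast
  note sp = Span_subgroup_props[OF assms(2) usO]
  have mJ: "x \<otimes> y \<in> ?V" if xy: "x \<in> ?V" "y \<in> J" for x y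
  proof -
    obtain ks where k: "set ks \<subseteq> E" "x = combine ks us"
      using xy(1) Span_eq_combine_set[OF assms(2) usO] by blast
    have yO: "y \<in> carrier \<Omega>" using xy(2) JO by blast
    let ?us = "map (\<lambda>u. u \<otimes> y) us"
    have "set ?us \<subseteq> J" using assms(6) xy(2) subringE(6)[OF subfieldE(1)[OF assms(3)]] by auto
    hence s: "set ?us \<subseteq> ?V" "set ?us \<subseteq> carrier \<Omega>" using JV JO by blast+
    have "x \<otimes> y = combine ks ?us" using combine_l_distr[OF _ usO yO, of ks] k EO by blast
    hence "x \<otimes> y \<in> Span E ?us" using Span_eq_combine_set[OF assms(2) s(2)] k(1) by blast
    thus ?thesis using mono_Span_subset[OF assms(2) s(1) usO] by blast
  qed
  have m: "x \<otimes> y \<in> ?V" if xy: "x \<in> ?V" "y \<in> ?V" for x y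
  proof -
    have xO: "x \<in> carrier \<Omega>" using xy(1) sp(1) by blast
    obtain ks where k: "set ks \<subseteq> E" "y = combine ks us"
      using xy(2) Span_eq_combine_set[OF assms(2) usO] by blast
    let ?us = "map (\<lambda>u. u \<otimes> x) us"
    have "u \<otimes> x \<in> ?V" if "u \<in> set us" for u
    proof -
      have "u \<in> J" "u \<in> carrier \<Omega>" using that assms(6) usO by blast+
      thus ?thesis using mJ[OF xy(1)] m_comm[OF _ xO] by simp
    qed
    hence s: "set ?us \<subseteq> ?V" by auto
    hence s2: "set ?us \<subseteq> carrier \<Omega>" using sp(1) by blast
    have "y \<otimes> x = combine ks ?us" using combine_l_distr[OF _ usO xO, of ks] k EO by blast
    hence "y \<otimes> x \<in> Span E ?us" using Span_eq_combine_set[OF assms(2) s2] k(1) by blast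
    hence "y \<otimes> x \<in> ?V" using mono_Span_subset[OF assms(2) s usO] by blast
    thus ?thesis using xO xy(2) sp(1) by (metis m_comm subsetD)
  qed
  have oneV: "\<one> \<in> ?V" using subringE(3)[OF subfieldE(1)[OF assms(3)]] JV by blast
  have V: "subring ?V \<Omega>" by (rule subringI) (use sp m oneV in auto)
  have "e \<in> ?V" if e: "e \<in> E" for e
    using Span_smult_closed[OF assms(2) usO e oneV] e EO by auto
  hence EV: "E \<subseteq> ?V" by blast
  have "subfield ?V \<Omega>"
    using finite_subring_is_subfield[OF assms(2) V EV Span_finite_dimension[OF assms(2) usO]] .
  thus "?C \<subseteq> ?V" using compositum_least EV JV by blast
qed

lemma finite_compositum:
  assumes "finite_field_ext \<Omega> K J" "subfield E \<Omega>" "K \<subseteq> E"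
  shows "finite_field_ext \<Omega> E (compositum \<Omega> E J)"
proof -
  note J = finite_field_ext_subfields[OF assms(1)]
  obtain us where us: "set us \<subseteq> J" "Span K us = J" using finite_field_ext_basis[OF assms(1)] by metis
  have "set us \<subseteq> carrier \<Omega>" using us(1) J(4) by blast
  hence "finite_dimension E (compositum \<Omega> E J)"
    using compositum_eq_Span[OF J(1) assms(2) J(2) assms(3) J(3) us] Span_finite_dimension[OF assms(2)] by simp
  thus ?thesis
    using compositum_subfield[OF subfieldE(3)[OF assms(2)] J(4)] compositum_upper(1)[of E J] assms(2)
    unfolding finite_field_ext_def field_ext_def by blast
qed

end

text \<open>\<open>P\<close> and \<open>Q\<close> stand for the two normal closures; of normality it
  keeps stability under conjugates over \<open>K\<close>. These fields stay fixed while the members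
  of the chains vary inside them.\<close>

locale disjoint_normal_fields = closed_field +
  fixes K P Q
  assumes base: "subfield K \<Omega>"
    and P: "subfield P \<Omega>" "K \<subseteq> P" "\<And>x. x \<in> P \<Longrightarrow> conjugates K x \<subseteq> P"
    and Q: "subfield Q \<Omega>" "K \<subseteq> Q" "\<And>x. x \<in> Q \<Longrightarrow> conjugates K x \<subseteq> Q"
    and disjoint: "linearly_disjoint \<Omega> K P Q"
begin

text \<open>Gives each one-sided result about \<open>L\<close> a mirror image about
  \<open>J\<close>.\<close>

lemma swap: "disjoint_normal_fields \<Omega> K Q P"
  using base P Q linearly_disjoint_commute[OF base P(1) Q(1) P(2) Q(2) disjoint] closed_field_axioms
  unfolding disjoint_normal_fields_def disjoint_normal_fields_axioms_def by blast

lemma independent_over_P: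
  assumes "set us \<subseteq> Q" "independent K us"
  shows "independent P us"
  using linearly_disjointD[OF linearly_disjoint_commute[OF base P(1) Q(1) P(2) Q(2) disjoint] assms] .

lemma coordinates_mem:
  assumes "independent P us" "subfield E \<Omega>" "E \<subseteq> P" "combine ks us \<in> Span E us" "set ks \<subseteq> P" "length ks = length us"
  shows "set ks \<subseteq> E"
proof -
  have usO: "set us \<subseteq> carrier \<Omega>" using independent_in_carrier[OF assms(1)] .
  obtain ls where l: "set ls \<subseteq> E" "length ls = length us" "combine ks us = combine ls us"
    using Span_mem_iff_length_version[OF assms(2) usO] assms(4) by blast
  have "combine ks us \<in> Span P us" using Span_mem_iff_length_version[OF P(1) usO] assms(5,6) by blast
  hence "ks = ls" using unique_decomposition[OF P(1) assms(1)] l assms(3,5,6) by blast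
  thus ?thesis using l(1) by blast
qed

text \<open>In a basis of \<open>J\<close> that contains one, an element \<open>x\<close> of
  \<open>P\<close> has the single nonzero coordinate \<open>x\<close>. Being in \<open>EJ\<close>
  puts this coordinate into \<open>E\<close>.\<close>

lemma compositum_inter:
  assumes "finite_field_ext \<Omega> K J" "J \<subseteq> Q" "subfield E \<Omega>" "K \<subseteq> E" "E \<subseteq> P"
  shows "compositum \<Omega> E J \<inter> P = E"
proof
  show "E \<subseteq> compositum \<Omega> E J \<inter> P" using compositum_upper(1) assms(5) by blast
  note J = finite_field_ext_subfields[OF assms(1)]
  have oJ: "set [\<one>] \<subseteq> J" using subringE(3)[OF subfieldE(1)[OF J(2)]] by simp
  have "\<one> \<notin> Span K []" using subfieldE(6)[OF base] by (simp add: Span.simps)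
  hence "independent K [\<one>]" using li_Cons[of \<one> K "[]"] by simp
  then obtain vs where vs: "independent K (vs @ [\<one>])" "Span K (vs @ [\<one>]) = J"
    using complete_base[OF J(1) finite_dimensionE[OF J(1,6)] _ oJ] by blast
  let ?us = "vs @ [\<one>]"
  have usO: "set ?us \<subseteq> carrier \<Omega>" using independent_in_carrier[OF vs(1)] .
  have usJ: "set ?us \<subseteq> J" using Span_base_incl[OF J(1) usO] vs(2) by simp
  have ind: "independent P ?us" using independent_over_P[OF _ vs(1)] usJ assms(2) by blast
  have C: "compositum \<Omega> E J = Span E ?us" using compositum_eq_Span[OF J(1) assms(3) J(2) assms(4) J(3) usJ vs(2)] .
  show "compositum \<Omega> E J \<inter> P \<subseteq> E"
  proof
    fix x assume x: "x \<in> compositum \<Omega> E J \<inter> P"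
    have xO: "x \<in> carrier \<Omega>" using x subfieldE(3)[OF P(1)] by blast
    let ?ks = "replicate (length vs) \<zero> @ [x]"
    have "combine ?ks ?us = combine [x] (drop (length vs) ?us)"
      using combine_prepend_replicate[of "[x]" ?us "length vs"] xO usO by simp
    hence "combine ?ks ?us = x" using xO by simp
    moreover have "set ?ks \<subseteq> P" using x subringE(2)[OF subfieldE(1)[OF P(1)]] by auto
    ultimately have "set ?ks \<subseteq> E"
      using coordinates_mem[OF ind assms(3,5), of ?ks] x C by simp
    thus "x \<in> E" by simp
  qed
qed

text \<open>A basis \<open>vs\<close> of \<open>F'\<close> is completed to a basis
  \<open>ws @ vs\<close> of \<open>J\<close>. Membership in \<open>LF'\<close> makes the coordinates
  at \<open>ws\<close> vanish, and membership in \<open>FJ\<close> puts the others into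
  \<open>F\<close>.\<close>

lemma compositum_inter_compositum:
  assumes "finite_field_ext \<Omega> K J" "J \<subseteq> Q" "subfield L \<Omega>" "K \<subseteq> L" "L \<subseteq> P"
    and "subfield F \<Omega>" "K \<subseteq> F" "F \<subseteq> L" "subfield F' \<Omega>" "K \<subseteq> F'" "F' \<subseteq> J"
  shows "compositum \<Omega> F J \<inter> compositum \<Omega> L F' \<subseteq> compositum \<Omega> F F'"
proof
  fix x assume x: "x \<in> compositum \<Omega> F J \<inter> compositum \<Omega> L F'"
  note J = finite_field_ext_subfields[OF assms(1)]
  have f': "finite_field_ext \<Omega> K F'" using finite_field_ext_between(1)[OF assms(1,9-11)] .
  obtain vs where vs: "set vs \<subseteq> F'" "independent K vs" "Span K vs = F'"
    using finite_field_ext_basis[OF f'] by metis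
  obtain ws where ws: "independent K (ws @ vs)" "Span K (ws @ vs) = J"
    using complete_base[OF J(1) finite_dimensionE[OF J(1,6)] vs(2)] vs(1) assms(11) by blast
  let ?us = "ws @ vs"
  have usO: "set ?us \<subseteq> carrier \<Omega>" using independent_in_carrier[OF ws(1)] .
  hence vsO: "set vs \<subseteq> carrier \<Omega>" by simp
  have usJ: "set ?us \<subseteq> J" using Span_base_incl[OF J(1) usO] ws(2) by simp
  have ind: "independent P ?us" using independent_over_P[OF _ ws(1)] usJ assms(2) by blast
  have C: "compositum \<Omega> F J = Span F ?us" using compositum_eq_Span[OF J(1) assms(6) J(2) assms(7) J(3) usJ ws(2)] .
  have C': "compositum \<Omega> L F' = Span L vs" using compositum_eq_Span[OF J(1) assms(3) assms(9) assms(4,10) vs(1,3)] .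
  have C'': "compositum \<Omega> F F' = Span F vs" using compositum_eq_Span[OF J(1) assms(6) assms(9) assms(7,10) vs(1,3)] .
  obtain ks where k: "set ks \<subseteq> L" "length ks = length vs" "x = combine ks vs"
    using x Span_mem_iff_length_version[OF assms(3) vsO] unfolding C' by blast
  have kO: "set ks \<subseteq> carrier \<Omega>" using k(1) subfieldE(3)[OF assms(3)] by blast
  let ?ks = "replicate (length ws) \<zero> @ ks"
  have "combine ?ks ?us = x"
    using combine_prepend_replicate[OF kO usO, of "length ws"] k(3) by simp
  moreover have "set ?ks \<subseteq> P" using k(1) assms(5) subringE(2)[OF subfieldE(1)[OF P(1)]] by auto
  moreover have "F \<subseteq> P" using assms(5,8) by blast
  ultimately have "set ?ks \<subseteq> F" using coordinates_mem[OF ind assms(6), of ?ks] x C k(2) by simp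
  thus "x \<in> compositum \<Omega> F F'"
    unfolding C'' using Span_mem_iff_length_version[OF assms(6) vsO] k by auto
qed

text \<open>Expanding its coefficients in \<open>us\<close>, split \<open>Irr\<close> over
  \<open>AJ\<close> into polynomials over \<open>A\<close>. Their values at \<open>x\<close> lie in
  \<open>P\<close> and vanish separately by independence, so they vanish at every conjugate of
  \<open>x\<close> over \<open>A\<close> too.\<close>

lemma conjugates_compositum:
  assumes "finite_field_ext \<Omega> K J" "J \<subseteq> Q" "subfield A \<Omega>" "K \<subseteq> A" "A \<subseteq> P"
    and "x \<in> P" "(algebraic over A) x"
  shows "conjugates A x \<subseteq> conjugates (compositum \<Omega> A J) x"
proof
  fix y assume y: "y \<in> conjugates A x"
  note J = finite_field_ext_subfields[OF assms(1)]
  let ?C = "compositum \<Omega> A J"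
  have C: "subfield ?C \<Omega>" using compositum_subfield[OF subfieldE(3)[OF assms(3)] J(4)] .
  have xO: "x \<in> carrier \<Omega>" using assms(6) subfieldE(3)[OF P(1)] by blast
  have yO: "y \<in> carrier \<Omega>" using y conjugates_carrier by blast
  have alg: "(algebraic over ?C) x" using algebraic_mono[OF compositum_upper(1)[of A J]] assms(7) unfolding over_def by blast
  note I = IrrE[OF C xO alg]
  obtain us where us: "set us \<subseteq> J" "independent K us" "Span K us = J"
    using finite_field_ext_basis[OF assms(1)] by metis
  have usO: "set us \<subseteq> carrier \<Omega>" using us(1) J(4) by blast
  have ind: "independent P us" using independent_over_P[OF _ us(2)] us(1) assms(2) by blast
  let ?p = "Irr ?C x"
  have "set ?p \<subseteq> Span A us"
    using polynomial_set[OF I(1)] compositum_eq_Span[OF J(1) assms(3) J(2) assms(4) J(3) us(1,3)] by simp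
  from combine_Span_exchange[OF assms(3) usO this]
  obtain cols where c: "length cols = length us" "\<forall>c \<in> set cols. set c \<subseteq> A \<and> length c = length ?p"
    "\<forall>ws. set ws \<subseteq> carrier \<Omega> \<and> length ws = length ?p \<longrightarrow>
      combine ?p ws = combine (map (\<lambda>c. combine c ws) cols) us"
    by (elim exE conjE) (rule that; assumption)
  \<comment> \<open>Evaluation is combination with the list of powers of \<open>z\<close>. All
    columns have the length of \<open>?p\<close>, so one list of powers serves them all.\<close>
  have ev: "eval ?p z = combine (map (\<lambda>c. eval c z) cols) us" if z: "z \<in> carrier \<Omega>" for z
  proof -
    let ?e = "exp_base z (length ?p)"
    have "combine c ?e = eval c z" if "c \<in> set cols" for c
      using combine_eq_eval[of c z] c(2) that by simp
    hence "map (\<lambda>c. combine c ?e) cols = map (\<lambda>c. eval c z) cols" by simp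
    moreover have "length ?e = length ?p" by (simp add: exp_base_def)
    ultimately show ?thesis using c(3) exp_base_closed[OF z] combine_eq_eval[of ?p z] by metis
  qed
  have eP: "eval c x \<in> P" if "c \<in> set cols" for c
  proof -
    have "set (exp_base x n) \<subseteq> P" for n
    proof -
      have "x [^] i \<in> P" for i :: nat
        using assms(6) subringE(3,6)[OF subfieldE(1)[OF P(1)]] by (induction i) auto
      thus ?thesis unfolding exp_base_def by auto
    qed
    thus ?thesis
      using combine_in_subring[OF subfieldE(1)[OF P(1)], of c "exp_base x (length c)"] combine_eq_eval[of c x]
        c(2) that assms(5) by auto
  qed
  have "set (map (\<lambda>c. eval c x) cols) \<subseteq> {\<zero>}"
    using independent_imp_trivial_combine[OF P(1) ind, of "map (\<lambda>c. eval c x) cols"] eP ev[OF xO] I(4) c(1) by auto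
  hence z: "eval c x = \<zero>" if "c \<in> set cols" for c using that by auto
  have "eval c y = \<zero>" if cc: "c \<in> set cols" for c
  proof -
    have cA: "set c \<subseteq> A" using c(2) cc by blast
    hence cO: "set c \<subseteq> carrier \<Omega>" using subfieldE(3)[OF assms(3)] by blast
    \<comment> \<open>A column may start with zeros and is a polynomial only after
      normalization.\<close>
    have "normalize c \<in> carrier (A[X])"
      using normalize_gives_polynomial[OF cA] unfolding univ_poly_carrier .
    moreover have "eval (normalize c) x = \<zero>" using eval_normalize[OF cO xO] z[OF cc] by simp
    ultimately have "eval (normalize c) y = \<zero>" using conjugate_root[OF assms(3) xO assms(7)] y by blast
    thus ?thesis using eval_normalize[OF cO yO] by simp
  qed
  hence "map (\<lambda>c. eval c y) cols = replicate (length us) \<zero>"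
    using c(1) by (auto intro!: nth_equalityI)
  hence "eval ?p y = \<zero>" using ev[OF yO] combine_replicate[OF usO] by simp
  thus "y \<in> conjugates ?C x" using yO unfolding conjugates_def by blast
qed

end

section \<open>Chains\<close>

context closed_field
begin

text \<open>\<open>LJ\<close> is generated over \<open>NN'\<close> by \<open>L\<close> and
  \<open>J\<close>, whose elements stay separable and keep their conjugates inside when the base
  grows.\<close>

lemma galois_ext_compositum:
  assumes "finite_field_ext \<Omega> N L" "finite_field_ext \<Omega> N' J"
    and "finite_field_ext \<Omega> (compositum \<Omega> N N') (compositum \<Omega> L J)"
    and "galois_ext \<Omega> N L" "galois_ext \<Omega> N' J"
  shows "galois_ext \<Omega> (compositum \<Omega> N N') (compositum \<Omega> L J)"
proof -
  note L = finite_field_ext_subfields[OF assms(1)] and J = finite_field_ext_subfields[OF assms(2)]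
  let ?F = "compositum \<Omega> N N'" let ?E = "compositum \<Omega> L J"
  note E = finite_field_ext_subfields[OF assms(3)]
  have up: "L \<subseteq> ?E" "J \<subseteq> ?E" "N \<subseteq> ?F" "N' \<subseteq> ?F" using compositum_upper by auto
  have aL: "separable_over ?F a \<and> conjugates ?F a \<subseteq> ?E" if a: "a \<in> L" for a
  proof -
    have aO: "a \<in> carrier \<Omega>" using a L(4) by blast
    have alg: "(algebraic over N) a" using finite_field_ext_algebraic[OF assms(1) a] .
    have "separable_over N a" "conjugates N a \<subseteq> L" using assms(4) a unfolding galois_ext_iff by auto
    thus ?thesis using separable_over_mono[OF L(1) E(1) up(3) aO alg] conjugates_mono[OF L(1) E(1) up(3) aO alg] up(1) by blast
  qed
  have aJ: "separable_over ?F a \<and> conjugates ?F a \<subseteq> ?E" if a: "a \<in> J" for a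
  proof -
    have aO: "a \<in> carrier \<Omega>" using a J(4) by blast
    have alg: "(algebraic over N') a" using finite_field_ext_algebraic[OF assms(2) a] .
    have "separable_over N' a" "conjugates N' a \<subseteq> J" using assms(5) a unfolding galois_ext_iff by auto
    thus ?thesis using separable_over_mono[OF J(1) E(1) up(4) aO alg] conjugates_mono[OF J(1) E(1) up(4) aO alg] up(2) by blast
  qed
  have "?E = generate_field \<Omega> (?F \<union> (L \<union> J))"
  proof
    have s: "?F \<union> (L \<union> J) \<subseteq> carrier \<Omega>" using E(5) L(4) J(4) by blast
    show "?E \<subseteq> generate_field \<Omega> (?F \<union> (L \<union> J))"
      unfolding compositum_def[of \<Omega> L J] by (rule mono_generate_field[OF _ s]) blast
    show "generate_field \<Omega> (?F \<union> (L \<union> J)) \<subseteq> ?E"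
      using generate_field_min_subfield1[OF s E(2)] E(3) up by blast
  qed
  thus ?thesis using galois_ext_generated[OF assms(3), of "L \<union> J"] aL aJ up by blast
qed

text \<open>Adjoining all conjugates of \<open>z\<close> to \<open>A\<close> gives a Galois
  subextension of \<open>L\<close>, which \<open>F\<close> must contain.\<close>

lemma largest_galois_subext_mem:
  assumes "finite_field_ext \<Omega> A L" "largest_galois_subext \<Omega> A L F"
    and "z \<in> L" "separable_over A z" "conjugates A z \<subseteq> L"
  shows "z \<in> F"
proof -
  note L = finite_field_ext_subfields[OF assms(1)]
  have zO: "z \<in> carrier \<Omega>" using assms(3) L(4) by blast
  have alg: "(algebraic over A) z" using finite_field_ext_algebraic[OF assms(1,3)] .
  let ?E = "generate_field \<Omega> (A \<union> conjugates A z)"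
  have s: "A \<union> conjugates A z \<subseteq> carrier \<Omega>" using L(5) conjugates_carrier by blast
  have E: "subfield ?E \<Omega>" using generate_field_is_subfield[OF s] .
  have EL: "?E \<subseteq> L" using generate_field_min_subfield1[OF s L(2)] L(3) assms(5) by blast
  have AE: "A \<subseteq> ?E" and cE: "conjugates A z \<subseteq> ?E" by (auto intro: generate_field.incl)
  have "galois_ext \<Omega> A ?E"
    by (rule galois_ext_generated[OF finite_field_ext_between(1)[OF assms(1) E AE EL] cE refl])
      (use conjugates_conjugate[OF L(1) zO alg] assms(4) cE in auto)
  moreover have "intermediate_field \<Omega> A L ?E"
    using E L AE EL unfolding intermediate_field_def field_ext_def by blast
  ultimately have "?E \<subseteq> F" using assms(2) unfolding largest_galois_subext_def by blast
  thus ?thesis using cE conjugates_self[OF L(1) zO alg] by blast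
qed

lemma embedding_combine:
  assumes "subring E \<Omega>" "h \<in> embeddings F E" "F \<subseteq> E" "set us \<subseteq> F" "set ls \<subseteq> E"
  shows "h (combine ls us) = combine (map h ls) us"
proof -
  have hom: "h \<in> ring_hom (\<Omega>\<lparr>carrier := E\<rparr>) \<Omega>" and hfix: "\<And>x. x \<in> F \<Longrightarrow> h x = x"
    using assms(2) unfolding embeddings_def by auto
  have "set us \<subseteq> E" using assms(3,4) by blast
  thus ?thesis
    using assms(4,5)
  proof (induction ls us rule: combine.induct)
    case (1 k Ks u Us)
    have "combine Ks Us \<in> E" using combine_in_subring[OF assms(1)] 1 by simp
    thus ?case using 1 restricted_hom(2,3)[OF hom] hfix subringE(6)[OF assms(1)] by simp
  qed (use restricted_hom_zero[OF assms(1) hom] in auto)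
qed

end

context disjoint_normal_fields
begin

lemma compositum_finite:
  assumes "finite_field_ext \<Omega> K L" "finite_field_ext \<Omega> K J"
  shows "finite_field_ext \<Omega> K (compositum \<Omega> L J)"
  using finite_field_ext_trans[OF assms(1) finite_compositum[OF assms(2)]]
    finite_field_ext_subfields[OF assms(1)] by blast

lemma galois_base_contains:
  assumes "finite_field_ext \<Omega> K L" "L \<subseteq> P" "finite_field_ext \<Omega> K J" "J \<subseteq> Q"
    and "max_galois_base \<Omega> K L N" "intermediate_field \<Omega> K (compositum \<Omega> L J) N''"
    and "galois_ext \<Omega> N'' (compositum \<Omega> L J)"
  shows "N \<subseteq> N''"
proof -
  let ?M = "compositum \<Omega> L J"
  note L = finite_field_ext_subfields[OF assms(1)]
  have fM: "finite_field_ext \<Omega> K ?M" using compositum_finite[OF assms(1,3)] .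
  have LM: "L \<subseteq> ?M" using compositum_upper(1) .
  have N'': "subfield N'' \<Omega>" "K \<subseteq> N''" "N'' \<subseteq> ?M"
    using assms(6) unfolding intermediate_field_def field_ext_def by auto
  have fN: "finite_field_ext \<Omega> N'' ?M" using intermediate_finite(2)[OF fM assms(6)] .
  have sub: "subfield (N'' \<inter> L) \<Omega>" "K \<subseteq> N'' \<inter> L" using subfield_inter[OF N''(1) L(2)] N''(2) L(3) by auto
  have fin: "finite_field_ext \<Omega> (N'' \<inter> L) L" using finite_field_ext_between(2)[OF assms(1) sub] by blast
  have "galois_ext \<Omega> (N'' \<inter> L) L"
  \<comment> \<open>The embeddings of the whole compositum are read on \<open>L\<close>; the
    criterion asks only that they preserve \<open>L\<close> and fix nothing in it outside
    \<open>N''\<close>.\<close>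
  proof (rule galois_ext_fixed_field[OF fin, of "embeddings N'' ?M"])
    show "embeddings N'' ?M \<subseteq> embeddings (N'' \<inter> L) L"
      using restricted_hom_subset[OF _ LM] unfolding embeddings_def by blast
    show "h ` L \<subseteq> L" if h: "h \<in> embeddings N'' ?M" for h
    proof
      fix y assume "y \<in> h ` L"
      then obtain l where l: "l \<in> L" "y = h l" by blast
      have "h \<in> embeddings K ?M" using h N''(2) unfolding embeddings_def by blast
      hence "h l \<in> conjugates K l" using embedding_conjugates[OF fM] l(1) LM by blast
      hence "y \<in> P" using P(3) l assms(2) by blast
      moreover have "y \<in> ?M" using galois_embedding_image[OF fN assms(7) h] l LM by blast
      ultimately show "y \<in> L" using compositum_inter[OF assms(3,4) L(2,3) assms(2)] by blast
    qed
    show "x \<in> N'' \<inter> L" if "x \<in> L" "\<And>h. h \<in> embeddings N'' ?M \<Longrightarrow> h x = x" for x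
      using galois_fixed[OF fN assms(7)] that LM by blast
  qed
  moreover have "intermediate_field \<Omega> K L (N'' \<inter> L)"
    using sub L unfolding intermediate_field_def field_ext_def by blast
  ultimately have "N \<subseteq> N'' \<inter> L" using assms(5) unfolding max_galois_base_iff[OF assms(1)] by blast
  thus ?thesis by blast
qed

text \<open>Minimality is proved factor by factor: a competing base contains \<open>N\<close>, and
  by symmetry \<open>N'\<close>, hence their compositum.\<close>

lemma max_galois_base_compositum:
  assumes "finite_field_ext \<Omega> K L" "L \<subseteq> P" "finite_field_ext \<Omega> K J" "J \<subseteq> Q"
    and "max_galois_base \<Omega> K L N" "max_galois_base \<Omega> K J N'"
  shows "max_galois_base \<Omega> K (compositum \<Omega> L J) (compositum \<Omega> N N')"
proof -
  interpret S: disjoint_normal_fields \<Omega> K Q P using swap .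
  let ?M = "compositum \<Omega> L J" let ?N = "compositum \<Omega> N N'"
  note L = finite_field_ext_subfields[OF assms(1)] and J = finite_field_ext_subfields[OF assms(3)]
  have fM: "finite_field_ext \<Omega> K ?M" using compositum_finite[OF assms(1,3)] .
  note M = finite_field_ext_subfields[OF fM]
  have iN: "intermediate_field \<Omega> K L N" "galois_ext \<Omega> N L" and iN': "intermediate_field \<Omega> K J N'" "galois_ext \<Omega> N' J"
    using assms(5,6) unfolding max_galois_base_def by auto
  have s: "K \<subseteq> N" "N \<subseteq> L" "N' \<subseteq> J"
    using iN(1) iN'(1) unfolding intermediate_field_def field_ext_def by auto
  have sN: "subfield ?N \<Omega>" using compositum_subfield s L(4) J(4) by blast
  have KN: "K \<subseteq> ?N" using s(1) compositum_upper(1) by blast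
  have NM: "?N \<subseteq> ?M" using compositum_mono[OF s(2,3) L(4) J(4)] .
  have int: "intermediate_field \<Omega> K ?M ?N"
    using sN KN NM M unfolding intermediate_field_def field_ext_def by blast
  have "galois_ext \<Omega> ?N ?M"
    using galois_ext_compositum[OF intermediate_finite(2)[OF assms(1) iN(1)] intermediate_finite(2)[OF assms(3) iN'(1)]
        intermediate_finite(2)[OF fM int] iN(2) iN'(2)] .
  moreover have "?N \<subseteq> N''" if N'': "intermediate_field \<Omega> K ?M N''" "galois_ext \<Omega> N'' ?M" for N''
  proof (rule compositum_least)
    show "subfield N'' \<Omega>" using N''(1) unfolding intermediate_field_def field_ext_def by blast
    show "N \<subseteq> N''" using galois_base_contains[OF assms(1-5) N''] .
    show "N' \<subseteq> N''"
      using S.galois_base_contains[OF assms(3,4,1,2,6)] N'' compositum_commute[of L J] by simp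
  qed
  ultimately show ?thesis unfolding max_galois_base_iff[OF fM] using int by blast
qed

lemma galois_subext_contained:
  assumes "finite_field_ext \<Omega> K L" "L \<subseteq> P" "finite_field_ext \<Omega> K J" "J \<subseteq> Q"
    and "intermediate_field \<Omega> K L A" "intermediate_field \<Omega> K J A'" "largest_galois_subext \<Omega> A L F"
    and "intermediate_field \<Omega> (compositum \<Omega> A A') (compositum \<Omega> L J) G" "galois_ext \<Omega> (compositum \<Omega> A A') G"
  shows "G \<subseteq> compositum \<Omega> F J"
proof
  fix x assume x: "x \<in> G"
  let ?M = "compositum \<Omega> L J" let ?B = "compositum \<Omega> A A'" let ?AJ = "compositum \<Omega> A J" let ?FJ = "compositum \<Omega> F J"
  note L = finite_field_ext_subfields[OF assms(1)] and J = finite_field_ext_subfields[OF assms(3)]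
  have A: "subfield A \<Omega>" "K \<subseteq> A" "A \<subseteq> L" and A': "subfield A' \<Omega>" "A' \<subseteq> J"
    using assms(5,6) unfolding intermediate_field_def field_ext_def by auto
  have F: "subfield F \<Omega>" "A \<subseteq> F" "F \<subseteq> L"
    using assms(7) unfolding largest_galois_subext_def intermediate_field_def field_ext_def by auto
  have G: "subfield G \<Omega>" "?B \<subseteq> G" "G \<subseteq> ?M" "subfield ?B \<Omega>"
    using assms(8) unfolding intermediate_field_def field_ext_def by auto
  have FO: "F \<subseteq> carrier \<Omega>" and AO: "A \<subseteq> carrier \<Omega>" using F(3) A(3) L(4) by auto
  have fM: "finite_field_ext \<Omega> K ?M" using compositum_finite[OF assms(1,3)] .
  note M = finite_field_ext_subfields[OF fM]
  have LM: "L \<subseteq> ?M" using compositum_upper(1) .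
  have sAJ: "subfield ?AJ \<Omega>" and sFJ: "subfield ?FJ \<Omega>" using compositum_subfield[OF _ J(4)] AO FO by auto
  have BA: "?B \<subseteq> ?AJ" using compositum_mono[OF order_refl A'(2) AO J(4)] .
  have AF: "?AJ \<subseteq> ?FJ" using compositum_mono[OF F(2) order_refl FO J(4)] .
  have FM: "?FJ \<subseteq> ?M" using compositum_mono[OF F(3) order_refl L(4) J(4)] .
  have KA: "K \<subseteq> ?AJ" and JA: "J \<subseteq> ?AJ" and AA: "A \<subseteq> ?AJ" using order_trans[OF A(2)] compositum_upper by auto
  have fAJ: "finite_field_ext \<Omega> ?AJ ?M" using finite_field_ext_between(2)[OF fM sAJ KA] AF FM by blast
  have fFJ: "finite_field_ext \<Omega> ?FJ ?M" using finite_field_ext_between(2)[OF fM sFJ _ FM] KA AF by blast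
  have fB: "finite_field_ext \<Omega> ?B ?M"
    using finite_field_ext_between(2)[OF fM G(4)] BA AF FM A(2) compositum_upper(1)[of A A'] by blast
  have fAL: "finite_field_ext \<Omega> A L" using finite_field_ext_between(2)[OF assms(1) A] .
  obtain us where us: "set us \<subseteq> J" "independent K us" "Span K us = J"
    using finite_field_ext_basis[OF assms(3)] by metis
  have usO: "set us \<subseteq> carrier \<Omega>" using us(1) J(4) by blast
  have ind: "independent P us" using independent_over_P[OF _ us(2)] us(1) assms(4) by blast
  have MS: "?M = Span L us" using compositum_eq_Span[OF J(1) L(2) J(2) L(3) J(3) us(1,3)] .
  have xM: "x \<in> ?M" using x G(3) by blast
  obtain ls where ls: "set ls \<subseteq> L" "length ls = length us" "x = combine ls us"
    using xM Span_mem_iff_length_version[OF L(2) usO] unfolding MS by blast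
  have comb: "h x = combine (map h ls) us" if h: "h \<in> embeddings ?AJ ?M" for h
    unfolding ls(3)
    by (rule embedding_combine[OF subfieldE(1)[OF M(2)] h]) (use AF FM us(1) JA ls(1) LM in auto)
  have conjL: "conjugates A l \<subseteq> L" if l: "l \<in> set ls" for l
  proof
    fix y assume y: "y \<in> conjugates A l"
    have lL: "l \<in> L" using l ls(1) by blast
    \<comment> \<open>Disjointness enters here: an embedding can move \<open>l\<close> to
      \<open>y\<close> while fixing all of \<open>J\<close>, so that it acts on coordinates.\<close>
    have "y \<in> conjugates ?AJ l"
      using conjugates_compositum[OF assms(3,4) A(1,2) _ _ finite_field_ext_algebraic[OF fAL lL]] y A(3) assms(2) lL by blast
    then obtain h where h: "h \<in> embeddings ?AJ ?M" "h l = y"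
      using embedding_to_conjugate[OF fAJ] lL LM by blast
    have hB: "h \<in> embeddings ?B ?M" using h(1) BA unfolding embeddings_def by blast
    have hK: "h \<in> embeddings K ?M" using h(1) KA unfolding embeddings_def by blast
    have "h x \<in> conjugates ?B x" using embedding_conjugates[OF fB hB xM] .
    hence "h x \<in> ?M" using assms(9) x G(3) unfolding galois_ext_iff by blast
    moreover have "set (map h ls) \<subseteq> P"
    proof
      fix z assume "z \<in> set (map h ls)"
      then obtain l' where l': "l' \<in> L" "z = h l'" using ls(1) by auto
      have "h l' \<in> conjugates K l'" using embedding_conjugates[OF fM hK] l'(1) LM by blast
      thus "z \<in> P" using P(3) l' assms(2) by blast
    qed
    ultimately have "set (map h ls) \<subseteq> L"
      using coordinates_mem[OF ind L(2) assms(2), of "map h ls"] comb[OF h(1)] ls(2) MS by simp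
    thus "y \<in> L" using l h(2) by auto
  qed
  have "h x = x" if h: "h \<in> embeddings ?FJ ?M" for h
  proof -
    have hom: "h \<in> ring_hom (\<Omega>\<lparr>carrier := ?M\<rparr>) \<Omega>" and hfix: "\<And>z. z \<in> ?FJ \<Longrightarrow> h z = z"
      using h unfolding embeddings_def by auto
    have "h l = l" if l: "l \<in> set ls" for l
    proof -
      have lL: "l \<in> L" using l ls(1) by blast
      have lO: "l \<in> carrier \<Omega>" using lL L(4) by blast
      \<comment> \<open>\<open>l\<close> itself may be inseparable over \<open>A\<close> and so
        escape \<open>F\<close>; its \<open>q\<close>-th power does not.\<close>
      obtain q :: nat where q: "separable_over A (l [^] q)" "inj_on (\<lambda>y. y [^] q) (carrier \<Omega>)"
        using power_separable[OF A(1) lO finite_field_ext_algebraic[OF fAL lL]] by blast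
      have pow: "z [^] q \<in> L" if "z \<in> L" for z
        using that subringE(3,6)[OF subfieldE(1)[OF L(2)]] by (induction q) auto
      \<comment> \<open>Each such conjugate is the \<open>q\<close>-th power of a conjugate of
        \<open>l\<close>, which was just shown to lie in \<open>L\<close>.\<close>
      have "conjugates A (l [^] q) \<subseteq> L"
      proof
        fix w assume "w \<in> conjugates A (l [^] q)"
        then obtain g where g: "g \<in> embeddings A L" "g (l [^] q) = w"
          using embedding_to_conjugate[OF fAL pow[OF lL]] by blast
        have "g \<in> ring_hom (\<Omega>\<lparr>carrier := L\<rparr>) \<Omega>" using g(1) unfolding embeddings_def by blast
        hence "w = g l [^] q" using restricted_hom_pow[OF subfieldE(1)[OF L(2)] _ lL] g(2) by blast
        moreover have "g l \<in> L" using embedding_conjugates[OF fAL g(1) lL] conjL[OF l] by blast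
        ultimately show "w \<in> L" using pow by blast
      qed
      hence "l [^] q \<in> F" using largest_galois_subext_mem[OF fAL assms(7) pow[OF lL] q(1)] by blast
      hence "h (l [^] q) = l [^] q" using hfix compositum_upper(1)[of F J] by blast
      hence "h l [^] q = l [^] q" using restricted_hom_pow[OF subfieldE(1)[OF M(2)] hom, of l q] lL LM by auto
      thus "h l = l" using inj_onD[OF q(2)] restricted_hom(1)[OF hom, of l] lO lL LM by blast
    qed
    hence "map h ls = ls" by (intro map_idI)
    moreover have "h \<in> embeddings ?AJ ?M" using h AF unfolding embeddings_def by blast
    ultimately show ?thesis using comb ls(3) by metis
  qed
  \<comment> \<open>Being fixed by all embeddings does not suffice for inseparable elements;
    \<open>x\<close> inherits separability from the Galois extension \<open>G\<close> of
    \<open>AA'\<close>.\<close>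
  moreover have "separable_over ?FJ x"
  proof (rule separable_over_mono[OF G(4) sFJ])
    show "?B \<subseteq> ?FJ" using BA AF by blast
    show "x \<in> carrier \<Omega>" using xM M(4) by blast
    show "(algebraic over ?B) x" using finite_field_ext_algebraic[OF fB xM] .
    show "separable_over ?B x" using assms(9) x unfolding galois_ext_iff by blast
  qed
  ultimately show "x \<in> ?FJ" using separable_fixed[OF fFJ xM] by blast
qed

text \<open>A competitor lies in \<open>FJ\<close>, and by symmetry in \<open>LF'\<close>; by
  uniqueness of coordinates these two meet in \<open>FF'\<close>.\<close>

lemma largest_galois_subext_compositum:
  assumes "finite_field_ext \<Omega> K L" "L \<subseteq> P" "finite_field_ext \<Omega> K J" "J \<subseteq> Q"
    and "intermediate_field \<Omega> K L A" "intermediate_field \<Omega> K J A'"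
    and "largest_galois_subext \<Omega> A L F" "largest_galois_subext \<Omega> A' J F'"
  shows "largest_galois_subext \<Omega> (compositum \<Omega> A A') (compositum \<Omega> L J) (compositum \<Omega> F F')"
proof -
  interpret S: disjoint_normal_fields \<Omega> K Q P using swap .
  let ?M = "compositum \<Omega> L J" let ?B = "compositum \<Omega> A A'" let ?F = "compositum \<Omega> F F'"
  note L = finite_field_ext_subfields[OF assms(1)] and J = finite_field_ext_subfields[OF assms(3)]
  have A: "subfield A \<Omega>" "K \<subseteq> A" "A \<subseteq> L" and A': "subfield A' \<Omega>" "K \<subseteq> A'" "A' \<subseteq> J"
    using assms(5,6) unfolding intermediate_field_def field_ext_def by auto
  have F: "subfield F \<Omega>" "A \<subseteq> F" "F \<subseteq> L" "galois_ext \<Omega> A F"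
    and F': "subfield F' \<Omega>" "A' \<subseteq> F'" "F' \<subseteq> J" "galois_ext \<Omega> A' F'"
    using assms(7,8) unfolding largest_galois_subext_def intermediate_field_def field_ext_def by auto
  have fM: "finite_field_ext \<Omega> K ?M" using compositum_finite[OF assms(1,3)] .
  note M = finite_field_ext_subfields[OF fM]
  have FO: "F \<subseteq> carrier \<Omega>" "F' \<subseteq> carrier \<Omega>" using F(3) F'(3) L(4) J(4) by auto
  have sB: "subfield ?B \<Omega>" and sF: "subfield ?F \<Omega>" using compositum_subfield FO F(2) F'(2) by auto
  have BF: "?B \<subseteq> ?F" using compositum_mono[OF F(2) F'(2) FO] .
  have FM: "?F \<subseteq> ?M" using compositum_mono[OF F(3) F'(3) L(4) J(4)] .
  have KB: "K \<subseteq> ?B" using A(2) compositum_upper(1) by blast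
  have int: "intermediate_field \<Omega> ?B ?M ?F"
    using sB sF BF FM M(2) unfolding intermediate_field_def field_ext_def by blast
  have fB: "finite_field_ext \<Omega> ?B ?M" using finite_field_ext_between(2)[OF fM sB KB] BF FM by blast
  have "galois_ext \<Omega> ?B ?F"
    using galois_ext_compositum[OF _ _ intermediate_finite(1)[OF fB int] F(4) F'(4)]
      finite_field_ext_between(1)[OF finite_field_ext_between(2)[OF assms(1) A] F(1-3)]
      finite_field_ext_between(1)[OF finite_field_ext_between(2)[OF assms(3) A'] F'(1-3)] by blast
  moreover have "G \<subseteq> ?F" if G: "intermediate_field \<Omega> ?B ?M G" "galois_ext \<Omega> ?B G" for G
  proof -
    have "G \<subseteq> compositum \<Omega> F J" using galois_subext_contained[OF assms(1-7) G] .
    moreover have "G \<subseteq> compositum \<Omega> L F'"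
      using S.galois_subext_contained[OF assms(3,4,1,2,6,5,8)] G
        compositum_commute[of L J] compositum_commute[of A A'] compositum_commute[of L F'] by simp
    ultimately show ?thesis
      using compositum_inter_compositum[OF assms(3,4) L(2,3) assms(2) F(1) _ F(3) F'(1) _ F'(3)] A(2) A'(2) F(2) F'(2) by blast
  qed
  ultimately show ?thesis unfolding largest_galois_subext_def using int by blast
qed

text \<open>Intersecting a compositum with \<open>P\<close> or \<open>Q\<close> recovers its
  factors, so equal composita have equal factors.\<close>

lemma compositum_strict_mono:
  assumes "finite_field_ext \<Omega> K L" "L \<subseteq> P" "finite_field_ext \<Omega> K J" "J \<subseteq> Q"
    and "intermediate_field \<Omega> K L A" "intermediate_field \<Omega> K J A'" "A \<subset> L \<or> A' \<subset> J"
  shows "compositum \<Omega> A A' \<subset> compositum \<Omega> L J"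
proof -
  interpret S: disjoint_normal_fields \<Omega> K Q P using swap .
  note L = finite_field_ext_subfields[OF assms(1)] and J = finite_field_ext_subfields[OF assms(3)]
  note fA = intermediate_finite(1)[OF assms(1,5)] and fA' = intermediate_finite(1)[OF assms(3,6)]
  note A = finite_field_ext_subfields[OF fA] and A' = finite_field_ext_subfields[OF fA']
  have s: "A \<subseteq> L" "A' \<subseteq> J" using assms(5,6) unfolding intermediate_field_def field_ext_def by auto
  have sP: "A \<subseteq> P" "A' \<subseteq> Q" using s assms(2,4) by auto
  have "compositum \<Omega> A A' \<noteq> compositum \<Omega> L J"
  proof
    assume eq: "compositum \<Omega> A A' = compositum \<Omega> L J"
    have "A = L"
      using compositum_inter[OF fA' sP(2) A(2,3) sP(1)] compositum_inter[OF assms(3,4) L(2,3) assms(2)] eq by simp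
    moreover have "A' = J"
      using S.compositum_inter[OF fA sP(1) A'(2,3) sP(2)] S.compositum_inter[OF assms(1,2) J(2,3) assms(4)] eq
        compositum_commute[of A A'] compositum_commute[of L J] by simp
    ultimately show False using assms(7) by blast
  qed
  thus ?thesis using compositum_mono[OF s L(4) J(4)] by blast
qed

text \<open>Truncating indices with \<open>min\<close> continues the shorter chain by its last
  field, so that every index is treated by the same step. Strictness holds as long as one of the two
  chains still moves.\<close>

lemma descending_chain_compositum:
  assumes "finite_field_ext \<Omega> K L" "L \<subseteq> P" "finite_field_ext \<Omega> K J" "J \<subseteq> Q"
    and "descending_chain \<Omega> K L k N" "descending_chain \<Omega> K J k' N'"
  shows "descending_chain \<Omega> K (compositum \<Omega> L J) (max k k') (\<lambda>i. compositum \<Omega> (N (min i k)) (N' (min i k')))"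
proof -
  \<comment> \<open>Past the last index this is the stabilization condition, which makes the last
    field its own successor.\<close>
  have link: "max_galois_base \<Omega> K (C (min i n)) (C (min (Suc i) n))" if "descending_chain \<Omega> K E n C" for C E i n
    using that unfolding descending_chain_def by (cases "i < n") (auto simp: min_def not_less le_Suc_eq)
  have field: "finite_field_ext \<Omega> K (C (min i n)) \<and> C (min i n) \<subseteq> E"
    if "finite_field_ext \<Omega> K E" "descending_chain \<Omega> K E n C" for C E i n
  proof (induction i)
    case 0
    thus ?case using that unfolding descending_chain_def by simp
  next
    case (Suc i)
    have "intermediate_field \<Omega> K (C (min i n)) (C (min (Suc i) n))"
      using link[OF that(2)] unfolding max_galois_base_def by blast
    thus ?case using Suc intermediate_finite(1) unfolding intermediate_field_def field_ext_def by blast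
  qed
  have strict: "C (min (Suc i) n) \<subset> C (min i n)" if "descending_chain \<Omega> K E n C" "i < n" for C E i n
    using that unfolding descending_chain_def by (auto simp: min_def)
  note fN = field[OF assms(1,5)] and fN' = field[OF assms(3,6)]
  have step: "max_galois_base \<Omega> K (compositum \<Omega> (N (min i k)) (N' (min i k')))
      (compositum \<Omega> (N (min (Suc i) k)) (N' (min (Suc i) k')))" for i
    using max_galois_base_compositum[of "N (min i k)" "N' (min i k')"] fN[of i] fN'[of i] assms(2,4)
      link[OF assms(5), of i] link[OF assms(6), of i] by blast
  have "compositum \<Omega> (N (min (Suc i) k)) (N' (min (Suc i) k')) \<subset> compositum \<Omega> (N (min i k)) (N' (min i k'))"
    if i: "i < max k k'" for i
  proof (rule compositum_strict_mono)
    show "finite_field_ext \<Omega> K (N (min i k))" "finite_field_ext \<Omega> K (N' (min i k'))" using fN fN' by auto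
    show "N (min i k) \<subseteq> P" "N' (min i k') \<subseteq> Q" using fN[of i] fN'[of i] assms(2,4) by auto
    show "intermediate_field \<Omega> K (N (min i k)) (N (min (Suc i) k))"
      "intermediate_field \<Omega> K (N' (min i k')) (N' (min (Suc i) k'))"
      using link[OF assms(5)] link[OF assms(6)] unfolding max_galois_base_def by blast+
    show "N (min (Suc i) k) \<subset> N (min i k) \<or> N' (min (Suc i) k') \<subset> N' (min i k')"
      using strict[OF assms(5)] strict[OF assms(6)] i by (metis less_max_iff_disj)
  qed
  \<comment> \<open>At the index \<open>max k k'\<close> both truncated chains are constant, so the
    step there is the stabilization of the combined chain.\<close>
  moreover have "min (max k k') k = min (Suc (max k k')) k" "min (max k k') k' = min (Suc (max k k')) k'" by auto
  ultimately show ?thesis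
    using step step[of "max k k'"] assms(5,6) unfolding descending_chain_def by simp
qed

text \<open>In contrast to the descending case the top fields \<open>L\<close> and \<open>J\<close>
  stay fixed and the base moves, so each step refers to the whole of \<open>LJ\<close>.\<close>

lemma ascending_chain_compositum:
  assumes "finite_field_ext \<Omega> K L" "L \<subseteq> P" "finite_field_ext \<Omega> K J" "J \<subseteq> Q"
    and "ascending_chain \<Omega> K L l F" "ascending_chain \<Omega> K J l' F'"
  shows "ascending_chain \<Omega> K (compositum \<Omega> L J) (max l l') (\<lambda>j. compositum \<Omega> (F (min j l)) (F' (min j l')))"
proof -
  have link: "largest_galois_subext \<Omega> (C (min i n)) E (C (min (Suc i) n))" if "ascending_chain \<Omega> K E n C" for C E i n
    using that unfolding ascending_chain_def by (cases "i < n") (auto simp: min_def not_less le_Suc_eq)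
  have field: "intermediate_field \<Omega> K E (C (min i n))"
    if "finite_field_ext \<Omega> K E" "ascending_chain \<Omega> K E n C" for C E i n
  proof (induction i)
    case 0
    thus ?case using that finite_field_ext_subfields[OF that(1)]
      unfolding ascending_chain_def intermediate_field_def field_ext_def by simp
  next
    case (Suc i)
    have "intermediate_field \<Omega> (C (min i n)) E (C (min (Suc i) n))"
      using link[OF that(2)] unfolding largest_galois_subext_def by blast
    thus ?case using Suc unfolding intermediate_field_def field_ext_def by blast
  qed
  have nested: "intermediate_field \<Omega> K (C (min (Suc i) n)) (C (min i n))"
    if "finite_field_ext \<Omega> K E" "ascending_chain \<Omega> K E n C" for C E i n
  proof -
    have "field_ext \<Omega> K (C (min i n))" using field[OF that] unfolding intermediate_field_def by blast
    moreover have "field_ext \<Omega> (C (min i n)) (C (min (Suc i) n))"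
      using link[OF that(2)] unfolding largest_galois_subext_def intermediate_field_def by blast
    ultimately show ?thesis unfolding intermediate_field_def by blast
  qed
  have strict: "C (min i n) \<subset> C (min (Suc i) n)" if "ascending_chain \<Omega> K E n C" "i < n" for C E i n
    using that unfolding ascending_chain_def by (auto simp: min_def)
  note fF = field[OF assms(1,5)] and fF' = field[OF assms(3,6)]
  have step: "largest_galois_subext \<Omega> (compositum \<Omega> (F (min j l)) (F' (min j l'))) (compositum \<Omega> L J)
      (compositum \<Omega> (F (min (Suc j) l)) (F' (min (Suc j) l')))" for j
    using largest_galois_subext_compositum[OF assms(1-4) fF fF' link[OF assms(5)] link[OF assms(6)]] .
  have "compositum \<Omega> (F (min j l)) (F' (min j l')) \<subset> compositum \<Omega> (F (min (Suc j) l)) (F' (min (Suc j) l'))"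
    if j: "j < max l l'" for j
  proof (rule compositum_strict_mono)
    show "finite_field_ext \<Omega> K (F (min (Suc j) l))" "finite_field_ext \<Omega> K (F' (min (Suc j) l'))"
      using intermediate_finite(1)[OF assms(1) fF] intermediate_finite(1)[OF assms(3) fF'] .
    show "F (min (Suc j) l) \<subseteq> P" "F' (min (Suc j) l') \<subseteq> Q"
      using fF[of "Suc j"] fF'[of "Suc j"] assms(2,4) unfolding intermediate_field_def field_ext_def by auto
    show "intermediate_field \<Omega> K (F (min (Suc j) l)) (F (min j l))"
      "intermediate_field \<Omega> K (F' (min (Suc j) l')) (F' (min j l'))"
      using nested[OF assms(1,5)] nested[OF assms(3,6)] .
    show "F (min j l) \<subset> F (min (Suc j) l) \<or> F' (min j l') \<subset> F' (min (Suc j) l')"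
      using strict[OF assms(5)] strict[OF assms(6)] j by (metis less_max_iff_disj)
  qed
  moreover have "min (max l l') l = min (Suc (max l l')) l" "min (max l l') l' = min (Suc (max l l')) l'" by auto
  moreover have "compositum \<Omega> K K = K" using compositum_least[OF base] compositum_upper(1)[of K K] by blast
  ultimately show ?thesis
    using step step[of "max l l'"] assms(5,6) unfolding ascending_chain_def by simp
qed

end

section \<open>Normal closures and passage to the theorem\<close>

context closed_field
begin

lemma normal_closure_props:
  assumes "subfield K \<Omega>" "\<And>x. x \<in> carrier \<Omega> \<Longrightarrow> (algebraic over K) x" "L \<subseteq> carrier \<Omega>"
  shows "subfield (normal_closure \<Omega> K L) \<Omega>" "K \<subseteq> normal_closure \<Omega> K L" "L \<subseteq> normal_closure \<Omega> K L"
    "\<And>x. x \<in> normal_closure \<Omega> K L \<Longrightarrow> conjugates K x \<subseteq> normal_closure \<Omega> K L"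
proof -
  let ?S = "{E. L \<subseteq> E \<and> normal_ext \<Omega> K E}"
  have E: "subfield E \<Omega>" "K \<subseteq> E" "\<And>x. x \<in> E \<Longrightarrow> conjugates K x \<subseteq> E" if "E \<in> ?S" for E
    using that unfolding normal_ext_iff algebraic_field_ext_def field_ext_def by blast+
  \<comment> \<open>Since \<open>\<Omega>\<close> is algebraic over \<open>K\<close>, it is itself a
    normal extension containing \<open>L\<close>; thus the intersection is taken over a nonempty
    family.\<close>
  have "carrier \<Omega> \<in> ?S"
    using assms carrier_is_subfield conjugates_carrier subfieldE(3)[OF assms(1)]
    unfolding normal_ext_iff algebraic_field_ext_def field_ext_def over_def by blast
  hence ne: "?S \<noteq> {}" by blast
  show "subfield (normal_closure \<Omega> K L) \<Omega>"
    unfolding normal_closure_def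
  proof (rule subfieldI')
    show "subring (\<Inter>?S) \<Omega>" using subring_Inter[OF _ ne] subfieldE(1)[OF E(1)] by blast
    show "inv k \<in> \<Inter>?S" if k: "k \<in> \<Inter>?S - {\<zero>}" for k
      using subfield_m_inv(1)[OF E(1)] k by blast
  qed
  show "K \<subseteq> normal_closure \<Omega> K L" using E(2) unfolding normal_closure_def by blast
  show "L \<subseteq> normal_closure \<Omega> K L" unfolding normal_closure_def by blast
  show "conjugates K x \<subseteq> normal_closure \<Omega> K L" if "x \<in> normal_closure \<Omega> K L" for x
    using E(3) that unfolding normal_closure_def by blast
qed

lemma magnification_disjoint_normal_fields:
  assumes "subfield K \<Omega>" "\<And>x. x \<in> carrier \<Omega> \<Longrightarrow> (algebraic over K) x" "L \<subseteq> carrier \<Omega>" "J \<subseteq> carrier \<Omega>"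
    and "linearly_disjoint \<Omega> K (normal_closure \<Omega> K L) (normal_closure \<Omega> K J)"
  shows "disjoint_normal_fields \<Omega> K (normal_closure \<Omega> K L) (normal_closure \<Omega> K J)"
  using normal_closure_props[OF assms(1,2,3)] normal_closure_props[OF assms(1,2,4)] assms(1,5) closed_field_axioms
  unfolding disjoint_normal_fields_def disjoint_normal_fields_axioms_def by blast

end

text \<open>Justifies replacing the case distinctions on indices in the theorem by truncated
  indices: the two sequences agree up to the last index.\<close>

lemma descending_chain_cong:
  assumes "\<And>i. i \<le> k \<Longrightarrow> N i = N' i"
  shows "descending_chain \<Omega> K E k N \<longleftrightarrow> descending_chain \<Omega> K E k N'"
  using assms unfolding descending_chain_def by simp

lemma ascending_chain_cong:
  assumes "\<And>j. j \<le> l \<Longrightarrow> F j = F' j"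
  shows "ascending_chain \<Omega> K E l F \<longleftrightarrow> ascending_chain \<Omega> K E l F'"
  using assms unfolding ascending_chain_def by simp

theorem proposition3p13:
  fixes \<Omega> :: "('a, 'b) ring_scheme" and K L J M :: "'a set"
  assumes "algebraic_closure \<Omega> K"
    and "general_normal_magnification \<Omega> K L J M"
  shows "(\<forall>k k' N N'.
            descending_chain \<Omega> K L k N \<and> descending_chain \<Omega> K J k' N' \<longrightarrow>
            (k \<ge> k' \<longrightarrow> descending_chain \<Omega> K M k
               (\<lambda>i. if i \<le> k' then compositum \<Omega> (N i) (N' i) else compositum \<Omega> (N i) (N' k'))) \<and>
            (k < k' \<longrightarrow> descending_chain \<Omega> K M k'
               (\<lambda>i. if i \<le> k then compositum \<Omega> (N i) (N' i) else compositum \<Omega> (N k) (N' i))))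
       \<and> (\<forall>l l' F F'.
            ascending_chain \<Omega> K L l F \<and> ascending_chain \<Omega> K J l' F' \<longrightarrow>
            (l \<ge> l' \<longrightarrow> ascending_chain \<Omega> K M l
               (\<lambda>j. if j \<le> l' then compositum \<Omega> (F j) (F' j) else compositum \<Omega> (F j) (F' l'))) \<and>
            (l < l' \<longrightarrow> ascending_chain \<Omega> K M l'
               (\<lambda>j. if j \<le> l then compositum \<Omega> (F j) (F' j) else compositum \<Omega> (F l) (F' j))))"
proof -
  interpret C: algebraic_closure \<Omega> K using assms(1) .
  interpret closed_field \<Omega> by unfold_locales
  have m: "finite_field_ext \<Omega> K M" "intermediate_field \<Omega> K M L" "finite_field_ext \<Omega> K J"
    "linearly_disjoint \<Omega> K (normal_closure \<Omega> K L) (normal_closure \<Omega> K J)" "compositum \<Omega> L J = M"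
    using assms(2) unfolding general_normal_magnification_def by auto
  have L: "finite_field_ext \<Omega> K L" using intermediate_finite(1)[OF m(1,2)] .
  have sub: "L \<subseteq> carrier \<Omega>" "J \<subseteq> carrier \<Omega>"
    using finite_field_ext_subfields(4)[OF L] finite_field_ext_subfields(4)[OF m(3)] .
  interpret D: disjoint_normal_fields \<Omega> K "normal_closure \<Omega> K L" "normal_closure \<Omega> K J"
    using magnification_disjoint_normal_fields[OF C.subfield_axioms C.algebraic_extension sub m(4)] .
  have nc: "L \<subseteq> normal_closure \<Omega> K L" "J \<subseteq> normal_closure \<Omega> K J" unfolding normal_closure_def by auto
  show ?thesis
  proof (intro conjI allI impI; elim conjE)
    fix k k' N N' assume c: "descending_chain \<Omega> K L k N" "descending_chain \<Omega> K J k' N'"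
    note d = D.descending_chain_compositum[OF L nc(1) m(3) nc(2) c, unfolded m(5)]
    show "descending_chain \<Omega> K M k
        (\<lambda>i. if i \<le> k' then compositum \<Omega> (N i) (N' i) else compositum \<Omega> (N i) (N' k'))" if "k \<ge> k'"
      using d that by (subst descending_chain_cong[where N' = "\<lambda>i. compositum \<Omega> (N (min i k)) (N' (min i k'))"])
        (auto simp: min_def max_def)
    show "descending_chain \<Omega> K M k'
        (\<lambda>i. if i \<le> k then compositum \<Omega> (N i) (N' i) else compositum \<Omega> (N k) (N' i))" if "k < k'"
      using d that by (subst descending_chain_cong[where N' = "\<lambda>i. compositum \<Omega> (N (min i k)) (N' (min i k'))"])
        (auto simp: min_def max_def)
  next
    fix l l' F F' assume c: "ascending_chain \<Omega> K L l F" "ascending_chain \<Omega> K J l' F'"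
    note d = D.ascending_chain_compositum[OF L nc(1) m(3) nc(2) c, unfolded m(5)]
    show "ascending_chain \<Omega> K M l
        (\<lambda>j. if j \<le> l' then compositum \<Omega> (F j) (F' j) else compositum \<Omega> (F j) (F' l'))" if "l \<ge> l'"
      using d that by (subst ascending_chain_cong[where F' = "\<lambda>j. compositum \<Omega> (F (min j l)) (F' (min j l'))"])
        (auto simp: min_def max_def)
    show "ascending_chain \<Omega> K M l'
        (\<lambda>j. if j \<le> l then compositum \<Omega> (F j) (F' j) else compositum \<Omega> (F l) (F' j))" if "l < l'"
      using d that by (subst ascending_chain_cong[where F' = "\<lambda>j. compositum \<Omega> (F (min j l)) (F' (min j l'))"])
        (auto simp: min_def max_def)
  qed
qed

end
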